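(* Let $T$ be a tree satisfying $\sigma(T)=\tau_{\mathrm{ind}}(T)$ and containing a critical edge. Then $$\mathrm{ex}(n,K_3,T^{\triangle})\le\left|\mathcal{S}_{\mathrm{bi}}(n,\sigma(T)-1)\right|\quad\text{for all sufficiently large } n.$$ In particular, if $T$ is a strongly edge-critical tree, then $\mathrm{ex}(n,K_3,T^{\triangle})=\left|\mathcal{S}_{\mathrm{bi}}(n,\sigma(T)-1)\right|$ for all sufficiently large $n$.
   Context: For a graph $F$, $|F|$ is its number of edges and $F-I$ the subgraph induced on $V(F)\setminus I$. The crosscut number is $\sigma(F)=\min\{|I|+|F-I| : I \text{ independent in } F\}$; $\tau(F)$ is the minimum size of a vertex cover. For bipartite $F$, $\tau_{\mathrm{ind}}(F)$ is the minimum size of $S\subseteq V(F)$ with $|S\cap e|=1$ for every edge $e$. An edge $e$ of a tree $T$ is critical if $\sigma(T\setminus e)\le\sigma(T)-1$ ($T\setminus e$: delete the edge, keep vertices); $T$ is strongly edge-critical if $\tau(T)=\sigma(T)=\tau_{\mathrm{ind}}(T)$ and $T$ has a critical edge. The $\triangle$-blowup $F^{\triangle}$ of a graph $F$ is the graph obtained by replacing each edge $uv$ of $F$ by a triangle $uvw_{uv}$ with a new vertex $w_{uv}$, distinct edges receiving distinct new vertices. $\mathrm{ex}(n,K_3,F^{\triangle})$ is the maximum number of triangles in an $n$-vertex graph containing no copy of $F^{\triangle}$. $T(m)$ denotes the balanced complete bipartite graph on $m$ vertices; $S(n,t)=K_t \vee T(n-t)$ is the join of $K_t$ and $T(n-t)$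 (disjoint copies plus all edges between them). $\mathcal{S}_{\mathrm{bi}}(n,t)$ is the set of $3$-subsets of $V(S(n,t))$ that induce a triangle in $S(n,t)$. *)

theory Defs
  imports Main
begin

type_synonym 'a graph = "'a set \<times> 'a set set"

definition verts :: "'a graph \<Rightarrow> 'a set" where "verts G = fst G"
definition edges :: "'a graph \<Rightarrow> 'a set set" where "edges G = snd G"

definition wf_graph :: "'a graph \<Rightarrow> bool" where
  "wf_graph G \<longleftrightarrow> finite (verts G) \<and>
     (\<forall>e\<in>edges G. \<exists>x y. x \<noteq> y \<and> e = {x, y} \<and> x \<in> verts G \<and> y \<in> verts G)"

definition adj :: "'a graph \<Rightarrow> 'a \<Rightarrow> 'a \<Rightarrow> bool" where
  "adj G x y \<longleftrightarrow> {x, y} \<in> edges G"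

definition connected_graph :: "'a graph \<Rightarrow> bool" where
  "connected_graph G \<longleftrightarrow> (\<forall>x\<in>verts G. \<forall>y\<in>verts G. (adj G)\<^sup>*\<^sup>* x y)"

definition is_cycle :: "'a graph \<Rightarrow> 'a list \<Rightarrow> bool" where
  "is_cycle G xs \<longleftrightarrow> length xs \<ge> 3 \<and> distinct xs \<and> set xs \<subseteq> verts G \<and>
     (\<forall>i<length xs. {xs ! i, xs ! ((i + 1) mod length xs)} \<in> edges G)"

definition is_tree :: "'a graph \<Rightarrow> bool" where
  "is_tree G \<longleftrightarrow> wf_graph G \<and> verts G \<noteq> {} \<and> connected_graph G \<and> (\<nexists>xs. is_cycle G xs)"

definition independent :: "'a graph \<Rightarrow> 'a set \<Rightarrow> bool" where
  "independent G I \<longleftrightarrow> I \<subseteq> verts G \<and> (\<forall>e\<in>edges G. \<not> e \<subseteq> I)"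

definition edges_minus :: "'a graph \<Rightarrow> 'a set \<Rightarrow> 'a set set" where
  "edges_minus G I = {e \<in> edges G. e \<inter> I = {}}"

definition sigma :: "'a graph \<Rightarrow> nat" where
  "sigma G = Min {card I + card (edges_minus G I) | I. independent G I}"

definition tau :: "'a graph \<Rightarrow> nat" where
  "tau G = Min {card C | C. C \<subseteq> verts G \<and> (\<forall>e\<in>edges G. e \<inter> C \<noteq> {})}"

definition tau_ind :: "'a graph \<Rightarrow> nat" where
  "tau_ind G = Min {card S | S. S \<subseteq> verts G \<and> (\<forall>e\<in>edges G. card (S \<inter> e) = 1)}"

definition delete_edge :: "'a graph \<Rightarrow> 'a set \<Rightarrow> 'a graph" where
  "delete_edge G e = (verts G, edges G - {e})"

definition critical_edge :: "'a graph \<Rightarrow> 'a set \<Rightarrow> bool" where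
  "critical_edge T e \<longleftrightarrow> e \<in> edges T \<and> sigma (delete_edge T e) + 1 \<le> sigma T"

definition strongly_edge_critical :: "'a graph \<Rightarrow> bool" where
  "strongly_edge_critical T \<longleftrightarrow> is_tree T \<and> tau T = sigma T \<and> sigma T = tau_ind T \<and>
     (\<exists>e. critical_edge T e)"

definition tri_blowup :: "'a graph \<Rightarrow> ('a + 'a set) graph" where
  "tri_blowup F = (Inl ` verts F \<union> Inr ` edges F,
     (\<Union>e\<in>edges F. {Inl ` e} \<union> {{Inl x, Inr e} | x. x \<in> e}))"

definition contains_copy :: "'b graph \<Rightarrow> 'a graph \<Rightarrow> bool" where
  "contains_copy G H \<longleftrightarrow> (\<exists>f. inj_on f (verts H) \<and> f ` verts H \<subseteq> verts G \<and>
     (\<forall>e\<in>edges H. f ` e \<in> edges G))"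

definition triangles :: "'a graph \<Rightarrow> 'a set set" where
  "triangles G = {S. S \<subseteq> verts G \<and> card S = 3 \<and>
     (\<forall>x\<in>S. \<forall>y\<in>S. x \<noteq> y \<longrightarrow> {x, y} \<in> edges G)}"

text \<open>ex(n, K3, H): max number of triangles in an H-free graph on n vertices
  (vertex set {0..<n}, which is no loss of generality).\<close>
definition ex_K3 :: "nat \<Rightarrow> 'a graph \<Rightarrow> nat" where
  "ex_K3 n H = Max {card (triangles G) | G :: nat graph.
     wf_graph G \<and> verts G = {..<n} \<and> \<not> contains_copy G H}"

text \<open>S(n,t) = K_t join T(n-t) on vertex set {0..<n}: K_t on {0..<t}, the balanced
  complete bipartite graph T(n-t) on {t..<n} with parts {t..<t+(n-t) div 2} and the rest.\<close>
definition S_graph :: "nat \<Rightarrow> nat \<Rightarrow> nat graph" where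
  "S_graph n t = ({..<n}, {{x, y} | x y. x < n \<and> y < n \<and> x \<noteq> y \<and>
     (x < t \<or> y < t \<or> ((x < t + (n - t) div 2) \<noteq> (y < t + (n - t) div 2)))})"

definition S_bi :: "nat \<Rightarrow> nat \<Rightarrow> nat set set" where
  "S_bi n t = triangles (S_graph n t)"

end

theory Submission
  imports Complex_Main Defs
begin

text \<open>
  Since T is connected, sigma(T) = tau_ind(T) is the size t + 1 of a colour class A of T, and a
  critical edge forces A to contain a leaf. Call an edge of the host graph thick if it lies in more
  than 2|V(T)| triangles and thin otherwise. In a graph without the blowup of T the thick edges and
  the triangles of three thin edges (or three thick edges) are linear in number, so the thin edges
  form an almost triangle-free graph with at most n^2/4 + O(n) edges. All but o(n^2) thin edges have
  at most t common neighbours, since otherwise the common neighbours, each joined by a thick edge to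
  an end of the thin edge, allow a greedy embedding.

  Hence a graph with about t n^2/4 triangles has almost only triangles with exactly one thin edge.
  Their number is at most a quarter of the sum of the squared thick degrees, and the thick graph
  contains no large complete bipartite graph with t + 1 vertices on one side; this yields a set X of
  t vertices joined by thick edges to almost all vertices. The leaf in A shows that no triangle
  avoiding X meets a vertex dominated by X, so G - X is triangle-free up to few vertices. Each of
  the exceptional vertices loses about n/2 triangles, and the bound follows from Mantel's theorem.
\<close>

section \<open>Graphs and trees\<close>

text \<open>A copy of the blowup needs a private apex for every tree edge. Over a thick edge the
  apex can be chosen after everything else is placed. Over a thin edge it must be reserved during
  the embedding, and the next tree vertex has to come with an apex avoiding all occupied vertices.
  An occupied vertex must therefore spoil only boundedly many candidates, which holds if it would be
  joined to the current vertex by a thin edge. Hence the interest in common neighbours that are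
  thick towards one end and thin towards the other.

  Errors have two sizes. A quadratic error always carries a factor \<open>1 / D\<close> or a
  multiple of \<open>\<gamma>\<close>; a linear one is beaten by a large \<open>n\<close>. So
  \<open>\<gamma>\<close> is fixed by the size of \<open>T\<close>, then \<open>D\<close> and
  \<open>K\<close> by \<open>\<gamma>\<close>, then the threshold for \<open>n\<close>.

  The bound comes out exact because an exceptional vertex has at most \<open>t - 1\<close> thick
  neighbours in \<open>X\<close>, and so lies in about \<open>(t - 1) * n / 2\<close> instead of
  \<open>t * n / 2\<close> triangles with one vertex in \<open>X\<close>; this linear loss exceeds
  everything that such vertices can gain.\<close>

lemma wf_edgeE:
  assumes "wf_graph G" "e \<in> edges G"
  obtains x y where "x \<noteq> y" "e = {x, y}" "x \<in> verts G" "y \<in> verts G"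
  using assms unfolding wf_graph_def by blast

lemma wf_edgeD:
  assumes "wf_graph G" "{x, y} \<in> edges G"
  shows "x \<noteq> y" "x \<in> verts G" "y \<in> verts G"
  using assms by (auto elim!: wf_edgeE simp: doubleton_eq_iff)

lemma wf_edge_subset: "wf_graph G \<Longrightarrow> e \<in> edges G \<Longrightarrow> e \<subseteq> verts G"
  by (auto elim!: wf_edgeE)

lemma wf_edge_card: "wf_graph G \<Longrightarrow> e \<in> edges G \<Longrightarrow> card e = 2"
  by (auto elim!: wf_edgeE)

lemma wf_finite_verts: "wf_graph G \<Longrightarrow> finite (verts G)"
  by (simp add: wf_graph_def)

lemma wf_finite_edges: "wf_graph G \<Longrightarrow> finite (edges G)"
  by (rule finite_subset[of _ "Pow (verts G)"]) (auto dest: wf_edge_subset wf_finite_verts)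

text \<open>Trees as sets built from \<open>r\<close>, each new vertex \<open>w\<close> having
  exactly one neighbour \<open>p\<close> among the earlier ones. This is the induction principle
  behind the colouring, the edge count and the greedy embeddings. \<open>E\<close> may contain edges
  that leave \<open>S\<close>.\<close>

inductive grown :: "'a set set \<Rightarrow> 'a \<Rightarrow> 'a set \<Rightarrow> bool" for E r where
  root: "grown E r {r}"
| step: "\<lbrakk>grown E r S; w \<notin> S; p \<in> S; {p, w} \<in> E; \<And>q. q \<in> S \<Longrightarrow> {q, w} \<in> E \<Longrightarrow> q = p\<rbrakk>
    \<Longrightarrow> grown E r (insert w S)"

lemma grown_finite: "grown E r S \<Longrightarrow> finite S"
  by (induction rule: grown.induct) auto

lemma grown_root: "grown E r S \<Longrightarrow> r \<in> S"
  by (induction rule: grown.induct) auto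

text \<open>Supplies the path that closes a cycle with a vertex having two neighbours in
  \<open>S\<close>.\<close>

lemma grown_path:
  assumes "grown E r S" "p \<in> S" "q \<in> S"
  shows "\<exists>xs. xs \<noteq> [] \<and> hd xs = p \<and> last xs = q \<and> distinct xs \<and> set xs \<subseteq> S
      \<and> successively (\<lambda>x y. {x, y} \<in> E) xs"
  using assms
proof (induction arbitrary: p q rule: grown.induct)
  case root
  then show ?case by (intro exI[of _ "[r]"]) auto
next
  case (step S w p0)
  consider "p \<in> S" "q \<in> S" | "p = w" "q = w" | "p = w" "q \<in> S" | "p \<in> S" "q = w"
    using step.prems by blast
  then show ?case
  proof cases
    case 1
    then show ?thesis using step.IH by (meson subset_insertI2)
  next
    case 2
    then show ?thesis by (intro exI[of _ "[w]"]) auto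
  next
    case 3
    obtain xs where xs: "xs \<noteq> []" "hd xs = p0" "last xs = q" "distinct xs" "set xs \<subseteq> S"
      "successively (\<lambda>x y. {x, y} \<in> E) xs"
      using step.IH[OF step.hyps(3) 3(2)] by blast
    show ?thesis
      using xs 3 step.hyps(2,3,4) by (intro exI[of _ "w # xs"]) (auto simp: successively_Cons insert_commute)
  next
    case 4
    obtain xs where xs: "xs \<noteq> []" "hd xs = p" "last xs = p0" "distinct xs" "set xs \<subseteq> S"
      "successively (\<lambda>x y. {x, y} \<in> E) xs"
      using step.IH[OF 4(1) step.hyps(3)] by blast
    show ?thesis
      using xs 4 step.hyps(2,3,4) by (intro exI[of _ "xs @ [w]"]) (auto simp: successively_append_iff)
  qed
qed

text \<open>Take a largest grown set of vertices. If it misses a vertex, connectivity yields an edge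
  \<open>{p, w}\<close> leaving it. A second neighbour \<open>q\<close> of \<open>w\<close> in the
  set would close a cycle with the path from \<open>p\<close> to \<open>q\<close>, so
  \<open>w\<close> can be added after all.\<close>

lemma grown_tree:
  assumes "is_tree G" "r \<in> verts G"
  shows "grown (edges G) r (verts G)"
proof -
  have wf: "wf_graph G" and conn: "connected_graph G" and acyc: "\<nexists>xs. is_cycle G xs"
    using assms by (auto simp: is_tree_def)
  let ?P = "\<lambda>S. grown (edges G) r S \<and> S \<subseteq> verts G"
  have "?P {r}" using assms grown.root[of "edges G" r] by simp
  moreover have "\<forall>S. ?P S \<longrightarrow> card S < Suc (card (verts G))"
    using card_mono[OF wf_finite_verts[OF wf]] by (simp add: less_Suc_eq_le)
  ultimately have "\<exists>S. ?P S \<and> (\<forall>S'. ?P S' \<longrightarrow> card S' \<le> card S)"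
    by (rule ex_has_greatest_nat[where f = card])
  then obtain S where S: "?P S" and max: "\<And>S'. ?P S' \<Longrightarrow> card S' \<le> card S" by auto
  have "S = verts G"
  proof (rule ccontr)
    assume "S \<noteq> verts G"
    then obtain z where z: "z \<in> verts G" "z \<notin> S" using S by blast
    have "(adj G)\<^sup>*\<^sup>* r z" using conn z assms by (auto simp: connected_graph_def)
    then have "\<exists>p w. p \<in> S \<and> w \<notin> S \<and> adj G p w"
      using z(2)
    proof (induction rule: rtranclp_induct)
      case base
      then show ?case using S grown_root by metis
    qed blast
    then obtain p w where pw: "p \<in> S" "w \<notin> S" "{p, w} \<in> edges G" by (auto simp: adj_def)
    have uniq: "q = p" if q: "q \<in> S" "{q, w} \<in> edges G" for q
    proof (rule ccontr)
      assume "q \<noteq> p"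
      obtain xs where xs: "xs \<noteq> []" "hd xs = p" "last xs = q" "distinct xs" "set xs \<subseteq> S"
        "successively (\<lambda>x y. {x, y} \<in> edges G) xs"
        using grown_path[of "edges G" r S p q] S pw q by blast
      have len: "length xs \<ge> 2"
      proof (rule ccontr)
        assume "\<not> 2 \<le> length xs"
        then have "length xs = Suc 0" using xs(1) length_greater_0_conv[of xs] by linarith
        then show False using xs \<open>q \<noteq> p\<close> by (auto simp: length_Suc_conv)
      qed
      have "is_cycle G (xs @ [w])"
        unfolding is_cycle_def
      proof (intro conjI allI impI)
        show "3 \<le> length (xs @ [w])" using len by simp
        show "distinct (xs @ [w])" using xs pw by auto
        show "set (xs @ [w]) \<subseteq> verts G" using xs S pw wf_edgeD[OF wf pw(3)] by auto
        fix i assume i: "i < length (xs @ [w])"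
        consider "Suc i < length xs" | "Suc i = length xs" | "i = length xs" using i by fastforce
        then show "{(xs @ [w]) ! i, (xs @ [w]) ! ((i + 1) mod length (xs @ [w]))} \<in> edges G"
        proof cases
          case 1
          then show ?thesis using xs(6) by (simp add: successively_conv_nth nth_append)
        next
          case 2
          then have "xs ! i = q" using xs by (metis diff_Suc_1 last_conv_nth)
          then show ?thesis using 2 q by (simp add: nth_append)
        next
          case 3
          have "xs ! 0 = p" using xs by (simp add: hd_conv_nth)
          then show ?thesis using 3 pw xs(1) by (simp add: nth_append insert_commute)
        qed
      qed
      then show False using acyc by blast
    qed
    have "grown (edges G) r (insert w S)"
      using grown.step[of "edges G" r S w p] S pw uniq by blast
    moreover have "w \<in> verts G" using wf_edgeD[OF wf pw(3)] by simp
    ultimately have "card (insert w S) \<le> card S" using max S by blast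
    then show False using pw S grown_finite[of "edges G" r S] by simp
  qed
  then show ?thesis using S by simp
qed

lemma not_subset_singleton: "\<exists>x y. x \<noteq> y \<and> e = {x, y} \<Longrightarrow> \<not> e \<subseteq> {r}"
  by auto

lemma edges_insert:
  assumes "\<forall>e\<in>E. \<exists>x y. x \<noteq> y \<and> e = {x, y}" "{p, w} \<in> E" "p \<in> S" "w \<notin> S"
    "\<And>q. q \<in> S \<Longrightarrow> {q, w} \<in> E \<Longrightarrow> q = p"
  shows "{e\<in>E. e \<subseteq> insert w S} = insert {p, w} {e\<in>E. e \<subseteq> S}"
proof -
  have "e = {p, w}" if e: "e \<in> E" "e \<subseteq> insert w S" "\<not> e \<subseteq> S" for e
  proof -
    obtain x y where xy: "x \<noteq> y" "e = {x, y}" using assms(1) e(1) by blast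
    have "x = w \<or> y = w" using e(2,3) xy(2) by blast
    then obtain q where q: "e = {q, w}" "q \<noteq> w" using xy by fast
    then have "q \<in> S" using e(2) by simp
    then show ?thesis using assms(5)[of q] e(1) q(1) by simp
  qed
  moreover have "{p, w} \<subseteq> insert w S" using assms(3) by simp
  ultimately show ?thesis using assms(2) by blast
qed

lemma grown_bipartite:
  assumes "grown E r S" "\<forall>e\<in>E. \<exists>x y. x \<noteq> y \<and> e = {x, y}"
  shows "\<exists>C\<subseteq>S. \<forall>e\<in>E. e \<subseteq> S \<longrightarrow> card (C \<inter> e) = 1"
  using assms
proof (induction rule: grown.induct)
  case root
  have "\<not> e \<subseteq> {r}" if "e \<in> E" for e
    using that not_subset_singleton root(1) by metis
  then show ?case by blast
next
  case (step S w p)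
  obtain C where C: "C \<subseteq> S" "\<forall>e\<in>E. e \<subseteq> S \<longrightarrow> card (C \<inter> e) = 1"
    using step.IH step.prems by metis
  have es: "{e\<in>E. e \<subseteq> insert w S} = insert {p, w} {e\<in>E. e \<subseteq> S}"
    by (rule edges_insert[OF step.prems(1) step.hyps(4,3,2)]) (rule step.hyps(5))
  define C' where "C' = (if p \<in> C then C else insert w C)"
  have "card (C' \<inter> e) = 1" if "e \<in> E" "e \<subseteq> insert w S" for e
  proof -
    have "e \<in> insert {p, w} {e\<in>E. e \<subseteq> S}" using that unfolding es[symmetric] by simp
    then consider "e = {p, w}" | "e \<subseteq> S" by auto
    then show ?thesis
    proof cases
      case 1
      then have "C' \<inter> e = {p} \<or> C' \<inter> e = {w}"
        using step.hyps(2,3) C(1) by (auto simp: C'_def)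
      then show ?thesis by auto
    next
      case 2
      then have "C' \<inter> e = C \<inter> e" using step.hyps(2) by (auto simp: C'_def)
      then show ?thesis using C 2 that by simp
    qed
  qed
  moreover have "C' \<subseteq> insert w S" using C by (auto simp: C'_def)
  ultimately show ?case by blast
qed

text \<open>Removing the last vertex \<open>w\<close> removes at most one edge. The root in
  \<open>F\<close> keeps \<open>F - {w}\<close> nonempty; as any vertex of a tree can serve as root,
  the bound reaches all nonempty \<open>F\<close>.\<close>

lemma grown_edge_count:
  assumes "grown E r S" "\<forall>e\<in>E. \<exists>x y. x \<noteq> y \<and> e = {x, y}" "F \<subseteq> S" "r \<in> F"
  shows "card {e\<in>E. e \<subseteq> F} + 1 \<le> card F"
  using assms
proof (induction arbitrary: F rule: grown.induct)
  case root
  then have "F = {r}" by blast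
  moreover have "\<not> e \<subseteq> {r}" if "e \<in> E" for e
    using that not_subset_singleton root(1) by metis
  ultimately have "{e\<in>E. e \<subseteq> F} = {}" by blast
  then show ?case using \<open>F = {r}\<close> by (metis One_nat_def add_0 card.empty is_singletonI is_singleton_altdef le_refl)
next
  case (step S w p)
  have finS: "finite S" using grown_finite[OF step.hyps(1)] .
  show ?case
  proof (cases "w \<in> F")
    case False
    then have "F \<subseteq> S" using step.prems(2) by blast
    then show ?thesis using step.IH[OF step.prems(1)] step.prems(3) by blast
  next
    case True
    let ?F = "F - {w}"
    have rw: "r \<noteq> w" using grown_root step.hyps by metis
    have finF: "finite F" using step.prems finS finite_subset by blast
    have IH: "card {e\<in>E. e \<subseteq> ?F} + 1 \<le> card ?F" using step.prems rw by (intro step.IH[OF step.prems(1)]) auto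
    have es: "{e\<in>E. e \<subseteq> insert w S} = insert {p, w} {e\<in>E. e \<subseteq> S}"
      by (rule edges_insert[OF step.prems(1) step.hyps(4,3,2)]) (rule step.hyps(5))
    have "{e\<in>E. e \<subseteq> F} \<subseteq> insert {p, w} {e\<in>E. e \<subseteq> ?F}"
    proof
      fix e assume e: "e \<in> {e\<in>E. e \<subseteq> F}"
      then have "e \<in> insert {p, w} {e\<in>E. e \<subseteq> S}"
        using step.prems(2) unfolding es[symmetric] by auto
      then have "e = {p, w} \<or> e \<subseteq> S" by auto
      then show "e \<in> insert {p, w} {e\<in>E. e \<subseteq> ?F}" using e step.hyps(2) by blast
    qed
    moreover have "finite {e\<in>E. e \<subseteq> ?F}"
      by (rule finite_subset[of _ "Pow F"]) (use finF in auto)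
    ultimately have "card {e\<in>E. e \<subseteq> F} \<le> card {e\<in>E. e \<subseteq> ?F} + 1"
      using card_mono[of "insert {p, w} {e\<in>E. e \<subseteq> ?F}" "{e\<in>E. e \<subseteq> F}"]
      by (simp add: card_insert_if split: if_splits)
    then show ?thesis using IH True finF by (simp add: card_Diff_singleton)
  qed
qed

lemma tree_edge_count:
  assumes "is_tree G" "F \<subseteq> verts G" "F \<noteq> {}"
  shows "card {e\<in>edges G. e \<subseteq> F} + 1 \<le> card F"
proof -
  obtain r where r: "r \<in> F" using assms by blast
  then show ?thesis
    using grown_edge_count[OF grown_tree[OF assms(1)]] assms
    by (metis (no_types, lifting) is_tree_def subsetD wf_graph_def)
qed

lemma tree_edges_less_verts:
  assumes "is_tree G"
  shows "card (edges G) < card (verts G)"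
proof -
  have "{e\<in>edges G. e \<subseteq> verts G} = edges G"
    using wf_edge_subset[of G] assms by (auto simp: is_tree_def)
  then show ?thesis using tree_edge_count[of G "verts G"] assms by (auto simp: is_tree_def)
qed

text \<open>The minimum is taken over a nonempty set because trees are bipartite. Minimality is kept
  in the statement: it will exclude an isolated vertex in \<open>A\<close>.\<close>

lemma tau_ind_attained:
  assumes "is_tree T"
  shows "\<exists>A\<subseteq>verts T. (\<forall>e\<in>edges T. card (A \<inter> e) = 1) \<and> card A = tau_ind T
    \<and> (\<forall>S. S \<subseteq> verts T \<and> (\<forall>e\<in>edges T. card (S \<inter> e) = 1) \<longrightarrow> card A \<le> card S)"
proof -
  have wf: "wf_graph T" using assms by (simp add: is_tree_def)
  obtain r where r: "r \<in> verts T" using assms by (auto simp: is_tree_def)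
  have two: "\<forall>e\<in>edges T. \<exists>x y. x \<noteq> y \<and> e = {x, y}" using wf unfolding wf_graph_def by blast
  obtain C where C: "C \<subseteq> verts T" "\<forall>e\<in>edges T. e \<subseteq> verts T \<longrightarrow> card (C \<inter> e) = 1"
    using grown_bipartite[OF grown_tree[OF assms r] two] by blast
  let ?Q = "{card S | S. S \<subseteq> verts T \<and> (\<forall>e\<in>edges T. card (S \<inter> e) = 1)}"
  have fin: "finite ?Q"
    by (rule finite_subset[of _ "card ` Pow (verts T)"]) (use wf_finite_verts[OF wf] in auto)
  have "card C \<in> ?Q" using C wf_edge_subset[OF wf] by blast
  then have "Min ?Q \<in> ?Q" using Min_in[OF fin] by blast
  then obtain A where A: "A \<subseteq> verts T" "\<forall>e\<in>edges T. card (A \<inter> e) = 1" "card A = Min ?Q" by auto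
  have "card A \<le> card S" if "S \<subseteq> verts T" "\<forall>e\<in>edges T. card (S \<inter> e) = 1" for S
  proof -
    have "card S \<in> ?Q" using that by blast
    then show ?thesis using A(3) fin by simp
  qed
  then show ?thesis using A by (intro exI[of _ A]) (simp add: tau_ind_def)
qed

lemma sigma_attained:
  assumes "wf_graph G"
  obtains I where "Defs.independent G I" "card I + card (edges_minus G I) = sigma G"
proof -
  let ?Q = "{card I + card (edges_minus G I) | I. Defs.independent G I}"
  have fin: "finite ?Q"
    by (rule finite_subset[of _ "(\<lambda>I. card I + card (edges_minus G I)) ` Pow (verts G)"])
      (use wf_finite_verts[OF assms] in \<open>auto simp: Defs.independent_def\<close>)
  have "Defs.independent G {}" using assms unfolding Defs.independent_def wf_graph_def by blast
  then have "?Q \<noteq> {}" by blast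
  then have "Min ?Q \<in> ?Q" using Min_in[OF fin] by blast
  then show thesis using that unfolding sigma_def by auto
qed

text \<open>If every vertex of A had degree at least two, then deleting one edge would leave Hall's
  condition for A intact, so every cover of the remaining forest, and hence every crosscut,
  would have at least |A| elements.\<close>
lemma critical_leaf:
  assumes tree: "is_tree T" and crit: "critical_edge T e0"
    and A: "A \<subseteq> verts T" "\<And>e. e \<in> edges T \<Longrightarrow> card (A \<inter> e) = 1" "card A = sigma T"
  shows "\<exists>l\<in>A. card {e\<in>edges T. l \<in> e} \<le> 1"
proof (rule ccontr)
  assume "\<not> ?thesis"
  then have deg: "\<And>l. l \<in> A \<Longrightarrow> 2 \<le> card {e\<in>edges T. l \<in> e}" by force
  have wf: "wf_graph T" using tree by (simp add: is_tree_def)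
  have finV: "finite (verts T)" and finE: "finite (edges T)"
    using wf_finite_verts[OF wf] wf_finite_edges[OF wf] by auto
  let ?D = "delete_edge T e0"
  have D: "verts ?D = verts T" "edges ?D = edges T - {e0}"
    by (auto simp: delete_edge_def verts_def edges_def)
  have wfD: "wf_graph ?D" using wf unfolding wf_graph_def D by blast
  obtain I where I: "Defs.independent ?D I" "card I + card (edges_minus ?D I) = sigma ?D"
    using sigma_attained[OF wfD] by blast
  let ?J = "edges_minus ?D I"
  have "\<forall>e\<in>?J. \<exists>x. x \<in> e" using wfD unfolding edges_minus_def wf_graph_def by blast
  then obtain g where g: "\<And>e. e \<in> ?J \<Longrightarrow> g e \<in> e" by metis
  define C where "C = I \<union> g ` ?J"
  have finJ: "finite ?J" using finE by (simp add: edges_minus_def D)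
  have cC: "card C < card A"
  proof -
    have "card C \<le> card I + card ?J"
      unfolding C_def using card_Un_le[of I "g ` ?J"] card_image_le[OF finJ, of g] by linarith
    then show ?thesis using I(2) crit A(3) by (simp add: critical_edge_def)
  qed
  have cover: "C \<inter> e \<noteq> {}" if "e \<in> edges T" "e \<noteq> e0" for e
  proof (cases "e \<inter> I = {}")
    case True
    then have "e \<in> ?J" using that by (simp add: edges_minus_def D)
    then show ?thesis using g by (auto simp: C_def)
  qed (auto simp: C_def)
  have CV: "C \<subseteq> verts T"
  proof -
    have "g e \<in> verts T" if "e \<in> ?J" for e
      using g[OF that] that wf_edge_subset[OF wf, of e] by (auto simp: edges_minus_def D)
    then show ?thesis using I(1) by (auto simp: C_def Defs.independent_def D)
  qed
  have finA: "finite A" and finC: "finite C" using A(1) CV finV finite_subset by blast+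
  define S where "S = A - C"
  \<comment> \<open>Every edge at \<open>S\<close>, except possibly \<open>e0\<close>, runs inside
    \<open>F\<close>, because its other end lies in the cover and not in \<open>A\<close>. With
    degrees at least two this yields \<open>2 * card S \<le> card F\<close>, so \<open>A - C\<close>
    is no larger than \<open>C - A\<close>, contrary to \<open>card C < card A\<close>.\<close>
  define F where "F = S \<union> (C - A)"
  have "S \<noteq> {}"
    using cC card_mono[OF finC, of A] by (auto simp: S_def)
  then have F1: "card {e\<in>edges T. e \<subseteq> F} + 1 \<le> card F"
    using A CV by (intro tree_edge_count[OF tree]) (auto simp: F_def S_def)
  let ?ES = "{e\<in>edges T. e \<inter> S \<noteq> {}}"
  have "?ES \<subseteq> insert e0 {e\<in>edges T. e \<subseteq> F}"
  proof
    fix e assume e: "e \<in> ?ES"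
    then obtain s where s: "s \<in> S" "s \<in> e" by blast
    show "e \<in> insert e0 {e\<in>edges T. e \<subseteq> F}"
    proof (cases "e = e0")
      case False
      obtain b where b: "e = {s, b}" "s \<noteq> b" using e s wf by (auto elim!: wf_edgeE)
      have "b \<notin> A"
      proof
        assume "b \<in> A"
        then have "A \<inter> e = {s, b}" using s b by (auto simp: S_def)
        then show False using A(2)[of e] e b by simp
      qed
      moreover have "b \<in> C" using cover[of e] e False b s by (auto simp: S_def)
      ultimately show ?thesis using e b s by (auto simp: F_def)
    qed simp
  qed
  then have "card ?ES \<le> card {e\<in>edges T. e \<subseteq> F} + 1"
    using card_mono[of "insert e0 {e\<in>edges T. e \<subseteq> F}" ?ES] finE
    by (simp add: card_insert_if split: if_splits)
  then have ESF: "card ?ES \<le> card F" using F1 by linarith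
  have "?ES = (\<Union>s\<in>S. {e\<in>edges T. s \<in> e})" by blast
  moreover have "card (\<Union>s\<in>S. {e\<in>edges T. s \<in> e}) = (\<Sum>s\<in>S. card {e\<in>edges T. s \<in> e})"
  proof (rule card_UN_disjoint)
    show "\<forall>i\<in>S. \<forall>j\<in>S. i \<noteq> j \<longrightarrow> {e \<in> edges T. i \<in> e} \<inter> {e \<in> edges T. j \<in> e} = {}"
    proof (intro ballI impI)
      fix i j assume ij: "i \<in> S" "j \<in> S" "i \<noteq> j"
      have "\<not> (i \<in> e \<and> j \<in> e)" if "e \<in> edges T" for e
      proof
        assume "i \<in> e \<and> j \<in> e"
        then have "{i, j} \<subseteq> A \<inter> e" using ij by (auto simp: S_def)
        then have "card {i, j} \<le> card (A \<inter> e)" using finA by (intro card_mono) auto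
        then show False using A(2)[OF that] ij by simp
      qed
      then show "{e \<in> edges T. i \<in> e} \<inter> {e \<in> edges T. j \<in> e} = {}" by blast
    qed
  qed (use finA finE in \<open>auto simp: S_def\<close>)
  moreover have "(\<Sum>s\<in>S. 2) \<le> (\<Sum>s\<in>S. card {e\<in>edges T. s \<in> e})"
    using deg by (intro sum_mono) (auto simp: S_def)
  ultimately have "2 * card S \<le> card F" using ESF by simp
  moreover have "card F \<le> card S + card (C - A)" unfolding F_def by (rule card_Un_le)
  moreover have "card A = card (A \<inter> C) + card S"
    using card_Int_Diff[OF finA, of C] by (simp add: S_def)
  moreover have "card C = card (A \<inter> C) + card (C - A)"
    using card_Int_Diff[OF finC, of A] by (simp add: Int_commute)
  ultimately show False using cC by linarith
qed

section \<open>Greedy embeddings\<close>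

text \<open>The common neighbourhood; over an edge these are its possible apexes.\<close>

definition cn :: "'b graph \<Rightarrow> 'b set \<Rightarrow> 'b set" where
  "cn G e = {w \<in> verts G. \<forall>x\<in>e. {x, w} \<in> edges G}"

lemma finite_cn: "wf_graph G \<Longrightarrow> finite (cn G e)"
  by (simp add: cn_def wf_finite_verts)

text \<open>Distinct representatives can be picked one by one, since fewer than
  \<open>card U + card F\<close> vertices are blocked at any moment.\<close>

lemma sdr_avoiding:
  assumes "finite F" "\<And>e. e \<in> F \<Longrightarrow> card U + card F \<le> card (N e)" "finite U"
  shows "\<exists>g. inj_on g F \<and> (\<forall>e\<in>F. g e \<in> N e - U)"
  using assms
proof (induction F rule: finite_induct)
  case (insert a F)
  have "\<exists>g. inj_on g F \<and> (\<forall>e\<in>F. g e \<in> N e - U)"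
  proof (rule insert.IH)
    fix e assume "e \<in> F"
    then have "card U + card (insert a F) \<le> card (N e)" using insert.prems(1)[of e] by simp
    then show "card U + card F \<le> card (N e)" using insert.hyps by simp
  qed (rule insert.prems(2))
  then obtain g where g: "inj_on g F" "\<forall>e\<in>F. g e \<in> N e - U" by auto
  have "card (U \<union> g ` F) < card (N a)"
  proof -
    have "card (U \<union> g ` F) \<le> card U + card (g ` F)" by (rule card_Un_le)
    moreover have "card (g ` F) \<le> card F" by (rule card_image_le[OF insert.hyps(1)])
    moreover have "card U + card (insert a F) \<le> card (N a)" using insert.prems(1) by simp
    ultimately show ?thesis using insert.hyps by simp
  qed
  then have "\<not> N a \<subseteq> U \<union> g ` F"
    using card_mono[of "U \<union> g ` F" "N a"] insert.hyps(1) insert.prems(2) by auto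
  then obtain x where x: "x \<in> N a" "x \<notin> U" "x \<notin> g ` F" by auto
  have "inj_on (g(a := x)) (insert a F)"
    using g(1) x(3) insert.hyps(2) by (auto simp: inj_on_def)
  moreover have "\<forall>e\<in>insert a F. (g(a := x)) e \<in> N e - U"
    using g(2) x insert.hyps(2) by auto
  ultimately show ?case by blast
qed auto

text \<open>The apexes over \<open>E0\<close> are already fixed. The others come last, when at most
  \<open>card (verts T) + card E0\<close> vertices are occupied, so the common neighbourhoods in
  \<open>rest\<close> never run out.\<close>

lemma complete_copy:
  assumes wT: "wf_graph T" and wG: "wf_graph G"
    and f: "inj_on f (verts T)" "f ` verts T \<subseteq> verts G"
    and fE: "\<And>e. e \<in> edges T \<Longrightarrow> f ` e \<in> edges G"
    and E0: "E0 \<subseteq> edges T" "inj_on g E0" "\<And>e. e \<in> E0 \<Longrightarrow> g e \<in> cn G (f ` e) - f ` verts T"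
    and rest: "\<And>e. e \<in> edges T - E0 \<Longrightarrow> card (verts T) + card (edges T) \<le> card (cn G (f ` e))"
  shows "contains_copy G (tri_blowup T)"
proof -
  have finE: "finite (edges T)" and finV: "finite (verts T)"
    using wf_finite_edges[OF wT] wf_finite_verts[OF wT] by auto
  have finE0: "finite E0" using finE E0(1) finite_subset by blast
  let ?U = "f ` verts T \<union> g ` E0"
  have "\<exists>g'. inj_on g' (edges T - E0) \<and> (\<forall>e\<in>edges T - E0. g' e \<in> cn G (f ` e) - ?U)"
  proof (rule sdr_avoiding)
    fix e assume e: "e \<in> edges T - E0"
    have "card ?U \<le> card (f ` verts T) + card (g ` E0)" by (rule card_Un_le)
    moreover have "card (f ` verts T) \<le> card (verts T)" by (rule card_image_le[OF finV])
    moreover have "card (g ` E0) \<le> card E0" by (rule card_image_le[OF finE0])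
    moreover have "card (edges T - E0) + card E0 = card (edges T)"
      using card_Diff_subset[OF finE0 E0(1)] card_mono[OF finE E0(1)] by simp
    ultimately show "card ?U + card (edges T - E0) \<le> card (cn G (f ` e))"
      using rest[OF e] by linarith
  qed (use finE finV finE0 in auto)
  then obtain g' where g': "inj_on g' (edges T - E0)"
    "\<And>e. e \<in> edges T - E0 \<Longrightarrow> g' e \<in> cn G (f ` e) - ?U" by auto
  define k where "k e = (if e \<in> E0 then g e else g' e)" for e
  have k: "k e \<in> cn G (f ` e) - f ` verts T" if "e \<in> edges T" for e
    using that E0(3)[of e] g'(2)[of e] by (auto simp: k_def)
  have kinj: "inj_on k (edges T)"
  proof (rule inj_onI)
    fix x y assume xy: "x \<in> edges T" "y \<in> edges T" "k x = k y"
    show "x = y"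
    proof (cases "x \<in> E0"; cases "y \<in> E0")
      assume "x \<in> E0" "y \<in> E0"
      then show ?thesis using xy(3) E0(2) by (simp add: k_def inj_on_def)
    next
      assume "x \<in> E0" "y \<notin> E0"
      then have "g' y \<in> g ` E0" using xy(3) by (simp add: k_def) (metis imageI)
      then show ?thesis using g'(2)[of y] xy(2) \<open>y \<notin> E0\<close> by auto
    next
      assume "x \<notin> E0" "y \<in> E0"
      then have "g' x \<in> g ` E0" using xy(3) by (simp add: k_def)
      then show ?thesis using g'(2)[of x] xy(1) \<open>x \<notin> E0\<close> by auto
    next
      assume "x \<notin> E0" "y \<notin> E0"
      then show ?thesis using xy g'(1) by (simp add: k_def inj_on_def)
    qed
  qed
  let ?h = "case_sum f k"
  have "inj_on ?h (verts (tri_blowup T))"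
  proof (rule inj_onI)
    fix x y assume xy: "x \<in> verts (tri_blowup T)" "y \<in> verts (tri_blowup T)" "?h x = ?h y"
    have V: "verts (tri_blowup T) = Inl ` verts T \<union> Inr ` edges T"
      by (simp add: tri_blowup_def verts_def)
    show "x = y"
    proof (cases x; cases y)
      fix a b assume "x = Inl a" "y = Inl b"
      then show ?thesis using xy f(1) by (auto simp: V inj_on_def)
    next
      fix a b assume "x = Inr a" "y = Inr b"
      then show ?thesis using xy kinj by (auto simp: V inj_on_def)
    next
      fix a b assume "x = Inl a" "y = Inr b"
      then have "a \<in> verts T" "b \<in> edges T" "f a = k b" using xy by (auto simp: V)
      then show ?thesis using k[of b] by (metis DiffD2 imageI)
    next
      fix a b assume "x = Inr a" "y = Inl b"
      then have "a \<in> edges T" "b \<in> verts T" "k a = f b" using xy by (auto simp: V)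
      then show ?thesis using k[of a] by auto
    qed
  qed
  moreover have "?h ` verts (tri_blowup T) \<subseteq> verts G"
    using f(2) k by (auto simp: tri_blowup_def verts_def cn_def)
  moreover have "?h ` d \<in> edges G" if "d \<in> edges (tri_blowup T)" for d
  proof -
    have "edges (tri_blowup T) = (\<Union>e\<in>edges T. {Inl ` e} \<union> {{Inl x, Inr e} | x. x \<in> e})"
      by (simp add: tri_blowup_def edges_def)
    then have "\<exists>e\<in>edges T. d \<in> {Inl ` e} \<union> {{Inl x, Inr e} | x. x \<in> e}"
      using that by (simp only: UN_iff)
    then obtain e where e0: "e \<in> edges T" "d \<in> {Inl ` e} \<union> {{Inl x, Inr e} | x. x \<in> e}" ..
    have e: "e \<in> edges T" "d = Inl ` e \<or> (\<exists>x\<in>e. d = {Inl x, Inr e})"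
      by (rule e0(1)) (use e0(2) in \<open>simp, blast\<close>)
    show ?thesis
    proof (cases "d = Inl ` e")
      case True
      then show ?thesis using fE[OF e(1)] by (simp add: image_image)
    next
      case False
      then obtain x where "x \<in> e" "d = {Inl x, Inr e}" using e by auto
      then show ?thesis using k[OF e(1)] by (auto simp: cn_def)
    qed
  qed
  ultimately show ?thesis unfolding contains_copy_def by (intro exI[of _ ?h]) simp
qed

text \<open>A template for the greedy embeddings. A node of type \<open>'n\<close> records the image
  of a tree vertex with whatever is reserved for it; \<open>Sx\<close> gives the host vertices it
  occupies, \<open>Lv\<close> the nodes suitable for a tree vertex, \<open>R\<close> the relation of
  a parent to its child. \<open>M\<close> bounds all that is ever occupied. The function
  \<open>c\<close> returns the child end of an edge, and is injective because every vertex other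
  than the root is attached by a single edge.\<close>

lemma grown_embed:
  fixes Lv :: "'a \<Rightarrow> 'n \<Rightarrow> bool" and R :: "'n \<Rightarrow> 'n \<Rightarrow> bool" and Sx :: "'n \<Rightarrow> 'b set"
  assumes "grown E r S" and two: "\<forall>e\<in>E. \<exists>x y. x \<noteq> y \<and> e = {x, y}"
    and root: "Lv r x0" "Sx x0 \<inter> U0 = {}"
    and ext: "\<And>p w x U. \<lbrakk>{p, w} \<in> E; Lv p x; finite U; U0 \<subseteq> U; card U \<le> M\<rbrakk>
      \<Longrightarrow> \<exists>y. Lv w y \<and> R x y \<and> Sx y \<inter> U = {}"
    and size: "\<And>w y. Lv w y \<Longrightarrow> finite (Sx y) \<and> card (Sx y) \<le> s"
    and U0: "finite U0" "card U0 + s * card S \<le> M"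
  shows "\<exists>h c. (\<forall>w\<in>S. Lv w (h w) \<and> Sx (h w) \<inter> U0 = {})
     \<and> (\<forall>u\<in>S. \<forall>w\<in>S. u \<noteq> w \<longrightarrow> Sx (h u) \<inter> Sx (h w) = {})
     \<and> inj_on c {e\<in>E. e \<subseteq> S}
     \<and> (\<forall>e\<in>E. e \<subseteq> S \<longrightarrow> c e \<in> S \<and> (\<exists>p\<in>S. e = {p, c e} \<and> R (h p) (h (c e))))"
  using assms(1) U0(2)
proof (induction rule: grown.induct)
  case root
  have no: "\<not> e \<subseteq> {r}" if "e \<in> E" for e
    using that not_subset_singleton two by metis
  then have "{e\<in>E. e \<subseteq> {r}} = {}" by auto
  then have "inj_on (\<lambda>_. r) {e\<in>E. e \<subseteq> {r}}" by (metis inj_on_empty)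
  then show ?case using assms(3,4) no
    by (intro exI[of _ "\<lambda>_. x0"] exI[of _ "\<lambda>_. r"] conjI) auto
next
  case (step S w p)
  have finS: "finite S" using grown_finite[OF step.hyps(1)] .
  have "s * card S \<le> s * card (insert w S)" using finS by (intro mult_le_mono2 card_insert_le)
  then have "card U0 + s * card S \<le> M" using step.prems by linarith
  from step.IH[OF this] obtain h c where h: "\<forall>w\<in>S. Lv w (h w) \<and> Sx (h w) \<inter> U0 = {}"
    "\<forall>u\<in>S. \<forall>w\<in>S. u \<noteq> w \<longrightarrow> Sx (h u) \<inter> Sx (h w) = {}"
    "inj_on c {e\<in>E. e \<subseteq> S}"
    "\<forall>e\<in>E. e \<subseteq> S \<longrightarrow> c e \<in> S \<and> (\<exists>p\<in>S. e = {p, c e} \<and> R (h p) (h (c e)))"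
    by (elim exE conjE)
  let ?U = "U0 \<union> (\<Union>u\<in>S. Sx (h u))"
  have finU: "finite ?U" using U0(1) finS h(1) size by auto
  have cU: "card ?U \<le> M"
  proof -
    have "card (\<Union>u\<in>S. Sx (h u)) \<le> (\<Sum>u\<in>S. card (Sx (h u)))" by (rule card_UN_le[OF finS])
    also have "\<dots> \<le> (\<Sum>u\<in>S. s)" using h(1) size by (intro sum_mono) auto
    finally have "card (\<Union>u\<in>S. Sx (h u)) \<le> s * card S" by (simp add: mult.commute)
    moreover have "card ?U \<le> card U0 + card (\<Union>u\<in>S. Sx (h u))" by (rule card_Un_le)
    ultimately show ?thesis using \<open>card U0 + s * card S \<le> M\<close> by linarith
  qed
  obtain y where y: "Lv w y" "R (h p) y" "Sx y \<inter> ?U = {}"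
    using ext[OF step.hyps(4) _ finU _ cU, of "h p"] h(1) step.hyps(3) by auto
  have es: "{e\<in>E. e \<subseteq> insert w S} = insert {p, w} {e\<in>E. e \<subseteq> S}"
    by (rule edges_insert[OF two step.hyps(4,3,2)]) (rule step.hyps(5))
  let ?h = "h(w := y)" and ?c = "c({p, w} := w)"
  have pwS: "\<not> {p, w} \<subseteq> S" using step.hyps(2) by simp
  have "\<forall>v\<in>insert w S. Lv v (?h v) \<and> Sx (?h v) \<inter> U0 = {}" using h(1) y by auto
  moreover have "\<forall>u\<in>insert w S. \<forall>v\<in>insert w S. u \<noteq> v \<longrightarrow> Sx (?h u) \<inter> Sx (?h v) = {}"
    using h(2) y(3) by (simp add: Int_Un_distrib Int_commute) blast
  moreover have "inj_on ?c {e\<in>E. e \<subseteq> insert w S}"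
  proof -
    have "inj_on ?c {e\<in>E. e \<subseteq> S}"
      using h(3) pwS by (auto simp: inj_on_def)
    moreover have "w \<notin> ?c ` {e\<in>E. e \<subseteq> S}" using h(4) pwS step.hyps(2) by auto
    ultimately show ?thesis unfolding es using pwS by auto
  qed
  moreover have "\<forall>e\<in>E. e \<subseteq> insert w S \<longrightarrow>
      ?c e \<in> insert w S \<and> (\<exists>p\<in>insert w S. e = {p, ?c e} \<and> R (?h p) (?h (?c e)))"
  proof (intro ballI impI)
    fix e assume e: "e \<in> E" "e \<subseteq> insert w S"
    then have "e \<in> insert {p, w} {e\<in>E. e \<subseteq> S}" unfolding es[symmetric] by simp
    then consider "e = {p, w}" | "e \<noteq> {p, w}" "e \<subseteq> S" by auto
    then show "?c e \<in> insert w S \<and> (\<exists>p\<in>insert w S. e = {p, ?c e} \<and> R (?h p) (?h (?c e)))"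
    proof cases
      case 1
      have "p \<noteq> w" using step.hyps(2,3) by auto
      then show ?thesis using 1 y(2) step.hyps(3) by auto
    next
      case 2
      then obtain q where q: "c e \<in> S" "q \<in> S" "e = {q, c e}" "R (h q) (h (c e))"
        using h(4) e(1) by blast
      then have "c e \<noteq> w" "q \<noteq> w" using step.hyps(2) by auto
      then show ?thesis using 2(1) q by (auto intro!: bexI[of _ q])
    qed
  qed
  ultimately show ?case by (intro exI[of _ ?h] exI[of _ ?c] conjI)
qed

text \<open>In a smallest \<open>S\<close> with more than \<open>K * card S\<close> members inside,
  a vertex in at most \<open>K\<close> of them could be deleted. Set families are used so that edges
  and triangles are both covered.\<close>

lemma min_degree_subfamily:
  fixes H :: "'b set set"
  assumes "finite V" "finite H" "\<forall>e\<in>H. e \<subseteq> V \<and> e \<noteq> {}" "K * card V < card H"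
  shows "\<exists>V'\<subseteq>V. V' \<noteq> {} \<and> (\<forall>v\<in>V'. K < card {e\<in>H. v \<in> e \<and> e \<subseteq> V'})"
proof -
  let ?P = "\<lambda>S. S \<subseteq> V \<and> K * card S < card {e\<in>H. e \<subseteq> S}"
  have "{e\<in>H. e \<subseteq> V} = H" using assms(3) by auto
  then have "?P V" using assms(4) by simp
  then have "\<exists>S. ?P S \<and> (\<forall>S'. ?P S' \<longrightarrow> card S \<le> card S')"
    by (rule ex_has_least_nat)
  then obtain S where S: "?P S" "\<And>S'. ?P S' \<Longrightarrow> card S \<le> card S'" by auto
  have finS: "finite S" using S(1) assms(1) finite_subset by auto
  have "{e\<in>H. e \<subseteq> {}} = {}" using assms(3) by auto
  then have "card {e\<in>H. e \<subseteq> {}} = 0" by (simp only: card.empty)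
  then have "S \<noteq> {}" using S(1) by (metis not_less_zero)
  show ?thesis
  proof (intro exI[of _ S] conjI ballI)
    show "S \<subseteq> V" "S \<noteq> {}" using S(1) \<open>S \<noteq> {}\<close> by auto
    fix v assume v: "v \<in> S"
    show "K < card {e\<in>H. v \<in> e \<and> e \<subseteq> S}"
    proof (rule ccontr)
      assume "\<not> ?thesis"
      then have le: "card {e\<in>H. v \<in> e \<and> e \<subseteq> S} \<le> K" by simp
      have eq: "{e\<in>H. e \<subseteq> S} = {e\<in>H. e \<subseteq> S - {v}} \<union> {e\<in>H. v \<in> e \<and> e \<subseteq> S}" by auto
      have "card {e\<in>H. e \<subseteq> S} \<le> card {e\<in>H. e \<subseteq> S - {v}} + card {e\<in>H. v \<in> e \<and> e \<subseteq> S}"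
        by (subst eq) (rule card_Un_le)
      moreover have "card S = Suc (card (S - {v}))" using card_Suc_Diff1[OF finS v] by simp
      ultimately have "?P (S - {v})" using le S(1) by auto
      then have "card S \<le> card (S - {v})" by (rule S(2))
      then show False using \<open>card S = Suc (card (S - {v}))\<close> by simp
    qed
  qed
qed

text \<open>Neighbourhoods are independent, so the larger of \<open>I\<close> and a largest
  neighbourhood is an independent set \<open>J\<close> of size at least every degree. Each edge has
  an end outside \<open>J\<close>. Empty \<open>I\<close> gives Mantel's theorem; in general, a
  dense triangle-free graph has no independent set much larger than half of
  \<open>W\<close>.\<close>

lemma triangle_free_edge_bound:
  fixes E :: "'b set set"
  assumes W: "finite W" and E: "\<And>e. e \<in> E \<Longrightarrow> \<exists>x y. x \<noteq> y \<and> e = {x, y} \<and> x \<in> W \<and> y \<in> W"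
    and free: "\<And>x y z. \<lbrakk>{x, y} \<in> E; {y, z} \<in> E; {x, z} \<in> E\<rbrakk> \<Longrightarrow> False"
    and I: "I \<subseteq> W" "\<And>e. e \<in> E \<Longrightarrow> \<not> e \<subseteq> I"
  shows "\<exists>M. card I \<le> M \<and> M \<le> card W \<and> card E \<le> M * (card W - M)"
proof (cases "W = {}")
  case True
  then have "E = {}" using E by blast
  then show ?thesis using True I by (intro exI[of _ 0]) auto
next
  case False
  let ?N = "\<lambda>v. {w\<in>W. {v, w} \<in> E}"
  define D where "D = Max ((\<lambda>v. card (?N v)) ` W)"
  have D: "card (?N v) \<le> D" if "v \<in> W" for v
    unfolding D_def using W that by simp
  have "D \<in> (\<lambda>v. card (?N v)) ` W" unfolding D_def using W False by (intro Max_in) auto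
  then obtain v where v: "v \<in> W" "D = card (?N v)" by auto
  have "\<exists>J. J \<subseteq> W \<and> (\<forall>e\<in>E. \<not> e \<subseteq> J) \<and> card I \<le> card J \<and> D \<le> card J"
  proof (cases "D \<le> card I")
    case True
    then show ?thesis using I by (intro exI[of _ I]) auto
  next
    case False
    have "\<not> e \<subseteq> ?N v" if e: "e \<in> E" for e
    proof
      assume s: "e \<subseteq> ?N v"
      obtain x y where xy: "e = {x, y}" using E[OF e] by blast
      then show False using free[of v x y] s e by (auto simp: insert_commute)
    qed
    then show ?thesis using False v by (intro exI[of _ "?N v"]) auto
  qed
  then obtain J where J: "J \<subseteq> W" "\<forall>e\<in>E. \<not> e \<subseteq> J" "card I \<le> card J" "D \<le> card J" by auto
  have finJ: "finite J" using J(1) W finite_subset by auto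
  have "E \<subseteq> (\<Union>u\<in>W - J. (\<lambda>w. {u, w}) ` ?N u)"
  proof
    fix e assume e: "e \<in> E"
    obtain x y where xy: "e = {x, y}" "x \<in> W" "y \<in> W" using E[OF e] by blast
    have "x \<notin> J \<or> y \<notin> J" using J(2) e xy(1) by auto
    then show "e \<in> (\<Union>u\<in>W - J. (\<lambda>w. {u, w}) ` ?N u)"
    proof
      assume "x \<notin> J"
      then show ?thesis using xy e by (intro UN_I[of x]) auto
    next
      assume "y \<notin> J"
      then show ?thesis using xy e by (intro UN_I[of y]) (auto simp: insert_commute)
    qed
  qed
  then have "card E \<le> card (\<Union>u\<in>W - J. (\<lambda>w. {u, w}) ` ?N u)"
    using W by (intro card_mono) auto
  also have "\<dots> \<le> (\<Sum>u\<in>W - J. card ((\<lambda>w. {u, w}) ` ?N u))"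
    using W by (intro card_UN_le) auto
  also have "\<dots> \<le> (\<Sum>u\<in>W - J. card J)"
  proof (rule sum_mono)
    fix u assume u: "u \<in> W - J"
    have "card ((\<lambda>w. {u, w}) ` ?N u) \<le> card (?N u)" using W by (intro card_image_le) auto
    then show "card ((\<lambda>w. {u, w}) ` ?N u) \<le> card J" using D[of u] u J(4) by simp
  qed
  also have "\<dots> = card J * (card W - card J)"
    using card_Diff_subset[OF finJ J(1)] by simp
  finally show ?thesis using J(3) card_mono[OF W J(1)] by (intro exI[of _ "card J"]) simp
qed

lemma mult_diff_le_quarter: "4 * (M * (w - M)) \<le> w\<^sup>2" for w M :: nat
proof (cases "M \<le> w")
  case True
  then obtain k where "w = M + k" using le_Suc_ex by blast
  moreover have "0 \<le> (int M - int k)\<^sup>2" by simp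
  then have "int (4 * (M * k)) \<le> int ((M + k)\<^sup>2)" by (simp add: power2_eq_square algebra_simps)
  then have "4 * (M * k) \<le> (M + k)\<^sup>2" by (simp only: of_nat_le_iff)
  ultimately show ?thesis by simp
qed simp

lemma mantel:
  fixes E :: "'b set set"
  assumes "finite W" "\<And>e. e \<in> E \<Longrightarrow> \<exists>x y. x \<noteq> y \<and> e = {x, y} \<and> x \<in> W \<and> y \<in> W"
    and "\<And>x y z. \<lbrakk>{x, y} \<in> E; {y, z} \<in> E; {x, z} \<in> E\<rbrakk> \<Longrightarrow> False"
  shows "4 * card E \<le> (card W)\<^sup>2"
proof -
  have "\<exists>M. card ({} :: 'b set) \<le> M \<and> M \<le> card W \<and> card E \<le> M * (card W - M)"
  proof (rule triangle_free_edge_bound[OF assms])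
    show "{} \<subseteq> W" by simp
    show "\<not> e \<subseteq> {}" if "e \<in> E" for e using assms(2)[OF that] by auto
  qed
  then obtain M where "card E \<le> M * (card W - M)" by auto
  then show ?thesis using mult_diff_le_quarter[of M "card W"] by linarith
qed

section \<open>Counting\<close>

lemma triangle_cases:
  assumes "s \<in> triangles G" "v \<in> s"
  obtains a b where "s = {v, a, b}" "v \<noteq> a" "v \<noteq> b" "a \<noteq> b"
    "{v, a} \<in> edges G" "{v, b} \<in> edges G" "{a, b} \<in> edges G" "s \<subseteq> verts G"
proof -
  have s: "s \<subseteq> verts G" "card s = 3" "\<And>x y. x \<in> s \<Longrightarrow> y \<in> s \<Longrightarrow> x \<noteq> y \<Longrightarrow> {x, y} \<in> edges G"
    using assms(1) by (auto simp: triangles_def)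
  have "finite s" using s(2) card.infinite by fastforce
  then have "card (s - {v}) = 2" using s(2) assms(2) by simp
  then obtain a b where ab: "s - {v} = {a, b}" "a \<noteq> b" by (meson card_2_iff)
  then have "s = {v, a, b}" "v \<noteq> a" "v \<noteq> b" using assms(2) by auto
  then show thesis using that[of a b] ab s by auto
qed

lemma triangleI:
  assumes "wf_graph G" "{x, y} \<in> edges G" "{y, z} \<in> edges G" "{x, z} \<in> edges G"
  shows "{x, y, z} \<in> triangles G" "x \<noteq> y" "y \<noteq> z" "x \<noteq> z"
proof -
  show "x \<noteq> y" "y \<noteq> z" "x \<noteq> z" using assms wf_edgeD by metis+
  then show "{x, y, z} \<in> triangles G"
    using assms wf_edgeD[OF assms(1)] by (auto simp: triangles_def insert_commute)
qed

lemma finite_triangles: "wf_graph G \<Longrightarrow> finite (triangles G)"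
  by (rule finite_subset[of _ "Pow (verts G)"]) (auto simp: triangles_def dest: wf_finite_verts)

lemma triangles_over_edge:
  assumes wf: "wf_graph G" and e: "e \<in> edges G"
  shows "{s \<in> triangles G. e \<subseteq> s} = (\<lambda>w. insert w e) ` cn G e" "inj_on (\<lambda>w. insert w e) (cn G e)"
proof -
  obtain x y where xy: "x \<noteq> y" "e = {x, y}" using wf e by (auto elim!: wf_edgeE)
  show "{s \<in> triangles G. e \<subseteq> s} = (\<lambda>w. insert w e) ` cn G e"
  proof (intro equalityI subsetI)
    fix s assume s: "s \<in> {s \<in> triangles G. e \<subseteq> s}"
    then have "s \<in> triangles G" "x \<in> s" "y \<in> s" using xy by auto
    then obtain a b where ab: "s = {x, a, b}" "{x, a} \<in> edges G" "{x, b} \<in> edges G"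
      "{a, b} \<in> edges G" "s \<subseteq> verts G"
      by (metis triangle_cases)
    have "y = a \<or> y = b" using ab(1) \<open>y \<in> s\<close> xy(1) by auto
    then show "s \<in> (\<lambda>w. insert w e) ` cn G e"
    proof
      assume "y = a"
      then show ?thesis using ab xy by (intro image_eqI[of _ _ b]) (auto simp: cn_def)
    next
      assume "y = b"
      then show ?thesis using ab xy by (intro image_eqI[of _ _ a]) (auto simp: cn_def insert_commute)
    qed
  next
    fix s assume "s \<in> (\<lambda>w. insert w e) ` cn G e"
    then obtain w where w: "s = {w, x, y}" "{x, w} \<in> edges G" "{y, w} \<in> edges G"
      using xy by (auto simp: cn_def)
    then have "{w, x, y} \<in> triangles G"
      using triangleI(1)[OF wf, of w x y] e xy by (simp add: insert_commute)
    then show "s \<in> {s \<in> triangles G. e \<subseteq> s}" using w xy by auto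
  qed
  show "inj_on (\<lambda>w. insert w e) (cn G e)"
  proof (rule inj_onI)
    fix w w' assume w: "w \<in> cn G e" "w' \<in> cn G e" "insert w e = insert w' e"
    have "w \<notin> e" using w(1) wf_edgeD(1)[OF wf, of w w] by (auto simp: cn_def)
    then show "w = w'" using w(3) by auto
  qed
qed

lemma card_triangles_over_edge:
  assumes "wf_graph G" "e \<in> edges G"
  shows "card {s \<in> triangles G. e \<subseteq> s} = card (cn G e)"
  by (simp add: triangles_over_edge(1)[OF assms] card_image[OF triangles_over_edge(2)[OF assms]])

lemma handshake:
  assumes "finite V" and E: "\<And>e. e \<in> E \<Longrightarrow> \<exists>x y. x \<noteq> y \<and> e = {x, y} \<and> x \<in> V \<and> y \<in> V"
  shows "(\<Sum>x\<in>V. card {y\<in>V. {x, y} \<in> E}) = 2 * card E"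
proof -
  have finE: "finite E"
  proof (rule finite_subset[of _ "Pow V"])
    show "E \<subseteq> Pow V" using E by fast
  qed (use assms(1) in simp)
  have eq: "card {y\<in>V. {x, y} \<in> E} = card {e\<in>E. x \<in> e}" if x: "x \<in> V" for x
  proof (rule bij_betw_same_card[of "\<lambda>y. {x, y}"])
    have "{e\<in>E. x \<in> e} \<subseteq> (\<lambda>y. {x, y}) ` {y\<in>V. {x, y} \<in> E}"
    proof
      fix e assume e: "e \<in> {e\<in>E. x \<in> e}"
      then obtain a b where ab: "e = {a, b}" "a \<in> V" "b \<in> V" using E[of e] by auto
      then have "x = a \<or> x = b" using e by auto
      then show "e \<in> (\<lambda>y. {x, y}) ` {y\<in>V. {x, y} \<in> E}"
        using e ab by (auto simp: insert_commute)
    qed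
    then show "bij_betw (\<lambda>y. {x, y}) {y\<in>V. {x, y} \<in> E} {e\<in>E. x \<in> e}"
      by (auto simp: bij_betw_def inj_on_def doubleton_eq_iff)
  qed
  have "(\<Sum>x\<in>V. card {y\<in>V. {x, y} \<in> E}) = (\<Sum>x\<in>V. card {e\<in>E. x \<in> e})"
    by (rule sum.cong) (use eq in auto)
  also have "\<dots> = (\<Sum>x\<in>V. \<Sum>e\<in>E. if x \<in> e then 1 else 0)"
    using finE by (intro sum.cong) (auto simp: sum.If_cases Int_def)
  also have "\<dots> = (\<Sum>e\<in>E. \<Sum>x\<in>V. if x \<in> e then 1 else 0)" by (rule sum.swap)
  also have "\<dots> = (\<Sum>e\<in>E. 2)"
  proof (rule sum.cong)
    fix e assume "e \<in> E"
    then obtain a b where ab: "a \<noteq> b" "e = {a, b}" "a \<in> V" "b \<in> V" using E by blast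
    then have "V \<inter> {x. x \<in> e} = {a, b}" by auto
    then show "(\<Sum>x\<in>V. if x \<in> e then 1 else 0) = (2::nat)"
      using ab(1) assms(1) by (simp add: sum.If_cases)
  qed simp
  finally show ?thesis by simp
qed

text \<open>For each value of \<open>g\<close> keep the members carrying the most frequent label; at
  least one in \<open>M\<close> survives. In use, \<open>g\<close> is one end of a pair, and the
  label becomes a function of that end alone.\<close>

lemma popular_label:
  fixes f :: "'e \<Rightarrow> 'c" and g :: "'e \<Rightarrow> 'd"
  assumes E: "finite E" and C: "\<And>e. e \<in> E \<Longrightarrow> finite (C (g e)) \<and> card (C (g e)) \<le> M \<and> f e \<in> C (g e)"
  shows "\<exists>E' p. E' \<subseteq> E \<and> card E \<le> M * card E' \<and> (\<forall>e\<in>E'. f e = p (g e))"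
proof -
  let ?k = "\<lambda>y c. card {e\<in>E. g e = y \<and> f e = c}"
  have "\<exists>c. card {e\<in>E. g e = y} \<le> M * ?k y c" if y: "y \<in> g ` E" for y
  proof -
    obtain e0 where e0: "e0 \<in> E" "g e0 = y" using y by auto
    then have Cy: "finite (C y)" "card (C y) \<le> M" "C y \<noteq> {}" using C[OF e0(1)] by auto
    then have "Max (?k y ` C y) \<in> ?k y ` C y" by (intro Max_in) auto
    then obtain c where c: "Max (?k y ` C y) = ?k y c" by auto
    have "{e\<in>E. g e = y} \<subseteq> (\<Union>c\<in>C y. {e\<in>E. g e = y \<and> f e = c})" using C by auto
    then have "card {e\<in>E. g e = y} \<le> card (\<Union>c\<in>C y. {e\<in>E. g e = y \<and> f e = c})"
      using E Cy(1) by (intro card_mono) auto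
    also have "\<dots> \<le> (\<Sum>c\<in>C y. ?k y c)" by (rule card_UN_le[OF Cy(1)])
    also have "\<dots> \<le> (\<Sum>c'\<in>C y. ?k y c)"
      unfolding c[symmetric] using Cy(1) by (intro sum_mono Max_ge) auto
    also have "\<dots> \<le> M * ?k y c" using Cy(2) by simp
    finally show ?thesis by blast
  qed
  then have "\<forall>y\<in>g ` E. \<exists>c. card {e\<in>E. g e = y} \<le> M * ?k y c" by (rule ballI)
  from bchoice[OF this]
  obtain p where p: "\<forall>y\<in>g ` E. card {e\<in>E. g e = y} \<le> M * ?k y (p y)" by (rule exE)
  let ?E' = "{e\<in>E. f e = p (g e)}"
  have "card E = (\<Sum>y\<in>g ` E. card {e\<in>E. g e = y})"
    using sum.image_gen[OF E, of "\<lambda>_. 1 :: nat" g] by simp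
  also have "\<dots> \<le> (\<Sum>y\<in>g ` E. M * ?k y (p y))" using p by (intro sum_mono) (rule bspec)
  also have "\<dots> = M * (\<Sum>y\<in>g ` E. ?k y (p y))" by (simp add: sum_distrib_left)
  also have "(\<Sum>y\<in>g ` E. ?k y (p y)) = card (\<Union>y\<in>g ` E. {e\<in>E. g e = y \<and> f e = p y})"
    using E by (intro card_UN_disjoint[symmetric]) auto
  also have "(\<Union>y\<in>g ` E. {e\<in>E. g e = y \<and> f e = p y}) = ?E'" by auto
  finally show ?thesis by (intro exI[of _ ?E'] exI[of _ p]) auto
qed

text \<open>Pairs become edges of a bipartite graph on two copies of \<open>V\<close>, told apart by
  a Boolean; hence the factor 2. The sets \<open>Y\<close> and \<open>Z\<close> may overlap.\<close>

lemma bipartite_min_degree: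
  fixes E :: "('b \<times> 'b) set"
  assumes V: "finite V" "E \<subseteq> V \<times> V" and big: "K * (2 * card V) < card E"
  shows "\<exists>Y Z. Y \<subseteq> V \<and> Z \<subseteq> V \<and> Y \<noteq> {} \<and> (\<forall>y\<in>Y. K < card {z\<in>Z. (y, z) \<in> E})
    \<and> (\<forall>z\<in>Z. K < card {y\<in>Y. (y, z) \<in> E})"
proof -
  let ?h = "\<lambda>(y, z). {(y, True), (z, False)}"
  let ?H = "?h ` E" and ?N = "V \<times> (UNIV :: bool set)"
  have finE: "finite E" using V finite_subset[OF V(2)] by simp
  have "inj_on ?h E" by (auto simp: inj_on_def doubleton_eq_iff)
  then have "card ?H = card E" by (rule card_image)
  moreover have "card ?N = 2 * card V" by (simp add: card_cartesian_product)
  ultimately have big': "K * card ?N < card ?H" using big by simp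
  have sub: "\<forall>e\<in>?H. e \<subseteq> ?N \<and> e \<noteq> {}" using V(2) by auto
  have fin: "finite ?N" "finite ?H" using V(1) finE by auto
  obtain V' where V': "V' \<subseteq> ?N" "V' \<noteq> {}"
    "\<forall>v\<in>V'. K < card {e\<in>?H. v \<in> e \<and> e \<subseteq> V'}"
    using min_degree_subfamily[OF fin sub big'] by (elim exE conjE) (rule that)
  let ?Y = "{y. (y, True) \<in> V'}" and ?Z = "{z. (z, False) \<in> V'}"
  have sub2: "?Y \<subseteq> V" "?Z \<subseteq> V" using V'(1) by auto
  then have finYZ: "finite ?Y" "finite ?Z" using V(1) finite_subset by blast+
  have dY: "K < card {z\<in>?Z. (y, z) \<in> E}" if "y \<in> ?Y" for y
  proof -
    have "{e\<in>?H. (y, True) \<in> e \<and> e \<subseteq> V'} \<subseteq> (\<lambda>z. ?h (y, z)) ` {z\<in>?Z. (y, z) \<in> E}" by auto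
    then have "card {e\<in>?H. (y, True) \<in> e \<and> e \<subseteq> V'} \<le> card ((\<lambda>z. ?h (y, z)) ` {z\<in>?Z. (y, z) \<in> E})"
      using finYZ by (intro card_mono) auto
    also have "\<dots> \<le> card {z\<in>?Z. (y, z) \<in> E}" using finYZ by (intro card_image_le) auto
    moreover have "(y, True) \<in> V'" using that by simp
    ultimately show ?thesis using V'(3) by (meson less_le_trans)
  qed
  have dZ: "K < card {y\<in>?Y. (y, z) \<in> E}" if "z \<in> ?Z" for z
  proof -
    have "{e\<in>?H. (z, False) \<in> e \<and> e \<subseteq> V'} \<subseteq> (\<lambda>y. ?h (y, z)) ` {y\<in>?Y. (y, z) \<in> E}" by auto
    then have "card {e\<in>?H. (z, False) \<in> e \<and> e \<subseteq> V'} \<le> card ((\<lambda>y. ?h (y, z)) ` {y\<in>?Y. (y, z) \<in> E})"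
      using finYZ by (intro card_mono) auto
    also have "\<dots> \<le> card {y\<in>?Y. (y, z) \<in> E}" using finYZ by (intro card_image_le) auto
    moreover have "(z, False) \<in> V'" using that by simp
    ultimately show ?thesis using V'(3) by (meson less_le_trans)
  qed
  have "?Y \<noteq> {}"
  proof
    assume Y: "?Y = {}"
    obtain v b where v: "(v, b) \<in> V'" using V'(2) by (metis ex_in_conv surj_pair)
    then have "b = False" using Y by (cases b) auto
    then have "K < card {y\<in>?Y. (y, v) \<in> E}" using dZ v by blast
    then show False using Y by (metis (no_types, lifting) Collect_empty_eq card.empty empty_iff not_less_zero)
  qed
  then show ?thesis
    using dY dZ sub2 by (intro exI[of _ ?Y] exI[of _ ?Z] conjI ballI)
qed

lemma disjoint_ne: "A \<inter> B = {} \<Longrightarrow> a \<in> A \<Longrightarrow> b \<in> B \<Longrightarrow> a \<noteq> b"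
  by blast

text \<open>The linear coefficient in the bound for \<open>bad\<close>. The first summand counts
  nine ordered pairs for each of at most \<open>4 * v^2 * n\<close> all-thin triangles, the second
  the pairs with private neighbours at both ends, the third the nested pairs in both
  orientations.\<close>

definition bad_const :: "nat \<Rightarrow> nat \<Rightarrow> nat" where
  "bad_const v D = 36 * v\<^sup>2 + D * (D * (2 * v * (2 * v + 1) * 2))
     + 2 * (2 ^ D * 2 ^ D * (2 ^ D * ((v + (v + 1) * v) * (2 * v + 1) * 2)))"

text \<open>Linear errors of the degree estimate, in this order: thin edges beyond
  \<open>n^2 / 4\<close>, pairs in \<open>bad\<close>, thin edges inside thick neighbourhoods,
  all-thick triangles.\<close>

definition lin_const :: "nat \<Rightarrow> nat \<Rightarrow> nat \<Rightarrow> nat" where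
  "lin_const v t D = 16 * v\<^sup>2 * t + 8 * v * bad_const v D + 64 * v ^ 3 + 64 * v\<^sup>2"

lemma quarter_square_floor:
  fixes m k :: nat
  assumes "4 * m \<le> k\<^sup>2"
  shows "m \<le> (k div 2) * (k - k div 2)"
proof (cases "even k")
  case True
  then obtain a where "k = 2 * a" by (rule evenE)
  then show ?thesis using assms by (simp add: power2_eq_square)
next
  case False
  then obtain a where a: "k = 2 * a + 1" by (rule oddE)
  then have "m \<le> a * (a + 1)" using assms by (simp add: power2_eq_square algebra_simps)
  then show ?thesis using a by (simp add: algebra_simps)
qed

lemma quarter_square_lower: "k\<^sup>2 \<le> 4 * ((k div 2) * (k - k div 2)) + 1" for k :: nat
proof (cases "even k")
  case True
  then obtain a where "k = 2 * a" by (rule evenE)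
  then show ?thesis by (simp add: power2_eq_square)
next
  case False
  then obtain a where "k = 2 * a + 1" by (rule oddE)
  then show ?thesis by (simp add: power2_eq_square algebra_simps)
qed

text \<open>Here r exceptional vertices lie in triangles avoiding the dominating set, rho bounds the number of
  undominated vertices, M their degrees into the dominated part, and m the edges between the others.
  Deleting an exceptional vertex costs (t-1)(M + rho) triangles instead of about t n / 2.\<close>
lemma final_real_inequality:
  fixes n t r v \<rho> m M k :: real
  assumes t: "1 \<le> t" "t \<le> v" and r: "1 \<le> r" "r \<le> \<rho>" "0 \<le> k - r" and \<rho>: "1024 * v\<^sup>2 * \<rho> \<le> n"
    and n: "512 * v ^ 3 \<le> n" and k: "k = n - t"
    and m: "4 * m \<le> (k - r)\<^sup>2" and M: "16 * v * M \<le> 8 * v * n + n" "0 \<le> M"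
  shows "4 * (t * m + r * (2 * v + (t - 1) * (M + \<rho>)) + (2 * v * r\<^sup>2 + 4 * v\<^sup>2 * r)) \<le> t * k\<^sup>2 - t"
proof -
  have v1: "1 \<le> v" using t by simp
  have vv: "v \<le> v\<^sup>2" "1 \<le> v\<^sup>2" using v1 self_le_power[of v 2] one_le_power[of v 2] by simp_all
  have v3: "v\<^sup>2 \<le> v ^ 3" using v1 by (intro power_increasing) auto
  have r0: "0 \<le> \<rho>" using r by simp
  have vr: "v * \<rho> \<le> n / 1024"
  proof -
    have "v * \<rho> \<le> v\<^sup>2 * \<rho>" using vv r0 by (intro mult_right_mono)
    then show ?thesis using \<rho> by simp
  qed
  \<comment> \<open>\<open>M\<close> exceeds \<open>n / 2\<close> by at most
    \<open>n / (16 * v)\<close>. Since \<open>t - 1 < v\<close>, this excess contributes at most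
    \<open>n / 16\<close> in total before the factor 4.\<close>
  have tM: "4 * ((t - 1) * (M + \<rho>)) \<le> 2 * t * n - 2 * n + n / 4 + n / 256"
  proof -
    have Mb: "M \<le> n / 2 + n / (16 * v)" using M v1 by (simp add: field_simps)
    have "(t - 1) * M \<le> (t - 1) * (n / 2 + n / (16 * v))" using Mb t by (intro mult_left_mono) auto
    also have "\<dots> = (t - 1) * n / 2 + (t - 1) / v * (n / 16)" by (simp add: algebra_simps)
    also have "(t - 1) / v * (n / 16) \<le> 1 * (n / 16)"
      using t v1 n v3 vv by (intro mult_right_mono) auto
    finally have 1: "(t - 1) * M \<le> (t - 1) * n / 2 + n / 16" by simp
    have "(t - 1) * \<rho> \<le> v * \<rho>" using t r0 by (intro mult_right_mono) auto
    then have 2: "(t - 1) * \<rho> \<le> n / 1024" using vr by simp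
    have "4 * ((t - 1) * (M + \<rho>)) = 4 * ((t - 1) * M) + 4 * ((t - 1) * \<rho>)" by (simp add: algebra_simps)
    also have "\<dots> \<le> 4 * ((t - 1) * n / 2 + n / 16) + 4 * (n / 1024)" using 1 2 by (intro add_mono mult_left_mono) auto
    also have "\<dots> = 2 * t * n - 2 * n + n / 4 + n / 256" by (simp add: field_simps)
    finally show ?thesis .
  qed
  have tr: "t * r \<le> n / 1024" "8 * v * r \<le> 8 * (n / 1024)"
  proof -
    have "t * r \<le> v * \<rho>" using t r by (intro mult_mono) auto
    then show "t * r \<le> n / 1024" using vr by simp
    have "v * r \<le> v * \<rho>" using v1 r by (intro mult_left_mono) auto
    then show "8 * v * r \<le> 8 * (n / 1024)" using vr by simp
  qed
  have tt: "t\<^sup>2 \<le> v\<^sup>2" using t by (intro power_mono) auto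
  \<comment> \<open>The left side is the coefficient of \<open>r\<close> once
    \<open>t * (k - r)^2\<close> is expanded. The terms \<open>2 * t * n\<close> cancel, and the
    remaining \<open>- 2 * n\<close> outweighs all the others. As \<open>1 \<le> r\<close>, a gain
    of \<open>t\<close> results, which is what rounding in a balanced bipartition can cost.\<close>
  have br: "- 2 * t * k + t * r + 8 * v + 4 * ((t - 1) * (M + \<rho>)) + 8 * v * r + 16 * v\<^sup>2 \<le> - t"
  proof -
    have "- 2 * t * k = - 2 * t * n + 2 * t\<^sup>2" by (simp add: k algebra_simps power2_eq_square)
    then show ?thesis using tM tr tt vv t n v3 by linarith
  qed
  have "r * (- 2 * t * k + t * r + 8 * v + 4 * ((t - 1) * (M + \<rho>)) + 8 * v * r + 16 * v\<^sup>2) \<le> r * (- t)"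
    using br r by (intro mult_left_mono) auto
  moreover have "r * (- t) \<le> 1 * (- t)" using r t by (intro mult_right_mono_neg) auto
  ultimately have fin: "r * (- 2 * t * k + t * r + 8 * v + 4 * ((t - 1) * (M + \<rho>)) + 8 * v * r + 16 * v\<^sup>2) \<le> - t"
    by simp
  have "t * (4 * m) \<le> t * (k - r)\<^sup>2" using m t by (intro mult_left_mono) auto
  then have "4 * (t * m + r * (2 * v + (t - 1) * (M + \<rho>)) + (2 * v * r\<^sup>2 + 4 * v\<^sup>2 * r))
     \<le> t * (k - r)\<^sup>2 + (4 * (r * (2 * v + (t - 1) * (M + \<rho>))) + 4 * (2 * v * r\<^sup>2 + 4 * v\<^sup>2 * r))"
    unfolding distrib_left[of 4] by simp
  also have "\<dots> = t * k\<^sup>2 + r * (- 2 * t * k + t * r + 8 * v + 4 * ((t - 1) * (M + \<rho>)) + 8 * v * r + 16 * v\<^sup>2)"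
    by (simp add: algebra_simps power2_eq_square)
  also have "\<dots> \<le> t * k\<^sup>2 - t" using fin by linarith
  finally show ?thesis .
qed

text \<open>For \<open>t \<le> n\<close> this is the number of triangles of
  \<open>S_graph n t\<close>, sorted by three, two or one vertex in the complete part.\<close>

definition extremal_count :: "nat \<Rightarrow> nat \<Rightarrow> nat" where
  "extremal_count n t = (t choose 3) + (t choose 2) * (n - t)
     + t * (((n - t) div 2) * (n - t - (n - t) div 2))"

section \<open>Graphs without the blowup of a tree\<close>

locale tree_free =
  fixes T :: "'a graph" and A :: "'a set" and t :: nat and G :: "'b graph"
  assumes tree: "is_tree T"
    and A: "A \<subseteq> verts T" "\<And>e. e \<in> edges T \<Longrightarrow> card (A \<inter> e) = 1" "card A = Suc t"
    and wfG: "wf_graph G"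
    and free: "\<not> contains_copy G (tri_blowup T)"
begin

abbreviation vT :: nat where "vT \<equiv> card (verts T)"

text \<open>The threshold exceeds the number of vertices and apexes of any partial copy of the blowup, so the
  apexes of thick edges can always be chosen last.\<close>
definition thick :: "'b set set" where "thick = {e \<in> edges G. 2 * vT < card (cn G e)}"
definition thin :: "'b set set" where "thin = {e \<in> edges G. card (cn G e) \<le> 2 * vT}"
definition NT :: "'b \<Rightarrow> 'b set" where "NT y = {x. {y, x} \<in> thick}"

lemma wfT: "wf_graph T" using tree by (simp add: is_tree_def)

lemma two: "\<forall>e\<in>edges T. \<exists>x y. x \<noteq> y \<and> e = {x, y}"
  using wfT unfolding wf_graph_def by blast

lemma finG: "finite (verts G)" "finite (edges G)"
  using wf_finite_verts[OF wfG] wf_finite_edges[OF wfG] by auto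

lemma finT: "finite (verts T)" "finite (edges T)"
  using wf_finite_verts[OF wfT] wf_finite_edges[OF wfT] by auto

lemma thick_edge: "e \<in> thick \<Longrightarrow> e \<in> edges G" and thin_edge: "e \<in> thin \<Longrightarrow> e \<in> edges G"
  by (auto simp: thick_def thin_def)

lemma not_thick_thin: "e \<in> edges G \<Longrightarrow> e \<notin> thick \<Longrightarrow> e \<in> thin"
  by (auto simp: thick_def thin_def)

lemma fin_thick: "finite thick" and fin_thin: "finite thin"
  using finG by (auto simp: thick_def thin_def)

lemma NT_subset: "NT y \<subseteq> verts G"
  using wf_edgeD[OF wfG thick_edge] by (auto simp: NT_def)

lemma fin_NT: "finite (NT y)"
  using NT_subset finG(1) finite_subset by blast

lemma NT_sym: "x \<in> NT y \<longleftrightarrow> y \<in> NT x"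
  by (simp add: NT_def insert_commute)

lemma edge_two:
  assumes "e \<in> edges G" "e \<subseteq> S"
  shows "\<exists>x y. x \<noteq> y \<and> e = {x, y} \<and> x \<in> S \<and> y \<in> S"
proof -
  obtain x y where "x \<noteq> y" "e = {x, y}" using wfG assms(1) by (rule wf_edgeE)
  then show ?thesis using assms(2) by auto
qed

lemma edgesT_le: "card (edges T) < vT"
  by (rule tree_edges_less_verts[OF tree])

section \<open>Linear bounds by greedy embedding\<close>

lemma complete_copy_False:
  assumes "inj_on f (verts T)" "f ` verts T \<subseteq> verts G"
    and "\<And>e. e \<in> edges T \<Longrightarrow> f ` e \<in> edges G"
    and "E0 \<subseteq> edges T" "inj_on g E0" "\<And>e. e \<in> E0 \<Longrightarrow> g e \<in> cn G (f ` e) - f ` verts T"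
    and rest: "\<And>e. e \<in> edges T - E0 \<Longrightarrow> f ` e \<in> thick"
  shows False
proof -
  have "contains_copy G (tri_blowup T)"
  proof (rule complete_copy[OF wfT wfG assms(1-6)])
    fix e assume "e \<in> edges T - E0"
    then have "2 * vT < card (cn G (f ` e))" using rest by (auto simp: thick_def)
    then show "card (verts T) + card (edges T) \<le> card (cn G (f ` e))" using edgesT_le by linarith
  qed
  then show False using free by simp
qed

text \<open>Every vertex of \<open>L\<close> can continue inside \<open>L\<close>, around any
  \<open>2 * vT\<close> occupied vertices, along an edge that brings its own apex. So the tree
  embeds greedily: a node is a vertex paired with the apex over the edge to its parent, which costs
  two host vertices for each tree vertex.\<close>

lemma no_live_set:
  assumes L: "L \<subseteq> verts G" "L \<noteq> {}"
    and ext: "\<And>a U. a \<in> L \<Longrightarrow> finite U \<Longrightarrow> card U \<le> 2 * vT \<Longrightarrow>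
      \<exists>x\<in>L. \<exists>b. x \<notin> U \<and> b \<notin> U \<and> {a, x} \<in> edges G \<and> b \<in> cn G {a, x}"
  shows False
proof -
  obtain r where r: "r \<in> verts T" using tree by (auto simp: is_tree_def)
  obtain a0 where a0: "a0 \<in> L" using L by blast
  let ?Lv = "\<lambda>(_ :: 'a) n. fst n \<in> L"
  let ?R = "\<lambda>m n. {fst m, fst n} \<in> edges G \<and> snd n \<in> cn G {fst m, fst n}"
  let ?S = "\<lambda>n. {fst n, snd n}"
  have "\<exists>h c. (\<forall>w\<in>verts T. ?Lv w (h w) \<and> ?S (h w) \<inter> {} = {})
     \<and> (\<forall>u\<in>verts T. \<forall>w\<in>verts T. u \<noteq> w \<longrightarrow> ?S (h u) \<inter> ?S (h w) = {})
     \<and> inj_on c {e\<in>edges T. e \<subseteq> verts T}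
     \<and> (\<forall>e\<in>edges T. e \<subseteq> verts T \<longrightarrow> c e \<in> verts T \<and> (\<exists>p\<in>verts T. e = {p, c e} \<and> ?R (h p) (h (c e))))"
  proof (rule grown_embed[where M = "2 * vT" and s = 2, OF grown_tree[OF tree r] two])
    \<comment> \<open>The root has no parent edge; its apex entry is a dummy.\<close>
    show "?Lv r (a0, a0)" using a0 by simp
    fix x :: "'b \<times> 'b" and U :: "'b set"
    assume "fst x \<in> L" "finite U" "card U \<le> 2 * vT"
    then obtain y b where "y \<in> L" "y \<notin> U" "b \<notin> U" "{fst x, y} \<in> edges G" "b \<in> cn G {fst x, y}"
      using ext by blast
    then show "\<exists>n. fst n \<in> L \<and> ?R x n \<and> ?S n \<inter> U = {}" by (intro exI[of _ "(y, b)"]) auto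
  next
    fix y :: "'b \<times> 'b"
    show "finite (?S y) \<and> card (?S y) \<le> 2" by (simp add: card_insert_if)
  qed auto
  then obtain h c where h: "\<forall>w\<in>verts T. fst (h w) \<in> L"
    "\<forall>u\<in>verts T. \<forall>w\<in>verts T. u \<noteq> w \<longrightarrow> ?S (h u) \<inter> ?S (h w) = {}"
    and c: "inj_on c {e\<in>edges T. e \<subseteq> verts T}"
    "\<forall>e\<in>edges T. e \<subseteq> verts T \<longrightarrow> c e \<in> verts T \<and> (\<exists>p\<in>verts T. e = {p, c e} \<and> ?R (h p) (h (c e)))"
    by (elim exE conjE) auto
  have eqE: "{e\<in>edges T. e \<subseteq> verts T} = edges T" using wf_edge_subset[OF wfT] by auto
  let ?f = "\<lambda>w. fst (h w)" and ?g = "\<lambda>e. snd (h (c e))"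
  have ce: "c e \<in> verts T \<and> (\<exists>p. ?f ` e = {?f p, ?f (c e)} \<and> ?R (h p) (h (c e)))"
    if e: "e \<in> edges T" for e
  proof -
    note ce = c(2)[rule_format, OF e wf_edge_subset[OF wfT e]]
    obtain p where p: "e = {p, c e} \<and> ?R (h p) (h (c e))"
      using conjunct2[OF ce] by (rule bexE)
    have "?f ` e = ?f ` {p, c e}" by (rule arg_cong[OF conjunct1[OF p]])
    also have "\<dots> = {?f p, ?f (c e)}" by (simp only: image_insert image_empty)
    finally have "?f ` e = {?f p, ?f (c e)} \<and> ?R (h p) (h (c e))"
      using conjunct2[OF p] by (rule conjI)
    then show ?thesis using conjunct1[OF ce] by blast
  qed
  show False
  proof (rule complete_copy_False[of ?f "edges T" ?g])
    show "inj_on ?f (verts T)"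
    proof (rule inj_onI, rule ccontr)
      fix x y assume "x \<in> verts T" "y \<in> verts T" "?f x = ?f y" "x \<noteq> y"
      then show False using h(2) by fastforce
    qed
    show "?f ` verts T \<subseteq> verts G" using h(1) L(1) by auto
    show "?f ` e \<in> edges G" if e: "e \<in> edges T" for e
    proof -
      obtain p where "?f ` e = {?f p, ?f (c e)}" "?R (h p) (h (c e))" using ce[OF e] by blast
      then show ?thesis by simp
    qed
    show "inj_on ?g (edges T)"
    proof (rule inj_onI, rule ccontr)
      fix x y assume xy: "x \<in> edges T" "y \<in> edges T" "?g x = ?g y" "x \<noteq> y"
      then have "c x \<noteq> c y" using c(1) unfolding eqE inj_on_def by blast
      then have "?S (h (c x)) \<inter> ?S (h (c y)) = {}" using h(2) ce[OF xy(1)] ce[OF xy(2)] by blast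
      then show False using xy(3) by auto
    qed
    show "?g e \<in> cn G (?f ` e) - ?f ` verts T" if e: "e \<in> edges T" for e
    proof -
      obtain p where p: "?f ` e = {?f p, ?f (c e)}" "?R (h p) (h (c e))" using ce[OF e] by blast
      then have in_cn: "?g e \<in> cn G (?f ` e)" using p(2) by simp
      have ne1: "?g e \<noteq> ?f (c e)"
      proof
        assume "?g e = ?f (c e)"
        then have "{?f (c e), ?f (c e)} \<in> edges G" using p(2) by (simp add: cn_def)
        then show False using wf_edgeD(1)[OF wfG] by blast
      qed
      have ne2: "?g e \<noteq> ?f w" if "w \<in> verts T" "w \<noteq> c e" for w
      proof -
        have "?S (h w) \<inter> ?S (h (c e)) = {}" using h(2) that ce[OF e] by blast
        then show ?thesis by auto
      qed
      have "?g e \<notin> ?f ` verts T"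
      proof
        assume "?g e \<in> ?f ` verts T"
        then obtain w where w: "?g e = ?f w" "w \<in> verts T" by (rule imageE)
        show False
        proof (cases "w = c e")
          case True
          show ?thesis using ne1 w(1) unfolding True by (rule notE)
        next
          case False
          show ?thesis using ne2[OF w(2) False] w(1) by (rule notE)
        qed
      qed
      then show ?thesis using in_cn by (intro DiffI)
    qed
  qed auto
qed

text \<open>Otherwise some subgraph has minimum thick degree above \<open>2 * vT\<close>. There the
  next vertex and its apex both have more than \<open>2 * vT\<close> choices.\<close>

lemma thick_linear:
  assumes S: "S \<subseteq> verts G"
  shows "card {e\<in>thick. e \<subseteq> S} \<le> 2 * vT * card S"
proof (rule ccontr)
  assume "\<not> ?thesis"
  then have big: "2 * vT * card S < card {e\<in>thick. e \<subseteq> S}" by simp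
  have sub: "\<forall>e\<in>{e\<in>thick. e \<subseteq> S}. e \<subseteq> S \<and> e \<noteq> {}"
    using edge_two[OF thick_edge, of _ S] by auto
  have fin: "finite S" "finite {e\<in>thick. e \<subseteq> S}"
    using fin_thick finite_subset[OF S finG(1)] by auto
  obtain V' where V': "V' \<subseteq> S" "V' \<noteq> {}"
    "\<forall>v\<in>V'. 2 * vT < card {e\<in>{e\<in>thick. e \<subseteq> S}. v \<in> e \<and> e \<subseteq> V'}"
    using min_degree_subfamily[OF fin sub big] by (elim exE conjE) (rule that)
  show False
  proof (rule no_live_set[of V'])
    show "V' \<subseteq> verts G" "V' \<noteq> {}" using V' S by auto
    fix a and U :: "'b set" assume a: "a \<in> V'" and U: "finite U" "card U \<le> 2 * vT"
    let ?H = "{e\<in>{e\<in>thick. e \<subseteq> S}. a \<in> e \<and> e \<subseteq> V'}"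
    have "\<not> ?H \<subseteq> (\<lambda>u. {a, u}) ` U"
    proof
      assume "?H \<subseteq> (\<lambda>u. {a, u}) ` U"
      then have "card ?H \<le> card ((\<lambda>u. {a, u}) ` U)" using U(1) by (intro card_mono) auto
      also have "\<dots> \<le> card U" by (rule card_image_le[OF U(1)])
      finally show False using bspec[OF V'(3) a] U(2) by linarith
    qed
    then obtain e where e: "e \<in> thick" "a \<in> e" "e \<subseteq> V'" "e \<notin> (\<lambda>u. {a, u}) ` U" by blast
    obtain p q where "e = {p, q}" using edge_two[OF thick_edge[OF e(1)] e(3)] by blast
    then obtain x where x: "e = {a, x}" using e(2) by (metis empty_iff insertE insert_commute)
    then have x2: "x \<in> V'" "x \<notin> U" using e by auto
    have "card U < card (cn G e)" using e(1) U(2) by (simp add: thick_def)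
    then have "\<not> cn G e \<subseteq> U" using card_mono[OF U(1)] by (meson not_le)
    then obtain b where "b \<in> cn G e" "b \<notin> U" by blast
    then show "\<exists>x\<in>V'. \<exists>b. x \<notin> U \<and> b \<notin> U \<and> {a, x} \<in> edges G \<and> b \<in> cn G {a, x}"
      using x x2 thick_edge[OF e(1)] by blast
  qed
qed

definition tri0 :: "'b set set" where
  "tri0 = {s \<in> triangles G. \<forall>x\<in>s. \<forall>y\<in>s. x \<noteq> y \<longrightarrow> {x, y} \<in> thin}"

definition tri3 :: "'b set set" where
  "tri3 = {s \<in> triangles G. \<forall>x\<in>s. \<forall>y\<in>s. x \<noteq> y \<longrightarrow> {x, y} \<in> thick}"

lemma fin_tri: "finite (triangles G)" "finite tri0" "finite tri3"
  using finite_triangles[OF wfG] by (auto simp: tri0_def tri3_def)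

text \<open>In a subfamily of minimum degree above \<open>(2 * vT)^2\<close>, a continuation at
  \<open>a\<close> is spoiled only by triangles through \<open>a\<close> and an occupied vertex
  \<open>u\<close>. The edge \<open>{a, u}\<close> is then thin, so each \<open>u\<close> spoils at
  most \<open>2 * vT\<close> of them.\<close>

lemma tri0_linear:
  assumes S: "S \<subseteq> verts G"
  shows "card {s\<in>tri0. s \<subseteq> S} \<le> 2 * vT * (2 * vT) * card S"
proof (rule ccontr)
  assume "\<not> ?thesis"
  then have big: "2 * vT * (2 * vT) * card S < card {s\<in>tri0. s \<subseteq> S}" by simp
  have sub: "\<forall>s\<in>{s\<in>tri0. s \<subseteq> S}. s \<subseteq> S \<and> s \<noteq> {}"
    by (auto simp: tri0_def triangles_def)
  have fin: "finite S" "finite {s\<in>tri0. s \<subseteq> S}"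
    using fin_tri finite_subset[OF S finG(1)] by auto
  obtain V' where V': "V' \<subseteq> S" "V' \<noteq> {}"
    "\<forall>v\<in>V'. 2 * vT * (2 * vT) < card {s\<in>{s\<in>tri0. s \<subseteq> S}. v \<in> s \<and> s \<subseteq> V'}"
    using min_degree_subfamily[OF fin sub big] by (elim exE conjE) (rule that)
  show False
  proof (rule no_live_set[of V'])
    show "V' \<subseteq> verts G" "V' \<noteq> {}" using V' S by auto
    fix a and U :: "'b set" assume a: "a \<in> V'" and U: "finite U" "card U \<le> 2 * vT"
    let ?H = "{s\<in>{s\<in>tri0. s \<subseteq> S}. a \<in> s \<and> s \<subseteq> V'}"
    let ?B = "\<Union>u\<in>{u\<in>U. {a, u} \<in> thin}. {s \<in> triangles G. {a, u} \<subseteq> s}"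
    have cB: "card ?B \<le> 2 * vT * (2 * vT)"
    proof -
      have "card ?B \<le> (\<Sum>u\<in>{u\<in>U. {a, u} \<in> thin}. card {s \<in> triangles G. {a, u} \<subseteq> s})"
        using U(1) by (intro card_UN_le) auto
      also have "\<dots> \<le> (\<Sum>u\<in>{u\<in>U. {a, u} \<in> thin}. 2 * vT)"
      proof (rule sum_mono)
        fix u assume "u \<in> {u\<in>U. {a, u} \<in> thin}"
        then have th: "{a, u} \<in> thin" by simp
        show "card {s \<in> triangles G. {a, u} \<subseteq> s} \<le> 2 * vT"
          using th unfolding card_triangles_over_edge[OF wfG thin_edge[OF th]] by (simp add: thin_def)
      qed
      also have "\<dots> \<le> card U * (2 * vT)"
        using U(1) by (simp add: card_mono)
      also have "\<dots> \<le> 2 * vT * (2 * vT)" using U(2) by simp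
      finally show ?thesis .
    qed
    have "\<not> ?H \<subseteq> ?B"
    proof
      assume "?H \<subseteq> ?B"
      then have "card ?H \<le> card ?B" using U(1) fin_tri(1) by (intro card_mono) auto
      then show False using cB bspec[OF V'(3) a] by linarith
    qed
    then obtain s where s: "s \<in> tri0" "a \<in> s" "s \<subseteq> V'" "s \<notin> ?B" by blast
    then have "s \<in> triangles G" by (simp add: tri0_def)
    then obtain x b where xb: "s = {a, x, b}" "a \<noteq> x" "a \<noteq> b" "{a, x} \<in> edges G"
      "{a, b} \<in> edges G" "{x, b} \<in> edges G" "s \<subseteq> verts G"
      using s(2) by (metis triangle_cases)
    have "{a, x} \<in> thin" "{a, b} \<in> thin" using s(1) xb by (auto simp: tri0_def)
    then have "x \<notin> U" "b \<notin> U" using s(4) \<open>s \<in> triangles G\<close> xb(1) by auto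
    moreover have "b \<in> cn G {a, x}" using xb by (auto simp: cn_def)
    ultimately show "\<exists>x\<in>V'. \<exists>b. x \<notin> U \<and> b \<notin> U \<and> {a, x} \<in> edges G \<and> b \<in> cn G {a, x}"
      using xb s(3) by auto
  qed
qed

text \<open>Deleting one edge \<open>q s\<close> from each all-thin triangle \<open>s\<close> inside
  \<open>S\<close> leaves a triangle-free graph, and \<open>tri0_linear\<close> bounds the number of
  deletions.\<close>

lemma thin_sub_bound:
  assumes S: "S \<subseteq> verts G"
  shows "4 * card {e\<in>thin. e \<subseteq> S} \<le> (card S)\<^sup>2 + 16 * vT\<^sup>2 * card S"
proof -
  let ?T0 = "{s\<in>tri0. s \<subseteq> S}" and ?E = "{e\<in>thin. e \<subseteq> S}"
  define q where "q s = (SOME e. e \<in> thin \<and> e \<subseteq> s)" for s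
  have q: "q s \<in> thin \<and> q s \<subseteq> s" if "s \<in> tri0" for s
  proof -
    have "s \<in> triangles G" using that by (simp add: tri0_def)
    then have "s \<noteq> {}" by (auto simp: triangles_def)
    then obtain a x b where "s = {a, x, b}" "a \<noteq> x" using \<open>s \<in> triangles G\<close>
      by (metis ex_in_conv triangle_cases)
    then have "\<exists>e. e \<in> thin \<and> e \<subseteq> s" using that by (intro exI[of _ "{a, x}"]) (auto simp: tri0_def)
    then show ?thesis unfolding q_def by (rule someI_ex)
  qed
  let ?E' = "?E - q ` ?T0"
  have finS: "finite S" using S finG(1) finite_subset by auto
  have "4 * card ?E' \<le> (card S)\<^sup>2"
  proof (rule mantel[OF finS])
    fix e assume "e \<in> ?E'"
    then show "\<exists>x y. x \<noteq> y \<and> e = {x, y} \<and> x \<in> S \<and> y \<in> S"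
      using edge_two[OF thin_edge, of e S] by simp
  next
    fix x y z assume xyz: "{x, y} \<in> ?E'" "{y, z} \<in> ?E'" "{x, z} \<in> ?E'"
    then have th: "{x, y} \<in> thin" "{y, z} \<in> thin" "{x, z} \<in> thin" and sub: "{x, y, z} \<subseteq> S" by auto
    then have tr: "{x, y, z} \<in> triangles G" "x \<noteq> y" "y \<noteq> z" "x \<noteq> z"
      using triangleI[OF wfG, of x y z] thin_edge by auto
    then have t0: "{x, y, z} \<in> ?T0" using th sub by (auto simp: tri0_def insert_commute)
    then have qs: "q {x, y, z} \<in> thin" "q {x, y, z} \<subseteq> {x, y, z}" using q by auto
    obtain a b where ab: "a \<noteq> b" "q {x, y, z} = {a, b}" "a \<in> {x, y, z}" "b \<in> {x, y, z}"
      using edge_two[OF thin_edge[OF qs(1)] qs(2)] by blast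
    then have "q {x, y, z} \<in> {{x, y}, {y, z}, {x, z}}" by (auto simp: insert_commute)
    then show False using xyz t0 by auto
  qed
  moreover have "card ?E \<le> card ?E' + card ?T0"
  proof -
    have "card ?E \<le> card (?E' \<union> q ` ?T0)" using fin_thin fin_tri by (intro card_mono) auto
    also have "\<dots> \<le> card ?E' + card (q ` ?T0)" by (rule card_Un_le)
    also have "\<dots> \<le> card ?E' + card ?T0" using fin_tri by (simp add: card_image_le)
    finally show ?thesis .
  qed
  moreover have "card ?T0 \<le> 4 * vT\<^sup>2 * card S"
    using tri0_linear[OF S] by (simp add: power2_eq_square algebra_simps)
  ultimately show ?thesis by linarith
qed

lemma thick_degree_sum: "(\<Sum>x\<in>verts G. card (NT x)) \<le> 4 * vT * card (verts G)"
proof -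
  have eq: "{e\<in>thick. e \<subseteq> verts G} = thick" using wf_edge_subset[OF wfG thick_edge] by auto
  have NTeq: "NT x = {y\<in>verts G. {x, y} \<in> thick}" for x
    using NT_subset[of x] by (auto simp: NT_def)
  have "(\<Sum>x\<in>verts G. card (NT x)) = 2 * card thick"
    unfolding NTeq
  proof (rule handshake[OF finG(1)])
    fix e assume "e \<in> thick"
    then show "\<exists>x y. x \<noteq> y \<and> e = {x, y} \<and> x \<in> verts G \<and> y \<in> verts G"
      using edge_two[OF thick_edge] wf_edge_subset[OF wfG thick_edge] by simp
  qed
  then show ?thesis using thick_linear[of "verts G"] eq by simp
qed

text \<open>Seen from a vertex \<open>x\<close>, an all-thick triangle is a thick edge inside
  \<open>NT x\<close>. Summing \<open>thick_linear\<close> over all \<open>x\<close> reduces the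
  count to the sum of the thick degrees.\<close>

lemma tri3_linear: "card tri3 \<le> 8 * vT\<^sup>2 * card (verts G)"
proof -
  let ?H = "\<lambda>x. {e\<in>thick. e \<subseteq> NT x}"
  have "tri3 \<subseteq> (\<Union>x\<in>verts G. insert x ` ?H x)"
  proof
    fix s assume s: "s \<in> tri3"
    then have tr: "s \<in> triangles G" by (simp add: tri3_def)
    then have "s \<noteq> {}" by (auto simp: triangles_def)
    then obtain a x b where abx: "s = {a, x, b}" "a \<noteq> x" "a \<noteq> b" "x \<noteq> b" "s \<subseteq> verts G"
      using tr by (metis ex_in_conv triangle_cases)
    then have "{a, x} \<in> thick" "{a, b} \<in> thick" "{x, b} \<in> thick" using s by (auto simp: tri3_def)
    then have "{x, b} \<in> ?H a" by (auto simp: NT_def)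
    then show "s \<in> (\<Union>x\<in>verts G. insert x ` ?H x)" using abx by blast
  qed
  then have "card tri3 \<le> card (\<Union>x\<in>verts G. insert x ` ?H x)"
    using finG(1) fin_thick by (intro card_mono) auto
  also have "\<dots> \<le> (\<Sum>x\<in>verts G. card (insert x ` ?H x))" by (rule card_UN_le[OF finG(1)])
  also have "\<dots> \<le> (\<Sum>x\<in>verts G. 2 * vT * card (NT x))"
  proof (rule sum_mono)
    fix x
    have "card (insert x ` ?H x) \<le> card (?H x)" using fin_thick by (intro card_image_le) auto
    also have "\<dots> \<le> 2 * vT * card (NT x)" by (rule thick_linear[OF NT_subset])
    finally show "card (insert x ` ?H x) \<le> 2 * vT * card (NT x)" .
  qed
  also have "\<dots> = 2 * vT * (\<Sum>x\<in>verts G. card (NT x))" by (simp add: sum_distrib_left)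
  also have "\<dots> \<le> 2 * vT * (4 * vT * card (verts G))" by (intro mult_le_mono2 thick_degree_sum)
  finally show ?thesis by (simp add: power2_eq_square algebra_simps)
qed

section \<open>Thin edges with more than t common neighbours\<close>

lemma pick_avoiding:
  assumes big: "M * (2 * vT + 1) < card N" and U: "finite U" "card U \<le> M"
    and P: "\<And>z u. z \<in> N \<Longrightarrow> u \<in> P z \<Longrightarrow> {a, u} \<in> thin \<and> z \<in> cn G {a, u}"
  shows "\<exists>z\<in>N. z \<notin> U \<and> P z \<inter> U = {}"
proof -
  let ?U = "{u\<in>U. {a, u} \<in> thin}"
  \<comment> \<open>An occupied vertex \<open>u\<close> blocks itself and, if \<open>{a, u}\<close>
    is thin, the at most \<open>2 * vT\<close> candidates that could reserve it; hence the factor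
    \<open>2 * vT + 1\<close>.\<close>
  let ?B = "U \<union> (\<Union>u\<in>?U. cn G {a, u})"
  have finB: "finite ?B" using U(1) finite_cn[OF wfG] by auto
  have "card (\<Union>u\<in>?U. cn G {a, u}) \<le> (\<Sum>u\<in>?U. card (cn G {a, u}))"
    using U(1) by (intro card_UN_le) auto
  also have "\<dots> \<le> (\<Sum>u\<in>?U. 2 * vT)" by (intro sum_mono) (auto simp: thin_def)
  also have "\<dots> \<le> card U * (2 * vT)" using U(1) by (simp add: card_mono)
  also have "\<dots> \<le> M * (2 * vT)" using U(2) by simp
  finally have "card ?B \<le> M + M * (2 * vT)"
    using card_Un_le[of U "\<Union>u\<in>?U. cn G {a, u}"] U(2) by linarith
  then have "card ?B < card N" using big by (simp add: algebra_simps)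
  then have "\<not> N \<subseteq> ?B" using card_mono[OF finB, of N] by linarith
  then obtain z where z: "z \<in> N" "z \<notin> ?B" by blast
  have "P z \<inter> U = {}"
  proof (rule ccontr)
    assume "P z \<inter> U \<noteq> {}"
    then obtain u where u: "u \<in> P z" "u \<in> U" by blast
    then show False using P[OF z(1) u(1)] z(2) by auto
  qed
  then show ?thesis using z by blast
qed

lemma cn_not_self: "w \<in> cn G e \<Longrightarrow> w \<notin> e"
  using wf_edgeD(1)[OF wfG, of w w] by (auto simp: cn_def)

lemma cn_edge: "w \<in> cn G {y, z} \<Longrightarrow> {y, w} \<in> edges G \<and> {z, w} \<in> edges G"
  by (simp add: cn_def)

lemma cn_rotate: "{y, z} \<in> edges G \<Longrightarrow> w \<in> cn G {y, z} \<Longrightarrow> z \<in> cn G {y, w} \<and> y \<in> cn G {z, w}"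
  using wf_edgeD[OF wfG, of y z] by (simp add: cn_def insert_commute)

lemma not_NT_thin: "{y, w} \<in> edges G \<Longrightarrow> w \<notin> NT y \<Longrightarrow> {y, w} \<in> thin"
  using not_thick_thin by (simp add: NT_def)

text \<open>Greedy embedding: each tree edge takes the private apex of its child end, which is why apexes
  private to either end of the thin edges are needed.\<close>
lemma private_both_bound:
  assumes E: "\<And>y z. (y, z) \<in> E \<Longrightarrow> {y, z} \<in> thin"
    and D: "\<And>y z. (y, z) \<in> E \<Longrightarrow> card (NT y) \<le> D \<and> card (NT z) \<le> D"
    and pq: "\<And>y z. (y, z) \<in> E \<Longrightarrow> \<exists>p q. p \<in> cn G {y, z} \<and> q \<in> cn G {y, z}
      \<and> p \<in> NT y - NT z \<and> q \<in> NT z - NT y"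
  shows "card E \<le> D * (D * (2 * vT * (2 * vT + 1) * (2 * card (verts G))))"
proof -
  have EV: "E \<subseteq> verts G \<times> verts G" using E thin_edge wf_edgeD[OF wfG] by fast
  then have finE: "finite E" using finG(1) finite_subset by blast
  have "\<forall>e\<in>E. \<exists>p. p \<in> cn G {fst e, snd e} \<and> p \<in> NT (fst e) - NT (snd e)"
  proof
    fix e assume "e \<in> E"
    then have "(fst e, snd e) \<in> E" by simp
    from pq[OF this] show "\<exists>p. p \<in> cn G {fst e, snd e} \<and> p \<in> NT (fst e) - NT (snd e)" by blast
  qed
  from bchoice[OF this] obtain p where
    p: "\<forall>e\<in>E. p e \<in> cn G {fst e, snd e} \<and> p e \<in> NT (fst e) - NT (snd e)" by (rule exE)
  have "\<forall>e\<in>E. \<exists>q. q \<in> cn G {fst e, snd e} \<and> q \<in> NT (snd e) - NT (fst e)"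
  proof
    fix e assume "e \<in> E"
    then have "(fst e, snd e) \<in> E" by simp
    from pq[OF this] show "\<exists>q. q \<in> cn G {fst e, snd e} \<and> q \<in> NT (snd e) - NT (fst e)" by blast
  qed
  from bchoice[OF this] obtain q where
    q: "\<forall>e\<in>E. q e \<in> cn G {fst e, snd e} \<and> q e \<in> NT (snd e) - NT (fst e)" by (rule exE)
  have De: "card (NT (fst e)) \<le> D \<and> card (NT (snd e)) \<le> D" if "e \<in> E" for e
    using D[of "fst e" "snd e"] that by simp
  \<comment> \<open>Pigeonhole, used twice at the cost of a factor \<open>D\<close> each:
    \<open>p\<close> comes to depend on the first end only and \<open>q\<close> on the second only,
    so that placing a vertex determines its apex.\<close>
  have "\<exists>E' p'. E' \<subseteq> E \<and> card E \<le> D * card E' \<and> (\<forall>e\<in>E'. p e = p' (fst e))"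
    by (rule popular_label[OF finE, of NT]) (use p De fin_NT in \<open>auto\<close>)
  then obtain E1 p' where E1: "E1 \<subseteq> E" "card E \<le> D * card E1" "\<forall>e\<in>E1. p e = p' (fst e)"
    by blast
  have finE1: "finite E1" using E1(1) finE finite_subset by blast
  have "\<exists>E' q'. E' \<subseteq> E1 \<and> card E1 \<le> D * card E' \<and> (\<forall>e\<in>E'. q e = q' (snd e))"
    by (rule popular_label[OF finE1, of NT]) (use q De fin_NT E1(1) in \<open>auto\<close>)
  then obtain E2 q' where E2: "E2 \<subseteq> E1" "card E1 \<le> D * card E2" "\<forall>e\<in>E2. q e = q' (snd e)"
    by blast
  let ?K = "2 * vT * (2 * vT + 1)"
  have "card E2 \<le> ?K * (2 * card (verts G))"
  proof (rule ccontr)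
    assume "\<not> ?thesis"
    then have big: "?K * (2 * card (verts G)) < card E2" by simp
    have E2V: "E2 \<subseteq> verts G \<times> verts G" using E1(1) E2(1) EV by blast
    obtain Y Z where YZ: "Y \<subseteq> verts G" "Z \<subseteq> verts G" "Y \<noteq> {}"
      "\<forall>y\<in>Y. ?K < card {z\<in>Z. (y, z) \<in> E2}" "\<forall>z\<in>Z. ?K < card {y\<in>Y. (y, z) \<in> E2}"
      using bipartite_min_degree[OF finG(1) E2V big] by (elim exE conjE) (rule that)
    have e2: "{y, z} \<in> edges G" "p' y \<in> cn G {y, z}" "p' y \<notin> NT z" "q' z \<in> cn G {y, z}" "q' z \<notin> NT y"
      if "(y, z) \<in> E2" for y z
    proof -
      have m: "(y, z) \<in> E" "(y, z) \<in> E1" using that E1(1) E2(1) by auto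
      have eq: "p (y, z) = p' y" "q (y, z) = q' z"
        using bspec[OF E1(3) m(2)] bspec[OF E2(3) that] by simp_all
      then show "{y, z} \<in> edges G" "p' y \<in> cn G {y, z}" "p' y \<notin> NT z" "q' z \<in> cn G {y, z}" "q' z \<notin> NT y"
        using bspec[OF p m(1)] bspec[OF q m(1)] thin_edge[OF E[OF m(1)]] by (simp_all add: eq)
    qed
    show False
    proof (rule no_live_set[of "Y \<union> Z"])
      show "Y \<union> Z \<subseteq> verts G" "Y \<union> Z \<noteq> {}" using YZ by auto
      fix a and U :: "'b set" assume a: "a \<in> Y \<union> Z" and U: "finite U" "card U \<le> 2 * vT"
      show "\<exists>x\<in>Y \<union> Z. \<exists>b. x \<notin> U \<and> b \<notin> U \<and> {a, x} \<in> edges G \<and> b \<in> cn G {a, x}"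
      proof (cases "a \<in> Y")
        case True
        \<comment> \<open>The apex \<open>q' z\<close> is thick towards the child \<open>z\<close>
          but thin towards the parent \<open>a\<close>, so an occupied vertex is the apex of
          boundedly many candidates.\<close>
        have "\<exists>z\<in>{z\<in>Z. (a, z) \<in> E2}. z \<notin> U \<and> {q' z} \<inter> U = {}"
        proof (rule pick_avoiding[OF bspec[OF YZ(4) True] U])
          fix z u assume "z \<in> {z\<in>Z. (a, z) \<in> E2}" "u \<in> {q' z}"
          then have z: "(a, z) \<in> E2" "u = q' z" by auto
          then have "{a, u} \<in> edges G" "u \<notin> NT a" using e2[OF z(1)] cn_edge by auto
          then show "{a, u} \<in> thin \<and> z \<in> cn G {a, u}"
            using not_NT_thin cn_rotate[OF e2(1,4)[OF z(1)]] z(2) by blast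
        qed
        then obtain z where "z \<in> Z" "(a, z) \<in> E2" "z \<notin> U" "q' z \<notin> U" by auto
        then show ?thesis using e2(1,4) by blast
      next
        case False
        then have aZ: "a \<in> Z" using a by simp
        have "\<exists>y\<in>{y\<in>Y. (y, a) \<in> E2}. y \<notin> U \<and> {p' y} \<inter> U = {}"
        proof (rule pick_avoiding[OF bspec[OF YZ(5) aZ] U])
          fix y u assume "y \<in> {y\<in>Y. (y, a) \<in> E2}" "u \<in> {p' y}"
          then have y: "(y, a) \<in> E2" "u = p' y" by auto
          then have "{a, u} \<in> edges G" "u \<notin> NT a" using e2[OF y(1)] cn_edge by auto
          then show "{a, u} \<in> thin \<and> y \<in> cn G {a, u}"
            using not_NT_thin cn_rotate[OF e2(1,2)[OF y(1)]] y(2) by blast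
        qed
        then obtain y where y: "y \<in> Y" "(y, a) \<in> E2" "y \<notin> U" "p' y \<notin> U" by auto
        then have "{a, y} \<in> edges G" "p' y \<in> cn G {a, y}" using e2(1,2)[OF y(2)] by (auto simp: insert_commute)
        then show ?thesis using y by blast
      qed
    qed
  qed
  then have "card E1 \<le> D * (?K * (2 * card (verts G)))" using E2(2) by (meson le_trans mult_le_mono2)
  then show ?thesis using E1(2) by (meson le_trans mult_le_mono2)
qed

lemma A_edge:
  assumes "e \<in> edges T"
  obtains u w where "e = {u, w}" "u \<in> A" "w \<notin> A"
proof -
  obtain x y where xy: "x \<noteq> y" "e = {x, y}" using wfT assms by (rule wf_edgeE)
  have c: "card (A \<inter> {x, y}) = 1" using A(2)[OF assms] xy(2) by simp
  show thesis
  proof (cases "x \<in> A")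
    case True
    then have "y \<notin> A" using c xy(1) by (cases "y \<in> A") auto
    then show ?thesis using that True xy(2) by blast
  next
    case False
    then have "y \<in> A" using c by (cases "y \<in> A") auto
    then show ?thesis using that[of y x] False xy(2) by (simp add: insert_commute)
  qed
qed

lemma A_edge_other: "{u, w} \<in> edges T \<Longrightarrow> u \<in> A \<longleftrightarrow> w \<notin> A"
  by (elim A_edge) (auto simp: doubleton_eq_iff)

lemma finA: "finite A"
  using A(1) finT(1) finite_subset by blast

lemma t_le: "Suc t \<le> vT"
  using card_mono[OF finT(1) A(1)] A(3) by simp

text \<open>T is first embedded with A in Z and the other class in Y, reserving P y together with y. Then as
  many vertices of A as X has are moved onto X, and each of the others owns one apex in every P y.\<close>
lemma nested_structure_False:
  assumes YZ: "Y \<subseteq> verts G" "Z \<subseteq> verts G" and z0: "z0 \<in> Z"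
    and X: "X \<subseteq> verts G" "card X \<le> Suc t" "finite X" "X \<inter> Y = {}" "X \<inter> Z = {}"
    and P: "\<And>y. y \<in> Y \<Longrightarrow> finite (P y) \<and> card (P y) = Suc t - card X \<and> P y \<inter> X = {}"
    and E: "\<And>y z. \<lbrakk>y \<in> Y; z \<in> Z; (y, z) \<in> E\<rbrakk> \<Longrightarrow> {y, z} \<in> edges G \<and> P y \<subseteq> cn G {y, z} - NT z"
    and XNT: "\<And>y. y \<in> Y \<Longrightarrow> X \<subseteq> NT y"
    and degY: "\<And>y. y \<in> Y \<Longrightarrow> (vT + (vT + 1) * vT) * (2 * vT + 1) < card {z\<in>Z. (y, z) \<in> E}"
    and degZ: "\<And>z. z \<in> Z \<Longrightarrow> (vT + (vT + 1) * vT) * (2 * vT + 1) < card {y\<in>Y. (y, z) \<in> E}"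
  shows False
proof -
  let ?M = "vT + (vT + 1) * vT"
  have "A \<noteq> {}" using A(3) by auto
  then obtain r where r: "r \<in> A" by blast
  then have rV: "r \<in> verts T" using A(1) by auto
  \<comment> \<open>The Boolean marks the side of a node: \<open>True\<close> for \<open>Y\<close>,
    where \<open>P y\<close> is occupied together with \<open>y\<close>, and \<open>False\<close>
    for \<open>Z\<close>, where only the vertex itself is.\<close>
  let ?Lv = "\<lambda>w n. if w \<in> A then \<not> fst n \<and> snd n \<in> Z else fst n \<and> snd n \<in> Y"
  let ?R = "\<lambda>m n. if fst m then (snd m, snd n) \<in> E else (snd n, snd m) \<in> E"
  let ?S = "\<lambda>n. if fst n then insert (snd n) (P (snd n)) else {snd n}"
  have ex: "\<exists>h c. (\<forall>w\<in>verts T. ?Lv w (h w) \<and> ?S (h w) \<inter> X = {})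
     \<and> (\<forall>u\<in>verts T. \<forall>w\<in>verts T. u \<noteq> w \<longrightarrow> ?S (h u) \<inter> ?S (h w) = {})
     \<and> inj_on c {e\<in>edges T. e \<subseteq> verts T}
     \<and> (\<forall>e\<in>edges T. e \<subseteq> verts T \<longrightarrow> c e \<in> verts T \<and> (\<exists>p\<in>verts T. e = {p, c e} \<and> ?R (h p) (h (c e))))"
  proof (rule grown_embed[where M = ?M and s = "vT + 1", OF grown_tree[OF tree rV] two])
    show "?Lv r (False, z0)" using r z0 by simp
    show "?S (False, z0) \<inter> X = {}" using z0 X(5) by auto
    show "finite X" by (rule X(3))
    show "card X + (vT + 1) * card (verts T) \<le> ?M" using X(2) t_le by simp
  next
    fix w and y :: "bool \<times> 'b"
    assume L: "?Lv w y"
    show "finite (?S y) \<and> card (?S y) \<le> vT + 1"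
    proof (cases "fst y")
      case True
      then have "snd y \<in> Y" using L by (auto split: if_splits)
      then have "finite (P (snd y))" "card (P (snd y)) \<le> vT" using P t_le by fastforce+
      then show ?thesis using True by (simp add: card_insert_if)
    qed simp
  next
    fix p w and x :: "bool \<times> 'b" and U :: "'b set"
    assume pw: "{p, w} \<in> edges T" and L: "?Lv p x" and U: "finite U" "X \<subseteq> U" "card U \<le> ?M"
    show "\<exists>n. ?Lv w n \<and> ?R x n \<and> ?S n \<inter> U = {}"
    proof (cases "p \<in> A")
      case True
      then have w: "w \<notin> A" using A_edge_other[OF pw] by simp
      have x: "\<not> fst x" "snd x \<in> Z" using L True by auto
      have "\<exists>y\<in>{y\<in>Y. (y, snd x) \<in> E}. y \<notin> U \<and> P y \<inter> U = {}"
      proof (rule pick_avoiding[OF degZ[OF x(2)] U(1,3)])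
        fix y u assume "y \<in> {y\<in>Y. (y, snd x) \<in> E}" "u \<in> P y"
        then have u: "{y, snd x} \<in> edges G" "u \<in> cn G {y, snd x}" "u \<notin> NT (snd x)"
          using E[OF _ x(2)] by auto
        then show "{snd x, u} \<in> thin \<and> y \<in> cn G {snd x, u}"
          using not_NT_thin cn_edge[OF u(2)] cn_rotate[OF u(1,2)] by auto
      qed
      then obtain y where "y \<in> Y" "(y, snd x) \<in> E" "y \<notin> U" "P y \<inter> U = {}" by auto
      then show ?thesis using w x by (intro exI[of _ "(True, y)"]) auto
    next
      case False
      then have w: "w \<in> A" using A_edge_other[OF pw] by simp
      have x: "fst x" "snd x \<in> Y" using L False by auto
      have "\<exists>z\<in>{z\<in>Z. (snd x, z) \<in> E}. z \<notin> U \<and> (\<lambda>_. {}) z \<inter> U = {}"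
        by (rule pick_avoiding[OF degY[OF x(2)] U(1,3)]) auto
      then obtain z where "z \<in> Z" "(snd x, z) \<in> E" "z \<notin> U" by auto
      then show ?thesis using w x by (intro exI[of _ "(False, z)"]) auto
    qed
  qed
  then obtain h c where h: "\<forall>w\<in>verts T. ?Lv w (h w) \<and> ?S (h w) \<inter> X = {}"
    "\<forall>u\<in>verts T. \<forall>w\<in>verts T. u \<noteq> w \<longrightarrow> ?S (h u) \<inter> ?S (h w) = {}"
    and c: "\<forall>e\<in>edges T. e \<subseteq> verts T \<longrightarrow> c e \<in> verts T \<and> (\<exists>p\<in>verts T. e = {p, c e} \<and> ?R (h p) (h (c e)))"
    by (elim exE conjE) (rule that)
  define k where "k w = snd (h w)" for w
  have kA: "\<not> fst (h w)" "k w \<in> Z" if "w \<in> A" for w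
    using bspec[OF h(1), of w] that A(1) by (auto simp: k_def)
  have kB: "fst (h w)" "k w \<in> Y" "P (k w) \<inter> X = {}" if "w \<in> verts T" "w \<notin> A" for w
    using bspec[OF h(1) that(1)] that P by (auto simp: k_def)
  have kX: "k w \<notin> X" if "w \<in> verts T" for w
    using bspec[OF h(1) that] by (auto simp: k_def split: if_splits)
  have kS: "k w \<in> ?S (h w)" for w by (simp add: k_def)
  have PS: "P (k w) \<subseteq> ?S (h w)" if "w \<in> verts T" "w \<notin> A" for w
    using kB(1)[OF that] by (auto simp: k_def)
  have disj: "?S (h u) \<inter> ?S (h w) = {}" if "u \<in> verts T" "w \<in> verts T" "u \<noteq> w" for u w
    using h(2) that by blast
  have kE: "(k w, k u) \<in> E" if e: "{u, w} \<in> edges T" and u: "u \<in> A" for u w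
  proof -
    have w: "w \<notin> A" using A_edge_other[OF e] u by simp
    have V: "u \<in> verts T" "w \<in> verts T" using wf_edgeD[OF wfT e] by auto
    note ce = c[rule_format, OF e wf_edge_subset[OF wfT e]]
    obtain p where p: "{u, w} = {p, c {u, w}} \<and> ?R (h p) (h (c {u, w}))"
      using conjunct2[OF ce] by (rule bexE)
    then have "(p = u \<and> c {u, w} = w) \<or> (p = w \<and> c {u, w} = u)" by (metis doubleton_eq_iff)
    then show ?thesis
    proof
      assume a: "p = u \<and> c {u, w} = w"
      have "?R (h u) (h w)"
        using conjunct2[OF p] unfolding conjunct1[OF a] conjunct2[OF a] .
      then show ?thesis using kA(1)[OF u] by (simp add: k_def)
    next
      assume a: "p = w \<and> c {u, w} = u"
      have "?R (h w) (h u)"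
        using conjunct2[OF p] unfolding conjunct1[OF a] conjunct2[OF a] .
      then show ?thesis using kB(1)[OF V(2) w] by (simp add: k_def)
    qed
  qed
  \<comment> \<open>An edge of \<open>T\<close> at \<open>AX\<close> will run to \<open>X\<close>
    and be thick, so its apex is chosen last. For the other edges, \<open>\<beta> y\<close> gives
    each vertex of \<open>A - AX\<close> its own member of \<open>P y\<close>; the cardinality of
    \<open>P y\<close> is tailored to this.\<close>
  obtain AX where AX: "AX \<subseteq> A" "card AX = card X"
    using obtain_subset_with_card_n[of "card X" A] X(2) A(3) by auto
  have finAX: "finite AX" using AX(1) finA finite_subset by blast
  obtain \<iota> where \<iota>: "bij_betw \<iota> AX X" using finite_same_card_bij[OF finAX X(3) AX(2)] by blast
  have cAZ: "card (A - AX) = Suc t - card X"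
    using card_Diff_subset[OF finAX AX(1)] AX(2) A(3) by simp
  have "\<forall>y\<in>Y. \<exists>b. bij_betw b (A - AX) (P y)"
  proof
    fix y assume "y \<in> Y"
    then have "finite (P y)" "card (A - AX) = card (P y)" using P cAZ by auto
    then show "\<exists>b. bij_betw b (A - AX) (P y)" using finite_same_card_bij finA by blast
  qed
  from bchoice[OF this] obtain \<beta> where \<beta>: "\<forall>y\<in>Y. bij_betw (\<beta> y) (A - AX) (P y)" by (rule exE)
  have "\<forall>e\<in>edges T. \<exists>p. e = {fst p, snd p} \<and> fst p \<in> A \<and> snd p \<notin> A"
  proof
    fix e assume "e \<in> edges T"
    then obtain u w where "e = {u, w}" "u \<in> A" "w \<notin> A" by (rule A_edge)
    then show "\<exists>p. e = {fst p, snd p} \<and> fst p \<in> A \<and> snd p \<notin> A" by (intro exI[of _ "(u, w)"]) simp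
  qed
  from bchoice[OF this] obtain pr where
    pr: "\<forall>e\<in>edges T. e = {fst (pr e), snd (pr e)} \<and> fst (pr e) \<in> A \<and> snd (pr e) \<notin> A" by (rule exE)
  have prs: "\<exists>u w. pr e = (u, w) \<and> e = {u, w} \<and> u \<in> A \<and> w \<notin> A \<and> u \<in> verts T \<and> w \<in> verts T
      \<and> (k w, k u) \<in> E \<and> k w \<in> Y \<and> k u \<in> Z" if e: "e \<in> edges T" for e
  proof -
    obtain u w where uw: "pr e = (u, w)" by fastforce
    then have 1: "e = {u, w}" "u \<in> A" "w \<notin> A" using bspec[OF pr e] by auto
    have 2: "{u, w} \<in> edges T" using e 1(1) by simp
    then have 3: "w \<in> verts T" "u \<in> verts T" using wf_edgeD[OF wfT] by blast+
    show ?thesis using uw 1 3 kE[OF 2 1(2)] kB(2)[OF 3(1) 1(3)] kA(2)[OF 1(2)] by blast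
  qed
  define f where "f w = (if w \<in> AX then \<iota> w else k w)" for w
  define g where "g e = \<beta> (k (snd (pr e))) (fst (pr e))" for e
  let ?E0 = "{e\<in>edges T. fst (pr e) \<notin> AX}"
  have \<iota>X: "\<iota> w \<in> X" if "w \<in> AX" for w using bij_betwE[OF \<iota>] that by blast
  have fk: "f w = k w" if "w \<notin> A" for w using that AX(1) by (auto simp: f_def)
  have kinj: "k u \<noteq> k w" if "u \<in> verts T" "w \<in> verts T" "u \<noteq> w" for u w
    using disj[OF that] kS[of u] kS[of w] by auto
  show False
  proof (rule complete_copy_False[of f ?E0 g])
    show "inj_on f (verts T)"
    proof (rule inj_onI)
      fix u w assume uw: "u \<in> verts T" "w \<in> verts T" "f u = f w"
      show "u = w"
      proof (cases "u \<in> AX"; cases "w \<in> AX")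
        assume "u \<in> AX" "w \<in> AX"
        then show ?thesis using uw(3) bij_betw_imp_inj_on[OF \<iota>] by (simp add: f_def inj_on_eq_iff)
      next
        assume "u \<in> AX" "w \<notin> AX"
        then show ?thesis using uw \<iota>X[of u] kX[of w] by (simp add: f_def)
      next
        assume "u \<notin> AX" "w \<in> AX"
        then show ?thesis using uw \<iota>X[of w] kX[of u] by (simp add: f_def)
      next
        assume "u \<notin> AX" "w \<notin> AX"
        then show ?thesis using uw kinj[of u w] by (auto simp: f_def)
      qed
    qed
    show "f ` verts T \<subseteq> verts G"
    proof
      fix v assume "v \<in> f ` verts T"
      then obtain w where w: "w \<in> verts T" "v = f w" by blast
      show "v \<in> verts G"
      proof (cases "w \<in> AX")
        case True
        then show ?thesis using w \<iota>X X(1) by (auto simp: f_def)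
      next
        case False
        then show ?thesis using w kA(2)[of w] kB(2)[of w] YZ by (cases "w \<in> A") (auto simp: f_def)
      qed
    qed
    show "?E0 \<subseteq> edges T" by auto
    have fthick: "f ` e \<in> thick" if e: "e \<in> edges T" "fst (pr e) \<in> AX" for e
    proof -
      obtain u w where uw: "pr e = (u, w)" "e = {u, w}" "w \<notin> A" "k w \<in> Y"
        using prs[OF e(1)] by blast
      have "f u \<in> X" using e(2) uw(1) \<iota>X by (simp add: f_def)
      then have "f u \<in> NT (k w)" using XNT[OF uw(4)] by blast
      then show ?thesis using fk[OF uw(3)] uw(2) by (simp add: NT_def insert_commute)
    qed
    have fthin: "f ` e \<in> edges G \<and> g e \<in> cn G (f ` e) \<and> g e \<in> P (k (snd (pr e)))"
      if e: "e \<in> edges T" "fst (pr e) \<notin> AX" for e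
    proof -
      obtain u w where uw: "pr e = (u, w)" "e = {u, w}" "w \<notin> A" "k w \<in> Y" "k u \<in> Z"
        "(k w, k u) \<in> E" "u \<in> A"
        using prs[OF e(1)] by blast
      have fe: "f ` e = {k w, k u}" using uw e(2) fk[OF uw(3)] by (auto simp: f_def)
      have "u \<in> A - AX" using uw(1,7) e(2) by simp
      then have "\<beta> (k w) u \<in> P (k w)" using bij_betwE[OF bspec[OF \<beta> uw(4)]] by blast
      then show ?thesis using E[OF uw(4,5,6)] fe uw(1) by (auto simp: g_def)
    qed
    show "f ` e \<in> edges G" if "e \<in> edges T" for e
      using fthick[OF that] fthin[OF that] thick_edge by blast
    show "f ` e \<in> thick" if "e \<in> edges T - ?E0" for e
      using fthick[of e] that by blast
    show "inj_on g ?E0"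
    proof (rule inj_onI)
      fix e e' assume ee: "e \<in> ?E0" "e' \<in> ?E0" "g e = g e'"
      obtain u w where uw: "pr e = (u, w)" "e = {u, w}" "w \<notin> A" "k w \<in> Y" "w \<in> verts T" "u \<in> A"
        using prs[of e] ee(1) by blast
      obtain u' w' where uw': "pr e' = (u', w')" "e' = {u', w'}" "w' \<notin> A" "k w' \<in> Y" "w' \<in> verts T" "u' \<in> A"
        using prs[of e'] ee(2) by blast
      have gP: "g e \<in> P (k w)" "g e' \<in> P (k w')" using fthin[of e] fthin[of e'] ee(1,2) uw(1) uw'(1) by auto
      \<comment> \<open>Sets reserved for different vertices are disjoint, so equal apexes belong to
        the same vertex on the \<open>Y\<close> side, where \<open>\<beta>\<close> is
        injective.\<close>
      have "w = w'"
      proof (rule ccontr)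
        assume "w \<noteq> w'"
        have "g e \<noteq> g e'"
          using disj[OF uw(5) uw'(5) \<open>w \<noteq> w'\<close>] subsetD[OF PS[OF uw(5,3)] gP(1)]
            subsetD[OF PS[OF uw'(5,3)] gP(2)] by (rule disjoint_ne)
        then show False using ee(3) by (rule notE)
      qed
      moreover have "u \<in> A - AX" "u' \<in> A - AX" using ee uw(1,6) uw'(1,6) by auto
      moreover have "inj_on (\<beta> (k w)) (A - AX)" using bij_betw_imp_inj_on[OF bspec[OF \<beta> uw(4)]] .
      ultimately have "u = u'" using ee(3) uw(1) uw'(1) by (simp add: g_def inj_on_eq_iff)
      then show "e = e'" using uw(2) uw'(2) \<open>w = w'\<close> by simp
    qed
    show "g e \<in> cn G (f ` e) - f ` verts T" if e: "e \<in> ?E0" for e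
    proof -
      obtain u w where uw: "pr e = (u, w)" "e = {u, w}" "w \<notin> A" "k w \<in> Y" "w \<in> verts T" "u \<in> A"
        using prs[of e] e by blast
      have ge: "g e \<in> cn G (f ` e)" "g e \<in> P (k w)" using fthin[of e] e uw(1) by auto
      have "g e \<noteq> f v" if v: "v \<in> verts T" for v
      proof (cases "v \<in> AX")
        case True
        then have "f v \<in> X" using \<iota>X by (simp add: f_def)
        then show ?thesis using kB(3)[OF uw(5,3)] ge(2) by auto
      next
        case False
        then have fv: "f v = k v" by (simp add: f_def)
        show ?thesis
        proof (cases "v = w")
          case True
          have "f w \<in> f ` e" using uw(2) by simp
          then show ?thesis using cn_not_self[OF ge(1)] True by metis
        next
          case False
          have "k v \<noteq> g e"
            using disj[OF v uw(5) False] kS subsetD[OF PS[OF uw(5,3)] ge(2)] by (rule disjoint_ne)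
          then show ?thesis unfolding fv by (rule not_sym)
        qed
      qed
      then have "g e \<notin> f ` verts T" by blast
      then show ?thesis using ge(1) by (intro DiffI)
    qed
  qed
qed

text \<open>All common neighbours are thick towards \<open>y\<close>, so \<open>z\<close> has no
  private one. The pigeonhole makes a set of \<open>Suc t\<close> of them depend on \<open>y\<close>
  alone, and its trace on \<open>NT z\<close> depend on either end alone. The trace serves as
  \<open>X\<close> and hosts part of \<open>A\<close>; the remaining members are thin towards
  \<open>z\<close> and serve as apexes.\<close>

lemma nested_bound:
  assumes E: "\<And>y z. (y, z) \<in> E \<Longrightarrow> {y, z} \<in> thin"
    and D: "\<And>y z. (y, z) \<in> E \<Longrightarrow> card (NT y) \<le> D \<and> card (NT z) \<le> D"
    and sub: "\<And>y z. (y, z) \<in> E \<Longrightarrow> cn G {y, z} \<subseteq> NT y \<and> Suc t \<le> card (cn G {y, z})"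
  shows "card E \<le> 2 ^ D * 2 ^ D * (2 ^ D * ((vT + (vT + 1) * vT) * (2 * vT + 1) * (2 * card (verts G))))"
proof -
  have EV: "E \<subseteq> verts G \<times> verts G" using E thin_edge wf_edgeD[OF wfG] by fast
  then have finE: "finite E" using finG(1) finite_subset by blast
  have De: "card (NT (fst e)) \<le> D \<and> card (NT (snd e)) \<le> D" if "e \<in> E" for e
    using D[of "fst e" "snd e"] that by simp
  have "\<forall>e\<in>E. \<exists>Q. Q \<subseteq> cn G {fst e, snd e} \<and> card Q = Suc t"
  proof
    fix e assume "e \<in> E"
    then have "Suc t \<le> card (cn G {fst e, snd e})" using sub[of "fst e" "snd e"] by simp
    then show "\<exists>Q. Q \<subseteq> cn G {fst e, snd e} \<and> card Q = Suc t"
      by (rule obtain_subset_with_card_n) blast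
  qed
  from bchoice[OF this] obtain Q where
    Q: "\<forall>e\<in>E. Q e \<subseteq> cn G {fst e, snd e} \<and> card (Q e) = Suc t" by (rule exE)
  have QNT: "Q e \<subseteq> NT (fst e)" if "e \<in> E" for e
    using bspec[OF Q that] sub[of "fst e" "snd e"] that by auto
  have pow: "card (Pow (NT y)) \<le> 2 ^ D" if "card (NT y) \<le> D" for y
    using that fin_NT by (simp add: card_Pow)
  have "\<exists>E' p. E' \<subseteq> E \<and> card E \<le> 2 ^ D * 2 ^ D * card E'
      \<and> (\<forall>e\<in>E'. (Q e, Q e \<inter> NT (snd e)) = p (fst e))"
  proof (rule popular_label[OF finE, of "\<lambda>y. Pow (NT y) \<times> Pow (NT y)"])
    fix e assume e: "e \<in> E"
    have "card (Pow (NT (fst e)) \<times> Pow (NT (fst e))) \<le> 2 ^ D * 2 ^ D"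
      unfolding card_cartesian_product using De[OF e] pow by (intro mult_le_mono) auto
    then show "finite (Pow (NT (fst e)) \<times> Pow (NT (fst e)))
        \<and> card (Pow (NT (fst e)) \<times> Pow (NT (fst e))) \<le> 2 ^ D * 2 ^ D
        \<and> (Q e, Q e \<inter> NT (snd e)) \<in> Pow (NT (fst e)) \<times> Pow (NT (fst e))"
      using fin_NT QNT[OF e] by auto
  qed
  then obtain E1 p where E1: "E1 \<subseteq> E" "card E \<le> 2 ^ D * 2 ^ D * card E1"
    "\<forall>e\<in>E1. (Q e, Q e \<inter> NT (snd e)) = p (fst e)"
    by (elim exE conjE) (rule that)
  have finE1: "finite E1" using E1(1) finE finite_subset by blast
  have "\<exists>E' x. E' \<subseteq> E1 \<and> card E1 \<le> 2 ^ D * card E' \<and> (\<forall>e\<in>E'. Q e \<inter> NT (snd e) = x (snd e))"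
  proof (rule popular_label[OF finE1, of "\<lambda>z. Pow (NT z)"])
    fix e assume "e \<in> E1"
    then have "e \<in> E" using E1(1) by blast
    then show "finite (Pow (NT (snd e))) \<and> card (Pow (NT (snd e))) \<le> 2 ^ D
        \<and> Q e \<inter> NT (snd e) \<in> Pow (NT (snd e))"
      using fin_NT De pow by auto
  qed
  then obtain E2 x where E2: "E2 \<subseteq> E1" "card E1 \<le> 2 ^ D * card E2"
    "\<forall>e\<in>E2. Q e \<inter> NT (snd e) = x (snd e)"
    by (elim exE conjE) (rule that)
  let ?K = "(vT + (vT + 1) * vT) * (2 * vT + 1)"
  have "card E2 \<le> ?K * (2 * card (verts G))"
  proof (rule ccontr)
    assume "\<not> ?thesis"
    then have big: "?K * (2 * card (verts G)) < card E2" by simp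
    have E2V: "E2 \<subseteq> verts G \<times> verts G" using E1(1) E2(1) EV by blast
    obtain Y Z where YZ: "Y \<subseteq> verts G" "Z \<subseteq> verts G" "Y \<noteq> {}"
      "\<forall>y\<in>Y. ?K < card {z\<in>Z. (y, z) \<in> E2}" "\<forall>z\<in>Z. ?K < card {y\<in>Y. (y, z) \<in> E2}"
      using bipartite_min_degree[OF finG(1) E2V big] by (elim exE conjE) (rule that)
    define q where "q y = fst (p y)" for y
    have e2: "{y, z} \<in> edges G \<and> q y \<subseteq> cn G {y, z} \<and> card (q y) = Suc t \<and> q y \<subseteq> NT y
        \<and> q y \<inter> NT z = x z \<and> snd (p y) = x z"
      if "(y, z) \<in> E2" for y z
    proof -
      have m: "(y, z) \<in> E1" "(y, z) \<in> E" using that E1(1) E2(1) by auto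
      have "(Q (y, z), Q (y, z) \<inter> NT z) = p y" using bspec[OF E1(3) m(1)] by simp
      then have "Q (y, z) = q y" "snd (p y) = Q (y, z) \<inter> NT z"
        by (simp_all add: q_def flip: \<open>_ = p y\<close>)
      moreover have "Q (y, z) \<inter> NT z = x z" using bspec[OF E2(3) that] by simp
      moreover have "{y, z} \<in> edges G" using thin_edge[OF E[OF m(2)]] .
      ultimately show ?thesis using bspec[OF Q m(2)] QNT[OF m(2)] by simp
    qed
    obtain y0 where y0: "y0 \<in> Y" using YZ(3) by blast
    have nz: "\<exists>z\<in>Z. (y, z) \<in> E2" if "y \<in> Y" for y
    proof (rule ccontr)
      assume "\<not> ?thesis"
      then have "{z\<in>Z. (y, z) \<in> E2} = {}" by blast
      then show False using bspec[OF YZ(4) that] by (simp only: card.empty)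
    qed
    \<comment> \<open>The traces recorded at the two ends of a pair in \<open>E2\<close> coincide,
      so restricting both sides to one trace \<open>X\<close> loses no neighbour and keeps all
      degrees.\<close>
    define X where "X = snd (p y0)"
    let ?Y = "{y\<in>Y. snd (p y) = X}" and ?Z = "{z\<in>Z. x z = X}"
    obtain z0 where z0: "z0 \<in> Z" "(y0, z0) \<in> E2" using nz[OF y0] by blast
    have z0': "z0 \<in> ?Z" using e2[OF z0(2)] z0(1) by (simp add: X_def)
    have e3: "q y \<inter> NT z = X" if "y \<in> ?Y" "(y, z) \<in> E2" for y z
      using e2[OF that(2)] that(1) by simp
    have Ysub: "X \<subseteq> q y \<and> finite (q y) \<and> card (q y) = Suc t \<and> q y \<subseteq> NT y" if y: "y \<in> ?Y" for y
    proof -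
      obtain z where z: "(y, z) \<in> E2" using nz y by blast
      have "card (q y) = Suc t" "q y \<subseteq> NT y" using e2[OF z] by auto
      then show ?thesis using e3[OF y z] fin_NT finite_subset by blast
    qed
    have y0': "y0 \<in> ?Y" using y0 by (simp add: X_def)
    have finX: "finite X" using Ysub[OF y0'] finite_subset by blast
    have cX: "card X \<le> Suc t" using Ysub[OF y0'] card_mono by metis
    show False
    proof (rule nested_structure_False[of ?Y ?Z z0 X "\<lambda>y. q y - X" E2])
      show "?Y \<subseteq> verts G" "?Z \<subseteq> verts G" using YZ by auto
      show "z0 \<in> ?Z" by (rule z0')
      show "X \<subseteq> verts G" using Ysub[OF y0'] NT_subset by blast
      show "card X \<le> Suc t" "finite X" by (fact cX, fact finX)
      show "X \<inter> ?Y = {}"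
      proof (rule ccontr)
        assume "X \<inter> ?Y \<noteq> {}"
        then obtain y where y: "y \<in> X" "y \<in> ?Y" by blast
        then have "y \<in> NT y" using Ysub[OF y(2)] by blast
        then show False using wf_edgeD(1)[OF wfG thick_edge, of y y] by (simp add: NT_def)
      qed
      show "X \<inter> ?Z = {}"
      proof (rule ccontr)
        assume "X \<inter> ?Z \<noteq> {}"
        then obtain z where z: "z \<in> X" "z \<in> Z" "x z = X" by blast
        have "{y\<in>Y. (y, z) \<in> E2} \<noteq> {}"
          using bspec[OF YZ(5) z(2)] by (metis card.empty not_less_zero)
        then obtain y where "y \<in> Y" "(y, z) \<in> E2" by blast
        then have "z \<in> NT z" using e2[of y z] z by blast
        then show False using wf_edgeD(1)[OF wfG thick_edge, of z z] by (simp add: NT_def)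
      qed
      show "finite (q y - X) \<and> card (q y - X) = Suc t - card X \<and> (q y - X) \<inter> X = {}" if "y \<in> ?Y" for y
        using Ysub[OF that] card_Diff_subset[OF finX, of "q y"] by auto
      show "{y, z} \<in> edges G \<and> q y - X \<subseteq> cn G {y, z} - NT z"
        if "y \<in> ?Y" "z \<in> ?Z" "(y, z) \<in> E2" for y z
        using e2[OF that(3)] e3[OF that(1,3)] by blast
      show "X \<subseteq> NT y" if "y \<in> ?Y" for y using Ysub[OF that] by blast
      show "?K < card {z\<in>?Z. (y, z) \<in> E2}" if y: "y \<in> ?Y" for y
      proof -
        have "{z\<in>?Z. (y, z) \<in> E2} = {z\<in>Z. (y, z) \<in> E2}" using e2[of y] y by auto
        then show ?thesis using YZ(4) y by auto
      qed
      show "?K < card {y\<in>?Y. (y, z) \<in> E2}" if z: "z \<in> ?Z" for z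
      proof -
        have "{y\<in>?Y. (y, z) \<in> E2} = {y\<in>Y. (y, z) \<in> E2}" using e2[of _ z] z by auto
        then show ?thesis using YZ(5) z by auto
      qed
    qed
  qed
  then have "card E1 \<le> 2 ^ D * (?K * (2 * card (verts G)))" using E2(2) by (meson le_trans mult_le_mono2)
  then show ?thesis using E1(2) by (meson le_trans mult_le_mono2)
qed

abbreviation "nG \<equiv> card (verts G)"

text \<open>Ordered pairs, because the embeddings treat the two ends differently.\<close>

definition bad :: "('b \<times> 'b) set" where
  "bad = {(y, z). {y, z} \<in> thin \<and> Suc t \<le> card (cn G {y, z})}"

lemma bad_subset: "bad \<subseteq> verts G \<times> verts G"
  using thin_edge wf_edgeD[OF wfG] by (fastforce simp: bad_def)

lemma fin_bad: "finite bad"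
  using bad_subset finG(1) finite_subset by blast

text \<open>Discarding the ends of high thick degree and the thin triangles, every common neighbour is joined
  by a thick edge to an end. Either both ends have private such neighbours, or one end sees them all.\<close>
lemma bad_bound: "D * card bad \<le> 8 * vT * nG\<^sup>2 + D * bad_const vT D * nG"
proof -
  \<comment> \<open>As the thick degrees sum to at most \<open>4 * vT * nG\<close>, there are at
    most \<open>4 * vT * nG / D\<close> such vertices. They cause the only quadratic term. The
    estimate is kept multiplied by \<open>D\<close> to stay within the natural numbers.\<close>
  let ?H = "{y\<in>verts G. D < card (NT y)}"
  let ?T0 = "\<Union>s\<in>tri0. s \<times> s"
  let ?low = "\<lambda>y z. (y, z) \<in> bad \<and> card (NT y) \<le> D \<and> card (NT z) \<le> D"
  let ?E1 = "{(y, z). ?low y z \<and> (\<exists>p q. p \<in> cn G {y, z} \<and> q \<in> cn G {y, z}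
      \<and> p \<in> NT y - NT z \<and> q \<in> NT z - NT y)}"
  let ?E2 = "{(y, z). ?low y z \<and> cn G {y, z} \<subseteq> NT y}"
  let ?E3 = "(\<lambda>(y, z). (z, y)) ` ?E2"
  have low_sub: "?E1 \<subseteq> bad" "?E2 \<subseteq> bad" by auto
  then have fin: "finite ?E1" "finite ?E2" using fin_bad finite_subset by blast+
  have cover: "bad \<subseteq> (?H \<times> verts G \<union> verts G \<times> ?H) \<union> (?T0 \<union> (?E1 \<union> (?E2 \<union> ?E3)))"
  proof (rule subrelI)
    fix y z assume yz: "(y, z) \<in> bad"
    then have V: "y \<in> verts G" "z \<in> verts G" and th: "{y, z} \<in> thin"
      using bad_subset by (auto simp: bad_def)
    have yz': "(z, y) \<in> bad" using yz by (simp add: bad_def insert_commute)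
    show "(y, z) \<in> (?H \<times> verts G \<union> verts G \<times> ?H) \<union> (?T0 \<union> (?E1 \<union> (?E2 \<union> ?E3)))"
    proof (cases "card (NT y) \<le> D \<and> card (NT z) \<le> D")
      case False
      then show ?thesis using V by auto
    next
      case low: True
      show ?thesis
      proof (cases "(y, z) \<in> ?T0")
        case notT0: False
        have 1: "w \<in> NT y \<or> w \<in> NT z" if w: "w \<in> cn G {y, z}" for w
        proof (rule ccontr)
          assume "\<not> ?thesis"
          then have thw: "{y, w} \<in> thin" "{z, w} \<in> thin" using cn_edge[OF w] not_NT_thin by auto
          then have "{y, z, w} \<in> triangles G" using triangleI(1)[OF wfG, of y z w] thin_edge th by simp
          then have "{y, z, w} \<in> tri0" using th thw by (auto simp: tri0_def insert_commute)
          then show False using notT0 by blast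
        qed
        show ?thesis
        proof (cases "cn G {y, z} \<subseteq> NT y \<or> cn G {y, z} \<subseteq> NT z")
          case True
          then show ?thesis
          proof
            assume "cn G {y, z} \<subseteq> NT y"
            then show ?thesis using yz low by simp
          next
            assume "cn G {y, z} \<subseteq> NT z"
            then have "(z, y) \<in> ?E2" using yz' low by (simp add: insert_commute)
            then have "(y, z) \<in> ?E3" by (intro image_eqI[of _ _ "(z, y)"]) simp_all
            then show ?thesis by blast
          qed
        next
          case False
          then obtain p q where "p \<in> cn G {y, z}" "p \<notin> NT z" "q \<in> cn G {y, z}" "q \<notin> NT y" by blast
          then have "(y, z) \<in> ?E1" using 1 yz low by blast
          then show ?thesis by blast
        qed
      qed blast
    qed
  qed
  have "D * card ?H \<le> 4 * vT * nG"
  proof -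
    have "D * card ?H = (\<Sum>y\<in>?H. D)" by simp
    also have "\<dots> \<le> (\<Sum>y\<in>?H. card (NT y))" by (intro sum_mono) simp
    also have "\<dots> \<le> (\<Sum>y\<in>verts G. card (NT y))" using finG(1) by (intro sum_mono2) auto
    also have "\<dots> \<le> 4 * vT * nG" by (rule thick_degree_sum)
    finally show ?thesis .
  qed
  then have "D * card ?H * (2 * nG) \<le> 4 * vT * nG * (2 * nG)" by (rule mult_le_mono1)
  moreover have "D * card (?H \<times> verts G \<union> verts G \<times> ?H) \<le> D * card ?H * (2 * nG)"
    unfolding mult.assoc
  proof (rule mult_le_mono2)
    show "card (?H \<times> verts G \<union> verts G \<times> ?H) \<le> card ?H * (2 * nG)"
      using card_Un_le[of "?H \<times> verts G" "verts G \<times> ?H"]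
      by (simp add: card_cartesian_product algebra_simps)
  qed
  moreover have "4 * vT * nG * (2 * nG) = 8 * vT * nG\<^sup>2" by (simp add: power2_eq_square)
  ultimately have b1: "D * card (?H \<times> verts G \<union> verts G \<times> ?H) \<le> 8 * vT * nG\<^sup>2"
    by linarith
  have b2: "card ?T0 \<le> 36 * vT\<^sup>2 * nG"
  proof -
    have "card ?T0 \<le> (\<Sum>s\<in>tri0. card (s \<times> s))" by (rule card_UN_le[OF fin_tri(2)])
    also have "\<dots> = (\<Sum>s\<in>tri0. 9)"
      by (intro sum.cong) (auto simp: tri0_def triangles_def card_cartesian_product)
    also have "\<dots> = 9 * card tri0" by simp
    finally have "card ?T0 \<le> 9 * card tri0" .
    moreover have "{s\<in>tri0. s \<subseteq> verts G} = tri0" by (auto simp: tri0_def triangles_def)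
    then have "card tri0 \<le> 2 * vT * (2 * vT) * nG" using tri0_linear[of "verts G"] by simp
    ultimately show ?thesis by (simp add: power2_eq_square algebra_simps)
  qed
  have b3: "card ?E1 \<le> D * (D * (2 * vT * (2 * vT + 1) * (2 * nG)))"
    by (rule private_both_bound) (auto simp: bad_def)
  have b4: "card ?E2 \<le> 2 ^ D * 2 ^ D * (2 ^ D * ((vT + (vT + 1) * vT) * (2 * vT + 1) * (2 * nG)))"
    by (rule nested_bound) (auto simp: bad_def)
  have b5: "card ?E3 \<le> card ?E2" using fin(2) by (rule card_image_le)
  let ?A = "?H \<times> verts G \<union> verts G \<times> ?H"
  have "finite (?A \<union> (?T0 \<union> (?E1 \<union> (?E2 \<union> ?E3))))"
  proof -
    have "finite s" if "s \<in> tri0" for s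
      using that finite_subset[OF _ finG(1), of s] by (simp add: tri0_def triangles_def)
    then have T0: "finite ?T0"
      using fin_tri(2) by (intro finite_UN_I finite_cartesian_product)
    have A: "finite ?A" using finG(1) by simp
    show ?thesis by (intro finite_UnI T0 A fin finite_imageI)
  qed
  then have "card bad \<le> card (?A \<union> (?T0 \<union> (?E1 \<union> (?E2 \<union> ?E3))))" using cover by (rule card_mono)
  moreover have "card (?A \<union> (?T0 \<union> (?E1 \<union> (?E2 \<union> ?E3)))) \<le> card ?A + card (?T0 \<union> (?E1 \<union> (?E2 \<union> ?E3)))"
    by (rule card_Un_le)
  moreover have "card (?T0 \<union> (?E1 \<union> (?E2 \<union> ?E3))) \<le> card ?T0 + card (?E1 \<union> (?E2 \<union> ?E3))"
    by (rule card_Un_le)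
  moreover have "card (?E1 \<union> (?E2 \<union> ?E3)) \<le> card ?E1 + card (?E2 \<union> ?E3)" by (rule card_Un_le)
  moreover have "card (?E2 \<union> ?E3) \<le> card ?E2 + card ?E3" by (rule card_Un_le)
  moreover have "36 * vT\<^sup>2 * nG + D * (D * (2 * vT * (2 * vT + 1) * (2 * nG)))
     + 2 * (2 ^ D * 2 ^ D * (2 ^ D * ((vT + (vT + 1) * vT) * (2 * vT + 1) * (2 * nG)))) = bad_const vT D * nG"
    by (simp add: bad_const_def algebra_simps)
  ultimately have "card bad \<le> card ?A + bad_const vT D * nG"
    using b2 b3 b4 b5 by linarith
  then have "D * card bad \<le> D * (card ?A + bad_const vT D * nG)" by (rule mult_le_mono2)
  also have "\<dots> = D * card ?A + D * bad_const vT D * nG" by (simp add: algebra_simps)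
  also have "\<dots> \<le> 8 * vT * nG\<^sup>2 + D * bad_const vT D * nG" using b1 by simp
  finally show ?thesis .
qed

section \<open>Counting triangles by their thin edges\<close>

lemma thin_codegree_sum: "(\<Sum>e\<in>thin. card (cn G e)) \<le> t * card thin + 2 * vT * card bad"
proof -
  let ?B = "{e\<in>thin. Suc t \<le> card (cn G e)}"
  have "(\<Sum>e\<in>thin. card (cn G e)) \<le> (\<Sum>e\<in>thin. t + (if e \<in> ?B then 2 * vT else 0))"
    by (intro sum_mono) (auto simp: thin_def)
  also have "\<dots> = t * card thin + 2 * vT * card ?B"
    using fin_thin by (simp add: sum.distrib sum.If_cases Int_def)
  also have "card ?B \<le> card bad"
  proof (rule surj_card_le[OF fin_bad])
    show "?B \<subseteq> (\<lambda>(y, z). {y, z}) ` bad"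
    proof
      fix e assume e: "e \<in> ?B"
      then have "e \<in> edges G" using thin_edge by simp
      with wfG obtain y z where "e = {y, z}" by (rule wf_edgeE)
      then show "e \<in> (\<lambda>(y, z). {y, z}) ` bad"
        using e by (intro image_eqI[of _ _ "(y, z)"]) (auto simp: bad_def)
    qed
  qed
  finally show ?thesis by simp
qed

definition thin_in :: "'b set \<Rightarrow> nat" where "thin_in s = card {e\<in>thin. e \<subseteq> s}"

lemma thin_in_sum: "(\<Sum>s\<in>triangles G. thin_in s) = (\<Sum>e\<in>thin. card (cn G e))"
proof -
  have "(\<Sum>s\<in>triangles G. thin_in s) = (\<Sum>s\<in>triangles G. \<Sum>e\<in>thin. if e \<subseteq> s then 1 else 0)"
    using fin_thin by (intro sum.cong) (auto simp: thin_in_def sum.If_cases Int_def)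
  also have "\<dots> = (\<Sum>e\<in>thin. \<Sum>s\<in>triangles G. if e \<subseteq> s then 1 else 0)" by (rule sum.swap)
  also have "\<dots> = (\<Sum>e\<in>thin. card {s\<in>triangles G. e \<subseteq> s})"
    using fin_tri by (intro sum.cong) (auto simp: sum.If_cases Int_def)
  also have "\<dots> = (\<Sum>e\<in>thin. card (cn G e))"
    using card_triangles_over_edge[OF wfG thin_edge] by (intro sum.cong) auto
  finally show ?thesis .
qed

lemma thin_in_zero: "s \<in> triangles G \<Longrightarrow> thin_in s = 0 \<Longrightarrow> s \<in> tri3"
proof -
  assume s: "s \<in> triangles G" "thin_in s = 0"
  have none: "\<not> e \<subseteq> s" if "e \<in> thin" for e
    using s(2) that fin_thin by (auto simp: thin_in_def)
  have "{x, y} \<in> thick" if "x \<in> s" "y \<in> s" "x \<noteq> y" for x y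
  proof -
    have "{x, y} \<in> edges G" using s(1) that by (auto simp: triangles_def)
    then show ?thesis using none[of "{x, y}"] that not_thick_thin by auto
  qed
  then show "s \<in> tri3" using s(1) by (simp add: tri3_def)
qed

lemma triangles_le_thin_sum: "card (triangles G) \<le> (\<Sum>e\<in>thin. card (cn G e)) + card tri3"
proof -
  have "card (triangles G) = (\<Sum>s\<in>triangles G. 1)" by simp
  also have "\<dots> \<le> (\<Sum>s\<in>triangles G. thin_in s + (if s \<in> tri3 then 1 else 0))"
    using thin_in_zero by (intro sum_mono) force
  also have "\<dots> = (\<Sum>s\<in>triangles G. thin_in s) + card tri3"
  proof -
    have "triangles G \<inter> tri3 = tri3" by (auto simp: tri3_def)
    then show ?thesis using fin_tri(1) by (simp add: sum.distrib sum.If_cases)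
  qed
  finally show ?thesis by (simp add: thin_in_sum)
qed

text \<open>As in \<open>tri0\<close> and \<open>tri3\<close>, the index counts the thick edges: one
  thin edge leaves two thick ones.\<close>

definition tri2 :: "'b set set" where "tri2 = {s \<in> triangles G. thin_in s = 1}"

text \<open>A triangle with at least two thin edges is counted at least twice by the thin sum. Since
  that sum is about \<open>t * n^2 / 4\<close> at most, a graph with so many triangles has nearly as
  many in \<open>tri2\<close>.\<close>

lemma twice_triangles_le:
  "2 * card (triangles G) \<le> (\<Sum>e\<in>thin. card (cn G e)) + card tri2 + 2 * card tri3"
proof -
  have "2 * card (triangles G) = (\<Sum>s\<in>triangles G. 2)" by simp
  also have "\<dots> \<le> (\<Sum>s\<in>triangles G. thin_in s + (if s \<in> tri2 then 1 else 0) + (if s \<in> tri3 then 2 else 0))"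
  proof (rule sum_mono)
    fix s assume s: "s \<in> triangles G"
    consider "thin_in s = 0" | "thin_in s = 1" | "thin_in s \<ge> 2" by linarith
    then show "2 \<le> thin_in s + (if s \<in> tri2 then 1 else 0) + (if s \<in> tri3 then 2 else 0)"
      by cases (use s thin_in_zero in \<open>auto simp: tri2_def\<close>)
  qed
  also have "\<dots> = (\<Sum>s\<in>triangles G. thin_in s) + card tri2 + 2 * card tri3"
  proof -
    have "triangles G \<inter> tri3 = tri3" "triangles G \<inter> tri2 = tri2" by (auto simp: tri3_def tri2_def)
    then show ?thesis using fin_tri(1) by (simp add: sum.distrib sum.If_cases)
  qed
  finally show ?thesis by (simp add: thin_in_sum)
qed

text \<open>The thin edge of such a triangle lies inside \<open>NT x\<close> for the opposite vertex
  \<open>x\<close>, and \<open>thin_sub_bound\<close> limits the thin edges inside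
  \<open>NT x\<close>.\<close>

lemma tri2_bound: "4 * card tri2 \<le> (\<Sum>x\<in>verts G. (card (NT x))\<^sup>2) + 64 * vT ^ 3 * nG"
proof -
  let ?H = "\<lambda>x. {e\<in>thin. e \<subseteq> NT x}"
  have "tri2 \<subseteq> (\<Union>x\<in>verts G. insert x ` ?H x)"
  proof
    fix s assume s: "s \<in> tri2"
    then have tr: "s \<in> triangles G" and one: "card {e\<in>thin. e \<subseteq> s} = 1"
      by (auto simp: tri2_def thin_in_def)
    then obtain e where e: "{e\<in>thin. e \<subseteq> s} = {e}" by (meson card_1_singletonE)
    then have eth: "e \<in> thin" "e \<subseteq> s" by auto
    obtain y z where yz: "y \<noteq> z" "e = {y, z}" "y \<in> s" "z \<in> s"
      using edge_two[OF thin_edge[OF eth(1)] eth(2)] by blast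
    have "s \<in> (\<lambda>w. insert w e) ` cn G e"
      using triangles_over_edge(1)[OF wfG thin_edge[OF eth(1)]] tr eth(2) by blast
    then obtain x where x: "s = insert x e" "x \<in> cn G e" by blast
    have xe: "x \<notin> e" using cn_not_self[OF x(2)] .
    have "x \<in> cn G {y, z}" using x(2) unfolding yz(2) .
    then have xe': "{y, x} \<in> edges G" "{z, x} \<in> edges G" "x \<in> verts G" by (simp_all add: cn_def)
    have only: "e' = e" if "e' \<in> thin" "e' \<subseteq> s" for e'
    proof -
      have "e' \<in> {e\<in>thin. e \<subseteq> s}" using that by simp
      then show ?thesis unfolding e by simp
    qed
    have xs: "x \<in> s" using x(1) by simp
    have "{y, x} \<notin> thin"
    proof
      assume "{y, x} \<in> thin"
      then have "{y, x} = e" using only yz(3,4) xs by simp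
      then show False using xe by blast
    qed
    moreover have "{z, x} \<notin> thin"
    proof
      assume "{z, x} \<in> thin"
      then have "{z, x} = e" using only yz(3,4) xs by simp
      then show False using xe by blast
    qed
    ultimately have "{y, x} \<in> thick" "{z, x} \<in> thick" using xe' not_thick_thin by blast+
    then have "e \<subseteq> NT x" unfolding yz(2) by (simp add: NT_def insert_commute)
    then have "e \<in> ?H x" using eth(1) by simp
    then have "s \<in> insert x ` ?H x" using x(1) by (intro image_eqI)
    then show "s \<in> (\<Union>x\<in>verts G. insert x ` ?H x)" using xe'(3) by (intro UN_I)
  qed
  then have "card tri2 \<le> card (\<Union>x\<in>verts G. insert x ` ?H x)"
    using finG(1) fin_thin by (intro card_mono) auto
  also have "\<dots> \<le> (\<Sum>x\<in>verts G. card (insert x ` ?H x))" by (rule card_UN_le[OF finG(1)])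
  also have "\<dots> \<le> (\<Sum>x\<in>verts G. card (?H x))"
    using fin_thin by (intro sum_mono card_image_le) auto
  finally have "4 * card tri2 \<le> (\<Sum>x\<in>verts G. 4 * card (?H x))"
    by (simp add: sum_distrib_left[symmetric])
  also have "\<dots> \<le> (\<Sum>x\<in>verts G. (card (NT x))\<^sup>2 + 16 * vT\<^sup>2 * card (NT x))"
    by (intro sum_mono thin_sub_bound NT_subset)
  also have "\<dots> = (\<Sum>x\<in>verts G. (card (NT x))\<^sup>2) + 16 * vT\<^sup>2 * (\<Sum>x\<in>verts G. card (NT x))"
    by (simp add: sum.distrib sum_distrib_left)
  also have "\<dots> \<le> (\<Sum>x\<in>verts G. (card (NT x))\<^sup>2) + 16 * vT\<^sup>2 * (4 * vT * nG)"
    by (intro add_left_mono mult_le_mono2 thick_degree_sum)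
  finally show ?thesis by (simp add: power2_eq_square power3_eq_cube algebra_simps)
qed

lemma thin_total: "4 * card thin \<le> nG\<^sup>2 + 16 * vT\<^sup>2 * nG"
proof -
  have "{e\<in>thin. e \<subseteq> verts G} = thin" using wf_edge_subset[OF wfG thin_edge] by auto
  then show ?thesis using thin_sub_bound[of "verts G"] by simp
qed

lemma bad_bound_real:
  assumes "D > 0"
  shows "real (8 * vT * card bad) \<le> 64 * vT\<^sup>2 / D * nG\<^sup>2 + 8 * vT * bad_const vT D * nG"
proof -
  have "real D * card bad \<le> 8 * vT * nG\<^sup>2 + D * bad_const vT D * nG"
    using bad_bound[of D] by (simp flip: of_nat_mult of_nat_add of_nat_power)
  then have "card bad \<le> 8 * vT * real (nG\<^sup>2) / D + bad_const vT D * nG"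
    using assms by (simp add: field_simps)
  then have "8 * vT * real (card bad) \<le> 8 * vT * (8 * vT * real (nG\<^sup>2) / D + bad_const vT D * nG)"
    by (intro mult_left_mono) auto
  then show ?thesis by (simp add: algebra_simps power2_eq_square)
qed

text \<open>For \<open>t * n^2 / 4\<close> triangles the left side is about \<open>t * n^2\<close>:
  of the eightfold count \<open>2 * t * n^2\<close>, the thin sum accounts for one half, and
  \<open>tri2_bound\<close> must provide the other.\<close>

lemma degree_square_lower:
  assumes "D > 0"
  shows "8 * real (card (triangles G)) - t * real nG ^ 2 - 64 * vT\<^sup>2 / D * nG\<^sup>2 - lin_const vT t D * nG
     \<le> (\<Sum>x\<in>verts G. (real (card (NT x)))\<^sup>2)"
proof -
  have "8 * card (triangles G) \<le> 4 * (\<Sum>e\<in>thin. card (cn G e)) + 4 * card tri2 + 8 * card tri3"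
    using twice_triangles_le by linarith
  also have "\<dots> \<le> 4 * (t * card thin + 2 * vT * card bad)
      + ((\<Sum>x\<in>verts G. (card (NT x))\<^sup>2) + 64 * vT ^ 3 * nG) + 8 * (8 * vT\<^sup>2 * nG)"
    by (intro add_mono mult_le_mono2 thin_codegree_sum tri2_bound tri3_linear)
  also have "\<dots> = t * (4 * card thin) + 8 * vT * card bad
      + ((\<Sum>x\<in>verts G. (card (NT x))\<^sup>2) + 64 * vT ^ 3 * nG) + 8 * (8 * vT\<^sup>2 * nG)"
    by (simp add: algebra_simps)
  also have "\<dots> \<le> t * (nG\<^sup>2 + 16 * vT\<^sup>2 * nG) + 8 * vT * card bad
      + ((\<Sum>x\<in>verts G. (card (NT x))\<^sup>2) + 64 * vT ^ 3 * nG) + 8 * (8 * vT\<^sup>2 * nG)"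
    by (intro add_right_mono mult_le_mono2 thin_total)
  finally have "real (8 * card (triangles G)) \<le> real (t * (nG\<^sup>2 + 16 * vT\<^sup>2 * nG) + 8 * vT * card bad
      + ((\<Sum>x\<in>verts G. (card (NT x))\<^sup>2) + 64 * vT ^ 3 * nG) + 8 * (8 * vT\<^sup>2 * nG))"
    by (simp only: of_nat_le_iff)
  then show ?thesis using bad_bound_real[OF assms] by (simp add: lin_const_def algebra_simps)
qed

text \<open>About \<open>t * n^2 / 4\<close> triangles thus force about \<open>n^2 / 4\<close> thin
  edges if \<open>t\<close> is positive. This density later limits independent sets.\<close>

lemma thin_lower:
  assumes "D > 0"
  shows "4 * real (card (triangles G)) - 64 * vT\<^sup>2 / D * nG\<^sup>2 - lin_const vT t D * nG \<le> 4 * t * real (card thin)"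
proof -
  have "card (triangles G) \<le> (t * card thin + 2 * vT * card bad) + 8 * vT\<^sup>2 * nG"
    by (rule order_trans[OF triangles_le_thin_sum add_mono[OF thin_codegree_sum tri3_linear]])
  then have "4 * card (triangles G) \<le> 4 * ((t * card thin + 2 * vT * card bad) + 8 * vT\<^sup>2 * nG)"
    by (rule mult_le_mono2)
  then have "4 * card (triangles G) \<le> 4 * (t * card thin + 2 * vT * card bad) + 4 * (8 * vT\<^sup>2 * nG)"
    by (simp only: distrib_left)
  then have "real (4 * card (triangles G)) \<le> real (4 * (t * card thin + 2 * vT * card bad) + 4 * (8 * vT\<^sup>2 * nG))"
    by (simp only: of_nat_le_iff)
  then have 1: "4 * real (card (triangles G)) \<le> 4 * t * real (card thin) + real (8 * vT * card bad)
      + 32 * vT\<^sup>2 * real nG"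
    by (simp add: algebra_simps)
  have "8 * vT * bad_const vT D + 32 * vT\<^sup>2 \<le> lin_const vT t D" by (simp add: lin_const_def)
  then have "(8 * vT * bad_const vT D + 32 * vT\<^sup>2) * nG \<le> lin_const vT t D * nG" by (rule mult_le_mono1)
  then have "real ((8 * vT * bad_const vT D + 32 * vT\<^sup>2) * nG) \<le> real (lin_const vT t D * nG)"
    by (simp only: of_nat_le_iff)
  then show ?thesis using 1 bad_bound_real[OF assms] by (simp add: algebra_simps)
qed

section \<open>Finding the dominating set\<close>

lemma common_thick_bound:
  assumes X: "X \<subseteq> verts G" "card X = Suc t"
  shows "card {y. X \<subseteq> NT y} \<le> vT"
proof (rule ccontr)
  let ?Y = "{y. X \<subseteq> NT y}"
  assume "\<not> ?thesis"
  then have big: "vT < card ?Y" by simp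
  have finY: "finite ?Y" using big by (metis card.infinite not_less_zero)
  have finX: "finite X" using X(1) finG(1) finite_subset by blast
  have "X \<noteq> {}" using X(2) by auto
  then have YV: "?Y \<subseteq> verts G" using NT_subset NT_sym by blast
  have XY: "X \<inter> ?Y = {}"
  proof (rule ccontr)
    assume "X \<inter> ?Y \<noteq> {}"
    then obtain y where "y \<in> NT y" by blast
    then show False using wf_edgeD(1)[OF wfG thick_edge, of y y] by (simp add: NT_def)
  qed
  \<comment> \<open>\<open>A\<close> goes onto \<open>X\<close> and the other class into the common
    thick neighbourhood. All images of tree edges are thick, so no apex has to be reserved.\<close>
  obtain \<iota> where \<iota>: "bij_betw \<iota> A X" using finite_same_card_bij[OF finA finX] A(3) X(2) by auto
  have "card (verts T - A) \<le> card ?Y" using big card_mono[OF finT(1), of "verts T - A"] by simp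
  then obtain \<kappa> where \<kappa>: "\<kappa> ` (verts T - A) \<subseteq> ?Y" "inj_on \<kappa> (verts T - A)"
    using card_le_inj[of "verts T - A" ?Y] finT(1) finY by blast
  define f where "f w = (if w \<in> A then \<iota> w else \<kappa> w)" for w
  have fA: "f w \<in> X" if "w \<in> A" for w using that bij_betwE[OF \<iota>] by (simp add: f_def)
  have fB: "f w \<in> ?Y" if "w \<in> verts T" "w \<notin> A" for w
  proof -
    have "\<kappa> w \<in> ?Y" using that \<kappa>(1) by (intro subsetD[OF \<kappa>(1)] imageI) simp
    then show ?thesis using that by (simp add: f_def)
  qed
  have thickE: "f ` e \<in> thick" if e: "e \<in> edges T" for e
  proof -
    obtain u w where uw: "e = {u, w}" "u \<in> A" "w \<notin> A" using e by (rule A_edge)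
    then have "w \<in> verts T" using wf_edge_subset[OF wfT e] by simp
    then have "f u \<in> NT (f w)" using fA[OF uw(2)] fB[of w] uw(3) by blast
    then show ?thesis using uw(1) by (simp add: NT_def insert_commute)
  qed
  show False
  proof (rule complete_copy_False[of f "{}" "\<lambda>_. undefined"])
    show "inj_on f (verts T)"
    proof (rule inj_onI)
      fix u w assume uw: "u \<in> verts T" "w \<in> verts T" "f u = f w"
      show "u = w"
      proof (cases "u \<in> A"; cases "w \<in> A")
        assume "u \<in> A" "w \<in> A"
        then show ?thesis using uw(3) bij_betw_imp_inj_on[OF \<iota>] by (simp add: f_def inj_on_eq_iff)
      next
        assume a: "u \<in> A" "w \<notin> A"
        then show ?thesis using disjoint_ne[OF XY fA[OF a(1)] fB[OF uw(2) a(2)]] uw(3) by simp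
      next
        assume a: "u \<notin> A" "w \<in> A"
        then show ?thesis using disjoint_ne[OF XY fA[OF a(2)] fB[OF uw(1) a(1)]] uw(3) by simp
      next
        assume "u \<notin> A" "w \<notin> A"
        then show ?thesis using uw \<kappa>(2) by (simp add: f_def inj_on_eq_iff)
      qed
    qed
    show "f ` verts T \<subseteq> verts G" using fA fB X(1) YV by blast
  qed (use thickE thick_edge in auto)
qed

text \<open>Counted from the other side: a vertex sees at most \<open>t\<close> members of
  \<open>L\<close> unless it is a common thick neighbour of some \<open>Suc t\<close> of them. There
  are at most \<open>2 ^ card L\<close> such subsets, with at most \<open>vT\<close> common
  neighbours each.\<close>

lemma heavy_degree_sum:
  assumes L: "L \<subseteq> verts G"
  shows "(\<Sum>x\<in>L. card (NT x)) \<le> t * nG + card L * (2 ^ card L * vT)"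
proof -
  have finL: "finite L" using L finG(1) finite_subset by blast
  let ?Y = "{y\<in>verts G. t < card (NT y \<inter> L)}"
  have "(\<Sum>x\<in>L. card (NT x)) = (\<Sum>x\<in>L. \<Sum>y\<in>verts G. if y \<in> NT x then 1 else 0)"
    using finG(1) NT_subset by (intro sum.cong) (auto simp: sum.If_cases Int_absorb1)
  also have "\<dots> = (\<Sum>y\<in>verts G. \<Sum>x\<in>L. if y \<in> NT x then 1 else 0)" by (rule sum.swap)
  also have "\<dots> = (\<Sum>y\<in>verts G. card (NT y \<inter> L))"
    using finL NT_sym by (intro sum.cong) (auto simp: sum.If_cases Int_def conj_commute)
  also have "\<dots> \<le> (\<Sum>y\<in>verts G. t + (if y \<in> ?Y then card L else 0))"
  proof (rule sum_mono)
    fix y assume "y \<in> verts G"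
    moreover have "card (NT y \<inter> L) \<le> card L" using finL by (intro card_mono) auto
    ultimately show "card (NT y \<inter> L) \<le> t + (if y \<in> ?Y then card L else 0)" by auto
  qed
  also have "\<dots> = t * nG + card ?Y * card L"
    using finG(1) by (simp add: sum.distrib sum.If_cases Int_def)
  also have "card ?Y \<le> 2 ^ card L * vT"
  proof -
    have "?Y \<subseteq> (\<Union>X\<in>{X\<in>Pow L. card X = Suc t}. {y. X \<subseteq> NT y})"
    proof
      fix y assume "y \<in> ?Y"
      then have "Suc t \<le> card (NT y \<inter> L)" by simp
      then obtain X where "X \<subseteq> NT y \<inter> L" "card X = Suc t" by (rule obtain_subset_with_card_n)
      then show "y \<in> (\<Union>X\<in>{X\<in>Pow L. card X = Suc t}. {y. X \<subseteq> NT y})" by blast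
    qed
    moreover have "finite {y. X \<subseteq> NT y}" if "card X = Suc t" for X
    proof -
      have "X \<noteq> {}" using that by auto
      then have "{y. X \<subseteq> NT y} \<subseteq> verts G" using NT_subset NT_sym by blast
      then show ?thesis using finG(1) finite_subset by blast
    qed
    ultimately have "card ?Y \<le> card (\<Union>X\<in>{X\<in>Pow L. card X = Suc t}. {y. X \<subseteq> NT y})"
      using finL by (intro card_mono) auto
    also have "\<dots> \<le> (\<Sum>X\<in>{X\<in>Pow L. card X = Suc t}. card {y. X \<subseteq> NT y})"
      using finL by (intro card_UN_le) auto
    also have "\<dots> \<le> (\<Sum>X\<in>{X\<in>Pow L. card X = Suc t}. vT)"
      using L by (intro sum_mono common_thick_bound) auto
    also have "\<dots> \<le> (\<Sum>X\<in>Pow L. vT)" using finL by (intro sum_mono2) auto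
    also have "\<dots> = 2 ^ card L * vT" using finL by (simp add: card_Pow)
    finally show ?thesis .
  qed
  finally show ?thesis by (simp add: mult.commute)
qed

text \<open>At most O(1) vertices have more than t neighbours among those of high thick degree, so the high
  degrees sum to t n + O(1); comparing the sum of squares with t n^2 forces t of them close to n.\<close>
lemma degree_square_upper:
  fixes \<gamma> \<delta> :: real
  assumes \<gamma>: "0 \<le> \<gamma>" "\<gamma> \<le> 1" and \<delta>: "0 < \<delta>" and n: "0 < nG"
    and K: "K = nat \<lfloor>4 * vT / \<delta>\<rfloor>"
  shows "(\<Sum>x\<in>verts G. (real (card (NT x)))\<^sup>2) \<le> 4 * vT * \<delta> * (real nG)\<^sup>2
      + (1 - \<gamma>) * nG * (t * nG + K * (2 ^ K * vT))
      + \<gamma> * (real nG)\<^sup>2 * card {x\<in>verts G. (1 - \<gamma>) * nG \<le> card (NT x)}"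
proof -
  let ?d = "\<lambda>x. real (card (NT x))" and ?n = "real nG"
  let ?L = "{x\<in>verts G. \<delta> * ?n \<le> ?d x}" and ?H = "{x\<in>verts G. (1 - \<gamma>) * ?n \<le> ?d x}"
  have dn: "?d x \<le> ?n" for x using card_mono[OF finG(1) NT_subset] by simp
  have dsum: "(\<Sum>x\<in>verts G. ?d x) \<le> 4 * vT * ?n"
    using thick_degree_sum by (simp flip: of_nat_sum of_nat_mult)
  have "(\<Sum>x\<in>?L. \<delta> * ?n) \<le> (\<Sum>x\<in>?L. ?d x)" by (intro sum_mono) auto
  also have "\<dots> \<le> (\<Sum>x\<in>verts G. ?d x)" using finG(1) by (intro sum_mono2) auto
  finally have "card ?L * (\<delta> * ?n) \<le> 4 * vT * ?n" using dsum by simp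
  then have "card ?L * \<delta> \<le> 4 * vT" using n by (simp add: mult.assoc[symmetric])
  then have "card ?L \<le> 4 * vT / \<delta>" using \<delta> by (simp add: field_simps)
  then have cL: "card ?L \<le> K" unfolding K by (simp add: le_nat_floor)
  have "(\<Sum>x\<in>?L. card (NT x)) \<le> t * nG + card ?L * (2 ^ card ?L * vT)"
    by (rule heavy_degree_sum) auto
  also have "\<dots> \<le> t * nG + K * (2 ^ K * vT)"
    using cL by (intro add_left_mono mult_le_mono power_increasing) auto
  finally have "real (\<Sum>x\<in>?L. card (NT x)) \<le> real (t * nG + K * (2 ^ K * vT))"
    by (simp only: of_nat_le_iff)
  then have sL: "(\<Sum>x\<in>?L. ?d x) \<le> t * nG + K * (2 ^ K * vT)"
    by simp
  \<comment> \<open>One factor of the square is at most \<open>\<delta> * n\<close> for light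
    vertices, at most \<open>(1 - \<gamma>) * n\<close> for heavy vertices outside
    \<open>?H\<close>, and at most \<open>n\<close> on \<open>?H\<close>, where the excess is
    charged as \<open>\<gamma> * n^2\<close>.\<close>
  have "(\<Sum>x\<in>verts G. (?d x)\<^sup>2) \<le> (\<Sum>x\<in>verts G. \<delta> * ?n * ?d x
      + (if x \<in> ?L then (1 - \<gamma>) * ?n * ?d x else 0) + (if x \<in> ?H then \<gamma> * ?n\<^sup>2 else 0))"
  proof (rule sum_mono)
    fix x assume x: "x \<in> verts G"
    have 0: "0 \<le> \<delta> * ?n * ?d x" using \<delta> by simp
    have 1: "0 \<le> \<gamma> * ?n\<^sup>2" "0 \<le> (1 - \<gamma>) * ?n * ?d x" using \<gamma> by simp_all
    show "(?d x)\<^sup>2 \<le> \<delta> * ?n * ?d x + (if x \<in> ?L then (1 - \<gamma>) * ?n * ?d x else 0)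
        + (if x \<in> ?H then \<gamma> * ?n\<^sup>2 else 0)"
    proof (cases "x \<in> ?L")
      case False
      then have "?d x \<le> \<delta> * ?n" using x by auto
      then have "?d x * ?d x \<le> \<delta> * ?n * ?d x" by (intro mult_right_mono) auto
      then show ?thesis using False 1 by (auto simp: power2_eq_square)
    next
      case L: True
      show ?thesis
      proof (cases "x \<in> ?H")
        case False
        then have "?d x \<le> (1 - \<gamma>) * ?n" using x by auto
        then have "?d x * ?d x \<le> (1 - \<gamma>) * ?n * ?d x" by (intro mult_right_mono) auto
        then show ?thesis using False L 0 by (auto simp: power2_eq_square)
      next
        case True
        have "?d x * ?d x \<le> ?n * ?d x" using dn by (intro mult_right_mono) auto
        also have "\<dots> = (1 - \<gamma>) * ?n * ?d x + \<gamma> * ?n * ?d x" by (simp add: algebra_simps)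
        also have "\<gamma> * ?n * ?d x \<le> \<gamma> * ?n * ?n" using \<gamma> dn by (intro mult_left_mono) auto
        finally show ?thesis using True L 0 by (auto simp: power2_eq_square algebra_simps)
      qed
    qed
  qed
  also have "\<dots> = \<delta> * ?n * (\<Sum>x\<in>verts G. ?d x) + (1 - \<gamma>) * ?n * (\<Sum>x\<in>?L. ?d x) + \<gamma> * ?n\<^sup>2 * card ?H"
    using finG(1) by (simp add: sum.distrib sum.If_cases sum_distrib_left Int_def)
  also have "\<dots> \<le> \<delta> * ?n * (4 * vT * ?n) + (1 - \<gamma>) * ?n * (t * nG + K * (2 ^ K * vT)) + \<gamma> * ?n\<^sup>2 * card ?H"
    using dsum sL \<gamma> \<delta> by (intro add_mono mult_left_mono) auto
  finally show ?thesis by (simp add: power2_eq_square algebra_simps)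
qed

text \<open>With at most \<open>t - 1\<close> vertices of nearly full thick degree, the squares sum
  to at most \<open>t * n^2 - 3/4 * \<gamma> * n^2\<close>, against at least
  \<open>t * n^2 - 1/4 * \<gamma> * n^2\<close>, both up to linear terms. The value
  \<open>\<gamma> / (16 * vT)\<close> of \<open>\<delta>\<close> limits the light vertices to
  \<open>\<gamma> / 4 * n^2\<close>, and the condition on \<open>D\<close> does the same for the
  pairs in \<open>bad\<close>.\<close>

lemma dominating_set_exists:
  fixes \<gamma> c :: real
  assumes \<gamma>: "0 < \<gamma>" "\<gamma> \<le> 1" and D: "0 < D" "64 * vT\<^sup>2 / D \<le> \<gamma> / 4" and v: "0 < vT"
    and K: "K = nat \<lfloor>4 * vT / (\<gamma> / (16 * vT))\<rfloor>"
    and n: "2 * (2 * c + lin_const vT t D + K * (2 ^ K * vT)) < \<gamma> * nG"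
    and tri: "t * (real nG)\<^sup>2 - c * nG \<le> 4 * card (triangles G)" and c: "0 \<le> c"
  shows "\<exists>X\<subseteq>verts G. card X = t \<and> (\<forall>x\<in>X. (1 - \<gamma>) * nG \<le> card (NT x))"
proof -
  let ?H = "{x\<in>verts G. (1 - \<gamma>) * nG \<le> card (NT x)}" and ?n = "real nG"
  let ?\<delta> = "\<gamma> / (16 * vT)" and ?K = "real (K * (2 ^ K * vT))"
  have n0: "0 < ?n"
  proof -
    have "0 < \<gamma> * ?n" using n c by (intro le_less_trans[OF _ n]) auto
    then show ?thesis using \<gamma>(1) by (simp add: zero_less_mult_iff)
  qed
  have "t \<le> card ?H"
  proof (rule ccontr)
    assume "\<not> ?thesis"
    then have H: "real (card ?H) \<le> real t - 1" by linarith
    have lo: "8 * real (card (triangles G)) - t * ?n\<^sup>2 - 64 * vT\<^sup>2 / D * ?n\<^sup>2 - lin_const vT t D * ?n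
        \<le> (\<Sum>x\<in>verts G. (real (card (NT x)))\<^sup>2)"
      using degree_square_lower[OF D(1)] by simp
    have "(\<Sum>x\<in>verts G. (real (card (NT x)))\<^sup>2) \<le> 4 * vT * ?\<delta> * ?n\<^sup>2
      + (1 - \<gamma>) * nG * (t * nG + K * (2 ^ K * vT)) + \<gamma> * ?n\<^sup>2 * card ?H"
      using \<gamma> v n0 by (intro degree_square_upper) (auto simp: K)
    also have "4 * vT * ?\<delta> * ?n\<^sup>2 = \<gamma> / 4 * ?n\<^sup>2" using v by simp
    also have "(1 - \<gamma>) * nG * (t * nG + K * (2 ^ K * vT)) \<le> (1 - \<gamma>) * t * ?n\<^sup>2 + ?K * ?n"
    proof -
      have "(1 - \<gamma>) * ?n * ?K \<le> 1 * ?n * ?K" using \<gamma> by (intro mult_right_mono) auto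
      then show ?thesis by (simp add: algebra_simps power2_eq_square)
    qed
    also have "\<gamma> * ?n\<^sup>2 * card ?H \<le> \<gamma> * ?n\<^sup>2 * (real t - 1)" using H \<gamma> by (intro mult_left_mono) auto
    finally have up: "(\<Sum>x\<in>verts G. (real (card (NT x)))\<^sup>2)
        \<le> \<gamma> / 4 * ?n\<^sup>2 + ((1 - \<gamma>) * t * ?n\<^sup>2 + ?K * ?n) + \<gamma> * ?n\<^sup>2 * (real t - 1)"
      by simp
    have "64 * vT\<^sup>2 / D * ?n\<^sup>2 \<le> \<gamma> / 4 * ?n\<^sup>2" using D(2) by (intro mult_right_mono) auto
    moreover have "(\<Sum>x\<in>verts G. (real (card (NT x)))\<^sup>2) \<le> t * ?n\<^sup>2 - 3 / 4 * (\<gamma> * ?n\<^sup>2) + ?K * ?n"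
      using up by (simp add: algebra_simps)
    moreover have "\<gamma> / 4 * ?n\<^sup>2 = 1 / 4 * (\<gamma> * ?n\<^sup>2)" by simp
    ultimately have "1 / 2 * (\<gamma> * ?n\<^sup>2) \<le> 2 * (c * ?n) + lin_const vT t D * ?n + ?K * ?n"
      using lo tri by linarith
    then have "\<gamma> / 2 * ?n\<^sup>2 \<le> (2 * c + lin_const vT t D + ?K) * ?n" by (simp add: algebra_simps)
    then have "\<gamma> / 2 * ?n * ?n \<le> (2 * c + lin_const vT t D + ?K) * ?n" by (simp add: power2_eq_square)
    then have "\<gamma> / 2 * ?n \<le> 2 * c + lin_const vT t D + ?K" using n0 by (simp only: mult_le_cancel_right_pos)
    then show False using n by simp
  qed
  then obtain X where "X \<subseteq> ?H" "card X = t" by (rule obtain_subset_with_card_n)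
  then show ?thesis by (intro exI[of _ X]) auto
qed

text \<open>Place A without its leaf l on X; the pendant edge at l is realised by the triangle x y z.\<close>
lemma no_triangle_at_dominated:
  assumes l: "l \<in> A" "e0 \<in> edges T" "l \<in> e0" "\<And>e. e \<in> edges T \<Longrightarrow> l \<in> e \<Longrightarrow> e = e0"
    and X: "X \<subseteq> verts G" "card X = t"
    and W: "W = {w \<in> verts G - X. X \<subseteq> NT w}" "vT + 2 \<le> card W"
    and tri: "{x, y} \<in> edges G" "{y, z} \<in> edges G" "{x, z} \<in> edges G"
    and xyz: "x \<in> W" "y \<notin> X" "z \<notin> X"
  shows False
proof -
  have finX: "finite X" using X(1) finG(1) finite_subset by blast
  have finW: "finite W" using W(1) finG(1) by simp
  obtain u b0 where ub: "e0 = {u, b0}" "u \<in> A" "b0 \<notin> A" using l(2) by (rule A_edge)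
  have ul: "u = l" using ub l(1,3) by auto
  have b0V: "b0 \<in> verts T" using wf_edge_subset[OF wfT l(2)] ub(1) by simp
  have "card (A - {l}) = card X" using l(1) finA A(3) X(2) by simp
  then obtain \<iota> where \<iota>: "bij_betw \<iota> (A - {l}) X" using finite_same_card_bij finA finX by blast
  \<comment> \<open>The class opposite \<open>A\<close> without \<open>b0\<close> has at most
    \<open>vT - 1\<close> vertices, and its images must avoid \<open>x\<close>, \<open>y\<close> and
    \<open>z\<close>; this accounts for \<open>vT + 2\<close>.\<close>
  let ?B = "verts T - A - {b0}" and ?W = "W - {x, y, z}"
  have "card W \<le> card ?W + card {x, y, z}" using card_Un_le[of ?W "{x, y, z}"]
      card_mono[of "?W \<union> {x, y, z}" W] finW by fastforce
  moreover have "card {x, y, z} \<le> 3" by (simp add: card_insert_if)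
  moreover have "card ?B < vT" using b0V finT(1) by (intro psubset_card_mono) auto
  ultimately have "card ?B \<le> card ?W" using W(2) by linarith
  then obtain \<kappa> where \<kappa>: "\<kappa> ` ?B \<subseteq> ?W" "inj_on \<kappa> ?B"
    using card_le_inj[of ?B ?W] finT(1) finW by blast
  \<comment> \<open>The leaf goes to \<open>y\<close> and its neighbour \<open>b0\<close> to
    \<open>x\<close>. Only \<open>b0\<close> has further edges, so only \<open>x\<close> must be
    dominated; \<open>z\<close> is the apex over the pendant edge, and all other edges are
    thick.\<close>
  define f where "f w = (if w = l then y else if w = b0 then x else if w \<in> A then \<iota> w else \<kappa> w)" for w
  have b0l: "b0 \<noteq> l" using l(1) ub(3) by auto
  have fl: "f l = y" and fb: "f b0 = x" using b0l by (auto simp: f_def)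
  have fA: "f w \<in> X" if "w \<in> A" "w \<noteq> l" for w
  proof -
    have "\<iota> w \<in> X" using bij_betwE[OF \<iota>] that by blast
    then show ?thesis using that ub(3) by (auto simp: f_def)
  qed
  have fB: "f w \<in> ?W" if "w \<in> verts T" "w \<notin> A" "w \<noteq> b0" for w
  proof -
    have "\<kappa> w \<in> ?W" using that by (intro subsetD[OF \<kappa>(1)] imageI) simp
    then show ?thesis using that l(1) by (auto simp: f_def)
  qed
  have fW: "f w \<in> W" if "w \<in> verts T" "w \<notin> A" for w
    using fB[OF that] fb xyz(1) by (cases "w = b0") auto
  have WX: "W \<inter> X = {}" using W(1) by auto
  have xX: "x \<notin> X" using xyz(1) WX by blast
  have ne: "x \<noteq> y" "y \<noteq> z" "x \<noteq> z" using triangleI[OF wfG tri] by auto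
  have V: "x \<in> verts G" "y \<in> verts G" "z \<in> verts G"
    using wf_edgeD[OF wfG tri(1)] wf_edgeD[OF wfG tri(2)] by auto
  have type: "w = l \<or> w = b0 \<or> (w \<in> A \<and> w \<noteq> l) \<or> (w \<notin> A \<and> w \<noteq> b0)" for w by auto
  have fne_l: "f w \<noteq> y" if "w \<in> verts T" "w \<noteq> l" for w
    using fA[of w] fB[of w] fb that ne(1) xyz(2) by (cases "w \<in> A"; cases "w = b0") auto
  have fne_b: "f w \<noteq> x" if "w \<in> verts T" "w \<noteq> b0" for w
    using fA[of w] fB[of w] fl that ne(1) xX by (cases "w \<in> A"; cases "w = l") auto
  have fne_z: "f w \<noteq> z" if "w \<in> verts T" for w
  proof (cases "w \<in> A")
    case True
    then show ?thesis using fA[of w] fl ne(2) xyz(3) by (cases "w = l") auto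
  next
    case False
    then show ?thesis using fB[of w] fb ne(3) that by (cases "w = b0") auto
  qed
  show False
  proof (rule complete_copy_False[of f "{e0}" "\<lambda>_. z"])
    show "inj_on f (verts T)"
    proof (rule inj_onI)
      fix p q assume pq: "p \<in> verts T" "q \<in> verts T" "f p = f q"
      show "p = q"
      proof (cases "p = l \<or> q = l")
        case True
        then show ?thesis using fne_l pq fl by metis
      next
        case nl: False
        show ?thesis
        proof (cases "p = b0 \<or> q = b0")
          case True
          then show ?thesis using fne_b pq fb by metis
        next
          case nb: False
          show ?thesis
          proof (cases "p \<in> A"; cases "q \<in> A")
            assume "p \<in> A" "q \<in> A"
            then show ?thesis using pq(3) bij_betw_imp_inj_on[OF \<iota>] nl nb
              by (simp add: f_def inj_on_eq_iff)
          next
            assume a: "p \<in> A" "q \<notin> A"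
            then show ?thesis
              using disjoint_ne[OF WX fW[OF pq(2) a(2)] fA[OF a(1)]] nl pq(3) by simp
          next
            assume a: "p \<notin> A" "q \<in> A"
            then show ?thesis
              using disjoint_ne[OF WX fW[OF pq(1) a(1)] fA[OF a(2)]] nl pq(3) by simp
          next
            assume "p \<notin> A" "q \<notin> A"
            then show ?thesis using pq \<kappa>(2) nl nb by (simp add: f_def inj_on_eq_iff)
          qed
        qed
      qed
    qed
    show "f ` verts T \<subseteq> verts G"
    proof
      fix v assume "v \<in> f ` verts T"
      then obtain w where w: "w \<in> verts T" "v = f w" by blast
      show "v \<in> verts G"
      proof (cases "w \<in> A")
        case True
        then show ?thesis using w fA[of w] fl V X(1) by (cases "w = l") auto
      next
        case False
        then show ?thesis using w fW[of w] W(1) by auto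
      qed
    qed
    show "{e0} \<subseteq> edges T" using l(2) by simp
    have e0f: "f ` e0 = {x, y}" using ub(1) ul fl fb by auto
    have thick: "f ` e \<in> thick" if e: "e \<in> edges T" "e \<noteq> e0" for e
    proof -
      obtain p q where pq: "e = {p, q}" "p \<in> A" "q \<notin> A" using e(1) by (rule A_edge)
      have "p \<noteq> l" using l(4)[OF e(1)] e(2) pq(1) by auto
      then have "f p \<in> X" using fA pq(2) by blast
      moreover have "q \<in> verts T" using wf_edge_subset[OF wfT e(1)] pq(1) by simp
      then have "f q \<in> W" using fW pq(3) by blast
      ultimately have "f p \<in> NT (f q)" using W(1) by blast
      then show ?thesis using pq(1) by (simp add: NT_def insert_commute)
    qed
    show "f ` e \<in> edges G" if "e \<in> edges T" for e
      using thick[OF that] thick_edge e0f tri(1) by (cases "e = e0") auto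
    show "z \<in> cn G (f ` e) - f ` verts T" if "e \<in> {e0}" for e
    proof -
      have "z \<in> cn G (f ` e)" using that e0f tri V by (simp add: cn_def)
      moreover have "z \<notin> f ` verts T" using fne_z by blast
      ultimately show ?thesis by blast
    qed
    show "f ` e \<in> thick" if "e \<in> edges T - {e0}" for e using thick that by blast
  qed simp
qed

section \<open>Exact counting relative to the dominating set\<close>

lemma triangles_inside:
  assumes S: "S \<subseteq> verts G"
  shows "card {s\<in>triangles G. s \<subseteq> S} \<le> 2 * vT * (card S)\<^sup>2 + 4 * vT\<^sup>2 * card S"
proof -
  have finS: "finite S" using S finG(1) finite_subset by blast
  let ?E = "{e\<in>thick. e \<subseteq> S}" and ?T0 = "{s\<in>tri0. s \<subseteq> S}"
  \<comment> \<open>A triangle inside \<open>S\<close> that is not all thin is a thick edge plus one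
    more vertex of \<open>S\<close>.\<close>
  let ?I = "(\<lambda>(w, e). insert w e) ` (S \<times> ?E)"
  have "{s\<in>triangles G. s \<subseteq> S} \<subseteq> ?I \<union> ?T0"
  proof
    fix s assume s: "s \<in> {s\<in>triangles G. s \<subseteq> S}"
    then have tr: "s \<in> triangles G" and sub: "s \<subseteq> S" by auto
    show "s \<in> ?I \<union> ?T0"
    proof (cases "s \<in> tri0")
      case False
      then obtain x y where xy: "x \<in> s" "y \<in> s" "x \<noteq> y" "{x, y} \<notin> thin"
        using tr by (auto simp: tri0_def)
      have "{x, y} \<in> edges G" using tr xy by (auto simp: triangles_def)
      then have th: "{x, y} \<in> thick" using not_thick_thin xy(4) by blast
      have "s \<in> (\<lambda>w. insert w {x, y}) ` cn G {x, y}"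
        using triangles_over_edge(1)[OF wfG thick_edge[OF th]] tr xy by blast
      then obtain w where w: "s = insert w {x, y}" by blast
      then have "w \<in> S" "{x, y} \<subseteq> S" using sub by auto
      then have "(w, {x, y}) \<in> S \<times> ?E" using th by blast
      then have "s \<in> ?I" using w by (intro image_eqI[of _ _ "(w, {x, y})"]) simp
      then show ?thesis by blast
    qed (use sub in blast)
  qed
  moreover have fin: "finite ?I" "finite ?T0" using finS fin_thick fin_tri by auto
  ultimately have "card {s\<in>triangles G. s \<subseteq> S} \<le> card (?I \<union> ?T0)"
    by (intro card_mono finite_UnI)
  also have "\<dots> \<le> card ?I + card ?T0" by (rule card_Un_le)
  also have "card ?I \<le> card (S \<times> ?E)" using finS fin_thick by (intro card_image_le) auto
  also have "card (S \<times> ?E) = card S * card ?E" by (rule card_cartesian_product)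
  also have "\<dots> \<le> card S * (2 * vT * card S)" by (intro mult_le_mono2 thick_linear S)
  also have "card ?T0 \<le> 2 * vT * (2 * vT) * card S" by (rule tri0_linear[OF S])
  finally show ?thesis by (simp add: power2_eq_square algebra_simps)
qed

text \<open>Triangles with two or three vertices in \<open>X\<close> are bounded trivially, by the
  same terms as in the extremal graph; only the last two summands depend on the structure of
  \<open>G\<close>.\<close>

lemma triangles_by_core:
  assumes X: "X \<subseteq> verts G" "card X = t"
  shows "card (triangles G) \<le> (t choose 3) + (t choose 2) * (nG - t)
     + card {s\<in>triangles G. card (s \<inter> X) = 1} + card {s\<in>triangles G. s \<inter> X = {}}"
proof -
  have finX: "finite X" using X(1) finG(1) finite_subset by blast
  let ?S3 = "{s. s \<subseteq> X \<and> card s = 3}" and ?P2 = "{B. B \<subseteq> X \<and> card B = 2} \<times> (verts G - X)"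
  let ?S2 = "(\<lambda>(B, w). insert w B) ` ?P2"
  let ?S1 = "{s\<in>triangles G. card (s \<inter> X) = 1}" and ?S0 = "{s\<in>triangles G. s \<inter> X = {}}"
  have fP: "finite {B. B \<subseteq> X \<and> card B = k}" for k
    by (rule finite_subset[of _ "Pow X"]) (use finX in auto)
  then have fin: "finite ?S3" "finite ?P2" "finite ?S2" "finite ?S1" "finite ?S0"
    using finG(1) fin_tri(1) by auto
  have "triangles G \<subseteq> ?S3 \<union> (?S2 \<union> (?S1 \<union> ?S0))"
  proof
    fix s assume s: "s \<in> triangles G"
    then have sV: "s \<subseteq> verts G" "card s = 3" by (auto simp: triangles_def)
    have fs: "finite s" using sV(1) finG(1) finite_subset by blast
    have split: "card s = card (s \<inter> X) + card (s - X)" by (rule card_Int_Diff[OF fs])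
    then consider "card (s \<inter> X) = 0" | "card (s \<inter> X) = 1" | "card (s \<inter> X) = 2" "card (s - X) = 1"
      | "card (s - X) = 0"
      using sV(2) by linarith
    then show "s \<in> ?S3 \<union> (?S2 \<union> (?S1 \<union> ?S0))"
    proof cases
      case 1
      then show ?thesis using s fs by auto
    next
      case 2
      then show ?thesis using s by auto
    next
      case 3
      then obtain w where w: "s - X = {w}" by (meson card_1_singletonE)
      then have "s = insert w (s \<inter> X)" "w \<in> verts G - X" using sV(1) by auto
      then have "(s \<inter> X, w) \<in> ?P2" "s = (\<lambda>(B, w). insert w B) (s \<inter> X, w)" using 3 by auto
      then have "s \<in> ?S2" by (rule rev_image_eqI)
      then show ?thesis by blast
    next
      case 4
      then have "s \<subseteq> X" using fs by auto
      then show ?thesis using sV(2) by auto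
    qed
  qed
  then have "card (triangles G) \<le> card (?S3 \<union> (?S2 \<union> (?S1 \<union> ?S0)))"
    using fin by (intro card_mono finite_UnI)
  also have "\<dots> \<le> card ?S3 + (card ?S2 + (card ?S1 + card ?S0))"
    by (intro order_trans[OF card_Un_le] add_left_mono order_refl)
  also have "card ?S3 = t choose 3" using n_subsets[OF finX, of 3] X(2) by simp
  also have "card ?S2 \<le> card ?P2" by (rule card_image_le[OF fin(2)])
  also have "card ?P2 = (t choose 2) * (nG - t)"
    using n_subsets[OF finX, of 2] X card_Diff_subset[OF finX X(1)] by (simp add: card_cartesian_product)
  finally show ?thesis by simp
qed

text \<open>Outside \<open>X\<close> and \<open>R0\<close> the graph is triangle-free, so Mantel's
  theorem bounds the edges that \<open>X\<close> can extend there. A vertex \<open>v\<close> of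
  \<open>R0\<close> is undominated: its edge to some \<open>x0\<close> in \<open>X\<close> is thin
  or missing and yields at most \<open>2 * vT\<close> triangles, while each of the other
  \<open>t - 1\<close> vertices of \<open>X\<close> yields at most the degree of \<open>v\<close>
  outside \<open>X\<close>.\<close>

lemma one_core_bound:
  assumes X: "X \<subseteq> verts G" "card X = t"
    and W: "W = {w \<in> verts G - X. X \<subseteq> NT w}"
    and lf: "\<And>s. \<lbrakk>s \<in> triangles G; s \<subseteq> verts G - X\<rbrakk> \<Longrightarrow> s \<inter> W = {}"
    and R0: "R0 = {v \<in> verts G - X. \<exists>s\<in>triangles G. v \<in> s \<and> s \<subseteq> verts G - X}"
    and M: "\<And>v. v \<in> R0 \<Longrightarrow> card {w\<in>W. {v, w} \<in> edges G} \<le> M"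
  shows "\<exists>m. 4 * m \<le> (nG - t - card R0)\<^sup>2 \<and> card {s\<in>triangles G. card (s \<inter> X) = 1}
     \<le> t * m + card R0 * (2 * vT + (t - 1) * (M + card (verts G - X - W)))"
proof -
  let ?V = "verts G - X"
  have finX: "finite X" using X(1) finG(1) finite_subset by blast
  have finR: "finite R0" using R0 finG(1) by simp
  have R0V: "R0 \<subseteq> ?V" using R0 by auto
  let ?E = "{e\<in>edges G. e \<subseteq> ?V - R0}"
  let ?q = "\<lambda>v. {(x, w). x \<in> X \<and> w \<in> ?V \<and> {x, v} \<in> edges G \<and> {x, w} \<in> edges G \<and> {v, w} \<in> edges G}"
  let ?I1 = "(\<lambda>(x, e). insert x e) ` (X \<times> ?E)"
  let ?I2 = "\<Union>v\<in>R0. (\<lambda>(x, w). {x, v, w}) ` ?q v"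
  have fq: "finite (?q v)" for v by (rule finite_subset[of _ "X \<times> ?V"]) (use finX finG(1) in auto)
  have fE: "finite ?E" using finG(2) by simp
  have cover: "{s\<in>triangles G. card (s \<inter> X) = 1} \<subseteq> ?I1 \<union> ?I2"
  proof
    fix s assume "s \<in> {s\<in>triangles G. card (s \<inter> X) = 1}"
    then have s: "s \<in> triangles G" "card (s \<inter> X) = 1" by auto
    then obtain x where x: "s \<inter> X = {x}" by (meson card_1_singletonE)
    then have "x \<in> s" by blast
    with s(1) obtain a b where ab: "s = {x, a, b}" "x \<noteq> a" "x \<noteq> b" "a \<noteq> b" "{x, a} \<in> edges G"
      "{x, b} \<in> edges G" "{a, b} \<in> edges G" "s \<subseteq> verts G"
      by (rule triangle_cases)
    have aX: "a \<notin> X" "b \<notin> X" "x \<in> X" using x ab by auto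
    have abV: "a \<in> ?V" "b \<in> ?V" using aX ab by auto
    consider "a \<in> R0" | "b \<in> R0" | "a \<notin> R0" "b \<notin> R0" by blast
    then show "s \<in> ?I1 \<union> ?I2"
    proof cases
      case 1
      have "(x, b) \<in> ?q a" using aX abV ab by simp
      then have "s \<in> (\<lambda>(x, w). {x, a, w}) ` ?q a" using ab(1) by (intro image_eqI[of _ _ "(x, b)"]) simp_all
      then show ?thesis using 1 by blast
    next
      case 2
      have "(x, a) \<in> ?q b" using aX abV ab by (simp add: insert_commute)
      then have "s \<in> (\<lambda>(x, w). {x, b, w}) ` ?q b"
        using ab(1) by (intro image_eqI[of _ _ "(x, a)"]) (simp_all add: insert_commute)
      then show ?thesis using 2 by blast
    next
      case 3
      have "(x, {a, b}) \<in> X \<times> ?E" using 3 aX abV ab by simp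
      then have "s \<in> ?I1" using ab(1) by (intro image_eqI[of _ _ "(x, {a, b})"]) simp_all
      then show ?thesis by blast
    qed
  qed
  have "card ?I1 \<le> card (X \<times> ?E)" using finX fE by (intro card_image_le) auto
  then have c1: "card ?I1 \<le> t * card ?E" by (simp add: card_cartesian_product X(2))
  have mE: "4 * card ?E \<le> (nG - t - card R0)\<^sup>2"
  proof -
    have "card (?V - R0) = nG - t - card R0"
      using card_Diff_subset[OF finX X(1)] card_Diff_subset[OF finR R0V] X(2) by simp
    moreover have "4 * card ?E \<le> (card (?V - R0))\<^sup>2"
    proof (rule mantel)
      show "finite (?V - R0)" using finG(1) by simp
      show "\<exists>x y. x \<noteq> y \<and> e = {x, y} \<and> x \<in> ?V - R0 \<and> y \<in> ?V - R0" if "e \<in> ?E" for e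
        using that edge_two[of e "?V - R0"] by simp
      fix x y z assume xyz: "{x, y} \<in> ?E" "{y, z} \<in> ?E" "{x, z} \<in> ?E"
      then have "{x, y, z} \<in> triangles G" using triangleI(1)[OF wfG, of x y z] by simp
      moreover have "{x, y, z} \<subseteq> ?V" "x \<notin> R0" "x \<in> ?V" using xyz by auto
      ultimately show False unfolding R0 by blast
    qed
    ultimately show ?thesis by simp
  qed
  have cq: "card (?q v) \<le> 2 * vT + (t - 1) * (M + card (?V - W))" if v: "v \<in> R0" for v
  proof -
    obtain s where s: "v \<in> ?V" "s \<in> triangles G" "v \<in> s" "s \<subseteq> ?V" using v R0 by auto
    then have "v \<notin> W" using lf by blast
    then obtain x0 where x0: "x0 \<in> X" "x0 \<notin> NT v" using s(1) W by blast
    let ?N = "{w\<in>?V. {v, w} \<in> edges G}"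
    let ?C = "if {v, x0} \<in> edges G then cn G {v, x0} else {}"
    have C: "card ?C \<le> 2 * vT" "finite ?C"
      using not_NT_thin[OF _ x0(2)] finite_cn[OF wfG] by (auto simp: thin_def)
    have "?q v \<subseteq> {x0} \<times> ?C \<union> (X - {x0}) \<times> ?N" by (auto simp: cn_def insert_commute)
    then have "card (?q v) \<le> card ({x0} \<times> ?C \<union> (X - {x0}) \<times> ?N)"
      using C(2) finX finG(1) by (intro card_mono) auto
    also have "\<dots> \<le> card ({x0} \<times> ?C) + card ((X - {x0}) \<times> ?N)" by (rule card_Un_le)
    also have "\<dots> \<le> 2 * vT + (t - 1) * card ?N"
      using C(1) x0(1) X(2) finX by (simp add: card_cartesian_product)
    also have "card ?N \<le> M + card (?V - W)"
    proof -
      have "?N \<subseteq> {w\<in>W. {v, w} \<in> edges G} \<union> (?V - W)" by auto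
      then have "card ?N \<le> card ({w\<in>W. {v, w} \<in> edges G} \<union> (?V - W))"
        using W finG(1) by (intro card_mono) auto
      also have "\<dots> \<le> card {w\<in>W. {v, w} \<in> edges G} + card (?V - W)" by (rule card_Un_le)
      finally show ?thesis using M[OF v] by linarith
    qed
    finally show ?thesis by simp
  qed
  have "card ?I2 \<le> (\<Sum>v\<in>R0. card ((\<lambda>(x, w). {x, v, w}) ` ?q v))" by (rule card_UN_le[OF finR])
  also have "\<dots> \<le> (\<Sum>v\<in>R0. 2 * vT + (t - 1) * (M + card (?V - W)))"
  proof (rule sum_mono)
    fix v assume "v \<in> R0"
    then show "card ((\<lambda>(x, w). {x, v, w}) ` ?q v) \<le> 2 * vT + (t - 1) * (M + card (?V - W))"
      using card_image_le[OF fq, of "\<lambda>(x, w). {x, v, w}" v] cq by (meson le_trans)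
  qed
  also have "\<dots> = card R0 * (2 * vT + (t - 1) * (M + card (?V - W)))" by simp
  finally have c2: "card ?I2 \<le> card R0 * (2 * vT + (t - 1) * (M + card (?V - W)))" .
  have "finite ?I1" "finite ?I2" using finX fE finR fq by auto
  then have "card {s\<in>triangles G. card (s \<inter> X) = 1} \<le> card (?I1 \<union> ?I2)"
    using cover by (intro card_mono finite_UnI)
  also have "\<dots> \<le> card ?I1 + card ?I2" by (rule card_Un_le)
  also have "\<dots> \<le> t * card ?E + card R0 * (2 * vT + (t - 1) * (M + card (?V - W)))"
    by (rule add_mono[OF c1 c2])
  finally show ?thesis using mE by blast
qed

text \<open>The neighbours of v in W are independent, and a graph on W with nearly n^2/4 edges has no large
  independent set: M is at most slightly more than n/2.\<close>
lemma degree_into_W: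
  assumes X: "X \<subseteq> verts G" and W: "W \<subseteq> verts G - X"
    and lf: "\<And>s. \<lbrakk>s \<in> triangles G; s \<subseteq> verts G - X\<rbrakk> \<Longrightarrow> s \<inter> W = {}"
    and v: "v \<in> verts G - X"
  shows "\<exists>M. card {w\<in>W. {v, w} \<in> edges G} \<le> M \<and> M \<le> nG
    \<and> card thin \<le> M * (nG - M) + card (verts G - W) * nG"
proof -
  have finW: "finite W" using W finG(1) finite_subset by blast
  let ?E = "{e\<in>edges G. e \<subseteq> W}" and ?I = "{w\<in>W. {v, w} \<in> edges G}"
  have lf': False if "{x, y} \<in> edges G" "{y, z} \<in> edges G" "{x, z} \<in> edges G" "x \<in> W"
    "y \<in> verts G - X" "z \<in> verts G - X" for x y z
  proof -
    have "{x, y, z} \<in> triangles G" using triangleI(1)[OF wfG that(1-3)] .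
    moreover have "{x, y, z} \<subseteq> verts G - X" using that W by auto
    ultimately show False using lf that(4) by blast
  qed
  have "\<exists>M. card ?I \<le> M \<and> M \<le> card W \<and> card ?E \<le> M * (card W - M)"
  proof (rule triangle_free_edge_bound[OF finW])
    show "\<exists>x y. x \<noteq> y \<and> e = {x, y} \<and> x \<in> W \<and> y \<in> W" if "e \<in> ?E" for e
      using that edge_two[of e W] by simp
    show False if "{x, y} \<in> ?E" "{y, z} \<in> ?E" "{x, z} \<in> ?E" for x y z
    proof (rule lf'[of x y z])
      show "y \<in> verts G - X" "z \<in> verts G - X" using that W by blast+
    qed (use that in auto)
    show "?I \<subseteq> W" by auto
    show "\<not> e \<subseteq> ?I" if e: "e \<in> ?E" for e
    proof
      assume sub: "e \<subseteq> ?I"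
      obtain x y where xy: "e = {x, y}" "x \<in> ?I" "y \<in> ?I" using e sub edge_two[of e ?I] by blast
      show False
      proof (rule lf'[of x y v])
        show "{x, y} \<in> edges G" using e xy(1) by simp
        show "{y, v} \<in> edges G" "{x, v} \<in> edges G" using xy(2,3) by (simp_all add: insert_commute)
        show "x \<in> W" "y \<in> verts G - X" using xy(2,3) W by auto
      qed (rule v)
    qed
  qed
  then obtain M where M: "card ?I \<le> M" "M \<le> card W" "card ?E \<le> M * (card W - M)" by auto
  have WV: "card W \<le> nG" using W finG(1) by (intro card_mono) auto
  let ?J = "\<Union>u\<in>verts G - W. (\<lambda>w. {u, w}) ` verts G"
  have "thin \<subseteq> ?E \<union> ?J"
  proof
    fix e assume e: "e \<in> thin"
    obtain x y where xy: "e = {x, y}" "x \<in> verts G" "y \<in> verts G"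
      using edge_two[OF thin_edge[OF e] wf_edge_subset[OF wfG thin_edge[OF e]]] by blast
    show "e \<in> ?E \<union> ?J"
    proof (cases "e \<subseteq> W")
      case False
      then have "x \<notin> W \<or> y \<notin> W" using xy(1) by auto
      then show ?thesis
      proof
        assume "x \<notin> W"
        then show ?thesis using xy by (intro UnI2 UN_I[of x]) auto
      next
        assume "y \<notin> W"
        then show ?thesis using xy by (intro UnI2 UN_I[of y]) (auto simp: insert_commute)
      qed
    qed (use thin_edge[OF e] in simp)
  qed
  then have "card thin \<le> card (?E \<union> ?J)" using finG by (intro card_mono) auto
  also have "\<dots> \<le> card ?E + card ?J" by (rule card_Un_le)
  also have "card ?J \<le> (\<Sum>u\<in>verts G - W. card ((\<lambda>w. {u, w}) ` verts G))"
    using finG(1) by (intro card_UN_le) auto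
  also have "\<dots> \<le> (\<Sum>u\<in>verts G - W. nG)" using finG(1) by (intro sum_mono card_image_le)
  also have "\<dots> = card (verts G - W) * nG" by simp
  also have "card ?E \<le> M * (nG - M)" using M(3) WV by (meson diff_le_mono le_trans mult_le_mono2)
  finally show ?thesis using M(1,2) WV by (intro exI[of _ M]) simp
qed

text \<open>Each member of \<open>X\<close> has at most \<open>\<gamma> * nG\<close> vertices
  outside its thick neighbourhood.\<close>

lemma few_undominated:
  fixes \<gamma> :: real
  assumes X: "X \<subseteq> verts G" "card X = t" "\<forall>x\<in>X. (1 - \<gamma>) * nG \<le> card (NT x)"
    and W: "W = {w \<in> verts G - X. X \<subseteq> NT w}"
  shows "real (card (verts G - X - W)) \<le> t * \<gamma> * nG"
proof -
  have finX: "finite X" using X(1) finG(1) finite_subset by blast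
  have "verts G - X - W \<subseteq> (\<Union>x\<in>X. verts G - NT x)"
    unfolding W using NT_sym by blast
  then have "card (verts G - X - W) \<le> card (\<Union>x\<in>X. verts G - NT x)"
    using finX finG(1) by (intro card_mono) auto
  also have "\<dots> \<le> (\<Sum>x\<in>X. card (verts G - NT x))" by (rule card_UN_le[OF finX])
  finally have "real (card (verts G - X - W)) \<le> (\<Sum>x\<in>X. real (card (verts G - NT x)))"
    by (simp flip: of_nat_sum)
  also have "\<dots> \<le> (\<Sum>x\<in>X. \<gamma> * nG)"
  proof (rule sum_mono)
    fix x assume x: "x \<in> X"
    have "card (NT x) \<le> nG" by (rule card_mono[OF finG(1) NT_subset])
    then have "real (card (verts G - NT x)) = real nG - card (NT x)"
      by (simp add: card_Diff_subset[OF fin_NT NT_subset])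
    then show "real (card (verts G - NT x)) \<le> \<gamma> * nG" using bspec[OF X(3) x] by (simp add: algebra_simps)
  qed
  finally show ?thesis by (simp add: X(2))
qed

text \<open>If \<open>R0\<close> is empty, Mantel's theorem with integer rounding gives the exact
  bound. Otherwise \<open>final_real_inequality\<close> shows that the exceptional vertices cost
  more than they gain. The value of \<open>\<gamma>\<close> makes the number of undominated vertices
  at most \<open>n / (1024 * vT^2)\<close>.\<close>

lemma triangles_le_extremal_count:
  fixes \<gamma> c :: real
  assumes l: "l \<in> A" "e0 \<in> edges T" "l \<in> e0" "\<And>e. e \<in> edges T \<Longrightarrow> l \<in> e \<Longrightarrow> e = e0"
    and X: "X \<subseteq> verts G" "card X = t" "\<forall>x\<in>X. (1 - \<gamma>) * nG \<le> card (NT x)"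
    and \<gamma>: "\<gamma> = 1 / (1024 * vT ^ 3)" and D: "0 < D" "64 * vT\<^sup>2 / D \<le> \<gamma> / 4"
    and tri: "t * (real nG)\<^sup>2 - c * nG \<le> 4 * card (triangles G)" and c: "0 \<le> c"
    and n: "128 * (real vT)\<^sup>2 * (c + lin_const vT t D + 4 * vT) \<le> nG"
  shows "card (triangles G) \<le> extremal_count nG t"
proof -
  let ?n = "real nG" and ?v = "real vT" and ?t = "real t"
  have v1: "1 \<le> ?v" using t_le by linarith
  have tv: "?t \<le> ?v" using t_le by simp
  define W where "W = {w \<in> verts G - X. X \<subseteq> NT w}"
  define R where "R = verts G - X - W"
  define R0 where "R0 = {v \<in> verts G - X. \<exists>s\<in>triangles G. v \<in> s \<and> s \<subseteq> verts G - X}"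
  have finX: "finite X" using X(1) finG(1) finite_subset by blast
  have finR: "finite R" using finG(1) by (simp add: R_def)
  have WV: "W \<subseteq> verts G - X" by (auto simp: W_def)
  have finW: "finite W" using WV finG(1) finite_subset by blast
  have n512: "512 * ?v ^ 3 \<le> ?n"
  proof -
    have "128 * ?v\<^sup>2 * (4 * ?v) \<le> 128 * ?v\<^sup>2 * (c + lin_const vT t D + 4 * ?v)"
      using c by (intro mult_left_mono) auto
    then show ?thesis using n by (simp add: power2_eq_square power3_eq_cube)
  qed
  have v3: "?v \<le> ?v ^ 3" using v1 by (simp add: self_le_power)
  have v13: "1 \<le> ?v ^ 3" using v1 by simp
  have \<rho>: "1024 * ?v\<^sup>2 * card R \<le> ?n"
  proof -
    have "real (card R) \<le> t * \<gamma> * nG"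
      unfolding R_def by (rule few_undominated[OF X W_def])
    also have "\<dots> \<le> vT * \<gamma> * nG" using tv \<gamma> by (intro mult_right_mono) auto
    finally have "1024 * ?v\<^sup>2 * card R \<le> 1024 * ?v\<^sup>2 * (vT * \<gamma> * nG)"
      by (intro mult_left_mono) auto
    also have "\<dots> = ?n" using v1 by (simp add: \<gamma> power2_eq_square power3_eq_cube)
    finally show ?thesis .
  qed
  have Rsmall: "real (card R) \<le> ?n / 1024"
  proof -
    have "1 * real (card R) \<le> ?v\<^sup>2 * card R" using v1 by (intro mult_right_mono) auto
    then show ?thesis using \<rho> by simp
  qed
  have cVW: "card (verts G - W) = t + card R"
  proof -
    have "verts G - W = X \<union> R" using X(1) WV by (auto simp: R_def)
    moreover have "X \<inter> R = {}" by (auto simp: R_def)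
    ultimately show ?thesis using X(2) finX finR by (simp add: card_Un_disjoint)
  qed
  have tn: "t \<le> nG" using card_mono[OF finG(1) X(1)] X(2) by simp
  have bigW: "vT + 2 \<le> card W"
  proof -
    have WG: "W \<subseteq> verts G" using WV by blast
    have "card (verts G - W) + card W = nG"
      using card_Diff_subset[OF finW WG] card_mono[OF finG(1) WG] by linarith
    then have "real (card W) = ?n - ?t - card R" using cVW by linarith
    then have "?v + 2 \<le> real (card W)" using Rsmall n512 v3 v13 tv by linarith
    then have "real (vT + 2) \<le> real (card W)" by simp
    then show ?thesis by (simp only: of_nat_le_iff)
  qed
  have lf: "s \<inter> W = {}" if s: "s \<in> triangles G" "s \<subseteq> verts G - X" for s
  proof (rule ccontr)
    assume "s \<inter> W \<noteq> {}"
    then obtain x where x: "x \<in> s" "x \<in> W" by blast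
    obtain a b where ab: "s = {x, a, b}" "{x, a} \<in> edges G" "{x, b} \<in> edges G" "{a, b} \<in> edges G"
      using s(1) x(1) by (rule triangle_cases)
    have "a \<notin> X" "b \<notin> X" using s(2) ab(1) by auto
    then show False
      using no_triangle_at_dominated[OF l X(1,2) W_def bigW ab(2,4,3) x(2)] by blast
  qed
  have R0R: "R0 \<subseteq> R"
  proof
    fix v assume "v \<in> R0"
    then obtain s where "v \<in> verts G - X" "s \<in> triangles G" "v \<in> s" "s \<subseteq> verts G - X"
      by (auto simp: R0_def)
    then show "v \<in> R" using lf[of s] by (auto simp: R_def)
  qed
  then have rR: "card R0 \<le> card R" by (rule card_mono[OF finR])
  have RV: "R \<subseteq> verts G" by (auto simp: R_def)
  have S0: "card {s\<in>triangles G. s \<inter> X = {}} \<le> 2 * vT * (card R0)\<^sup>2 + 4 * vT\<^sup>2 * card R0"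
  proof -
    have "{s\<in>triangles G. s \<inter> X = {}} \<subseteq> {s\<in>triangles G. s \<subseteq> R0}"
    proof
      fix s assume "s \<in> {s\<in>triangles G. s \<inter> X = {}}"
      then have s: "s \<in> triangles G" "s \<subseteq> verts G - X" by (auto simp: triangles_def)
      then show "s \<in> {s\<in>triangles G. s \<subseteq> R0}" by (auto simp: R0_def)
    qed
    then have "card {s\<in>triangles G. s \<inter> X = {}} \<le> card {s\<in>triangles G. s \<subseteq> R0}"
      using fin_tri(1) by (intro card_mono) auto
    also have "\<dots> \<le> 2 * vT * (card R0)\<^sup>2 + 4 * vT\<^sup>2 * card R0"
      using R0R RV by (intro triangles_inside) blast
    finally show ?thesis .
  qed
  let ?F = "((nG - t) div 2) * (nG - t - (nG - t) div 2)"
  let ?P1 = "card {s\<in>triangles G. card (s \<inter> X) = 1}" and ?P0 = "card {s\<in>triangles G. s \<inter> X = {}}"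
  have "?P1 + ?P0 \<le> t * ?F"
  proof (cases "R0 = {}")
    case True
    obtain m where m: "4 * m \<le> (nG - t - card R0)\<^sup>2"
      "?P1 \<le> t * m + card R0 * (2 * vT + (t - 1) * (0 + card (verts G - X - W)))"
      using one_core_bound[OF X(1,2) W_def lf R0_def, of 0] True by blast
    have "m \<le> ?F" using m(1) True by (intro quarter_square_floor) simp
    then have "t * m \<le> t * ?F" by (rule mult_le_mono2)
    moreover have "?P1 \<le> t * m" "?P0 = 0" using m(2) S0 True by simp_all
    ultimately show ?thesis by linarith
  next
    case False
    have r1: "1 \<le> card R0" using False finite_subset[OF R0R finR] by (simp add: Suc_leI card_gt_0_iff)
    have t1: "1 \<le> t"
    proof (rule ccontr)
      assume "\<not> 1 \<le> t"
      then have "card X = 0" using X(2) by simp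
      then have "X = {}" using finX by simp
      then have "R = {}" by (auto simp: R_def W_def)
      then show False using False R0R by blast
    qed
    define Z where "Z = (c + lin_const vT t D) * ?n + \<gamma> / 4 * ?n\<^sup>2"
    have Z0: "0 \<le> Z" using c \<gamma> by (simp add: Z_def)
    have "64 * vT\<^sup>2 / D * ?n\<^sup>2 \<le> \<gamma> / 4 * ?n\<^sup>2" using D(2) by (intro mult_right_mono) auto
    moreover have "4 * real (card (triangles G)) - 64 * vT\<^sup>2 / D * ?n\<^sup>2 - lin_const vT t D * ?n
        \<le> 4 * ?t * real (card thin)"
      using thin_lower[OF D(1)] by simp
    moreover have "4 * ?t * real (card thin) = ?t * (4 * card thin)" by simp
    moreover have "Z = c * ?n + lin_const vT t D * ?n + \<gamma> / 4 * ?n\<^sup>2"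
      by (simp add: Z_def distrib_right)
    ultimately have low1: "?t * ?n\<^sup>2 - Z \<le> ?t * (4 * card thin)" using tri by linarith
    have low: "?n\<^sup>2 - Z \<le> 4 * card thin"
    proof -
      have "1 * Z \<le> ?t * Z" using Z0 t1 by (intro mult_right_mono) auto
      then have "?t * (?n\<^sup>2 - Z) \<le> ?t * (4 * card thin)" using low1 by (simp add: algebra_simps)
      then show ?thesis using t1 by simp
    qed
    \<comment> \<open>Completing the square: a product \<open>M' * (n - M')\<close> close to
      \<open>n^2 / 4\<close> forces \<open>M' \<le> n / 2 + n / (16 * vT)\<close>. The margin stays
      below \<open>n / 16\<close> when summed over fewer than \<open>vT\<close> vertices of
      \<open>X\<close>.\<close>
    define M where "M = nat \<lfloor>?n / 2 + ?n / (16 * ?v)\<rfloor>"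
    have M: "card {w\<in>W. {v, w} \<in> edges G} \<le> M" if v: "v \<in> R0" for v
    proof -
      have "v \<in> verts G - X" using v by (simp add: R0_def)
      from degree_into_W[OF X(1) WV lf this] obtain M' where
        M': "card {w\<in>W. {v, w} \<in> edges G} \<le> M'" "M' \<le> nG"
        "card thin \<le> M' * (nG - M') + card (verts G - W) * nG"
        by blast
      have "real (card thin) \<le> real (M' * (nG - M') + card (verts G - W) * nG)"
        using M'(3) by (simp only: of_nat_le_iff)
      then have th: "real (card thin) \<le> real M' * (?n - M') + (?t + card R) * ?n"
        using M'(2) by (simp add: cVW of_nat_diff)
      have "(real M' - ?n / 2)\<^sup>2 = ?n\<^sup>2 / 4 - real M' * (?n - M')"
        by (simp add: power2_eq_square field_simps)
      also have "\<dots> \<le> Z / 4 + (?t + card R) * ?n" using low th by linarith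
      also have "\<dots> = (c + lin_const vT t D + 4 * t) / 4 * ?n + \<gamma> / 16 * ?n\<^sup>2 + card R * ?n"
        by (simp add: Z_def field_simps)
      \<comment> \<open>In units of \<open>n^2 / (1024 * vT^2)\<close>, the three summands are at
        most 2, 1 and 1, and the right side is 4.\<close>
      also have "\<dots> \<le> (?n / (16 * ?v))\<^sup>2"
      proof -
        have e: "(?n / (16 * ?v))\<^sup>2 = ?n\<^sup>2 / (256 * ?v\<^sup>2)" by (simp add: power_divide power_mult_distrib)
        have 1: "(c + lin_const vT t D + 4 * t) / 4 * ?n \<le> ?n\<^sup>2 / (512 * ?v\<^sup>2)"
        proof -
          have "(c + lin_const vT t D + 4 * t) \<le> (c + lin_const vT t D + 4 * vT)" using tv by simp
          then have "128 * ?v\<^sup>2 * (c + lin_const vT t D + 4 * t) \<le> 128 * ?v\<^sup>2 * (c + lin_const vT t D + 4 * vT)"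
            by (intro mult_left_mono) auto
          then have "128 * ?v\<^sup>2 * (c + lin_const vT t D + 4 * t) \<le> ?n" using n by linarith
          then have "(c + lin_const vT t D + 4 * t) / 4 \<le> ?n / (512 * ?v\<^sup>2)"
            using v1 by (simp add: field_simps)
          then have "(c + lin_const vT t D + 4 * t) / 4 * ?n \<le> ?n / (512 * ?v\<^sup>2) * ?n"
            by (intro mult_right_mono) auto
          then show ?thesis by (simp add: power2_eq_square)
        qed
        have 2: "card R * ?n \<le> ?n\<^sup>2 / (1024 * ?v\<^sup>2)"
        proof -
          have "real (card R) \<le> ?n / (1024 * ?v\<^sup>2)" using \<rho> v1 by (simp add: field_simps)
          then have "card R * ?n \<le> ?n / (1024 * ?v\<^sup>2) * ?n" by (intro mult_right_mono) auto
          then show ?thesis by (simp add: power2_eq_square)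
        qed
        have 3: "\<gamma> / 16 * ?n\<^sup>2 \<le> ?n\<^sup>2 / (1024 * ?v\<^sup>2)"
        proof -
          have "?v\<^sup>2 \<le> ?v ^ 3" using v1 by (intro power_increasing) auto
          then have "?v\<^sup>2 \<le> 16 * ?v ^ 3" using v13 by linarith
          then have "1 / (1024 * (16 * ?v ^ 3)) \<le> 1 / (1024 * ?v\<^sup>2)"
            using v1 by (intro divide_left_mono) auto
          then have "\<gamma> / 16 \<le> 1 / (1024 * ?v\<^sup>2)" by (simp add: \<gamma>)
          then have "\<gamma> / 16 * ?n\<^sup>2 \<le> 1 / (1024 * ?v\<^sup>2) * ?n\<^sup>2" by (intro mult_right_mono) auto
          then show ?thesis by simp
        qed
        have s1: "?n\<^sup>2 / (512 * ?v\<^sup>2) = 2 * (?n\<^sup>2 / (1024 * ?v\<^sup>2))"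
          and s2: "?n\<^sup>2 / (256 * ?v\<^sup>2) = 4 * (?n\<^sup>2 / (1024 * ?v\<^sup>2))" by simp_all
        show ?thesis unfolding e s2 using 1 2 3 unfolding s1 by linarith
      qed
      finally have "real M' - ?n / 2 \<le> ?n / (16 * ?v)"
        by (rule power2_le_imp_le) simp
      then have "M' \<le> M" unfolding M_def by (intro le_nat_floor) simp
      then show ?thesis using M'(1) by simp
    qed
    obtain m where m: "4 * m \<le> (nG - t - card R0)\<^sup>2"
      "?P1 \<le> t * m + card R0 * (2 * vT + (t - 1) * (M + card (verts G - X - W)))"
      using one_core_bound[OF X(1,2) W_def lf R0_def M] by blast
    have "R0 \<subseteq> verts G - X" by (auto simp: R0_def)
    then have "card R0 \<le> card (verts G - X)" using finG(1) by (intro card_mono) auto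
    then have rk: "card R0 \<le> nG - t" using card_Diff_subset[OF finX X(1)] X(2) by simp
    have up1: "4 * (?t * real m + real (card R0) * (2 * ?v + (?t - 1) * (real M + real (card R)))
        + (2 * ?v * (real (card R0))\<^sup>2 + 4 * ?v\<^sup>2 * real (card R0))) \<le> ?t * (?n - ?t)\<^sup>2 - ?t"
    proof (rule final_real_inequality[OF _ tv _ _ _ \<rho> n512 refl])
      show "1 \<le> ?t" "1 \<le> real (card R0)" "real (card R0) \<le> real (card R)" "0 \<le> ?n - ?t - real (card R0)"
        using t1 r1 rR rk tn by simp_all
      have "real (4 * m) \<le> real ((nG - t - card R0)\<^sup>2)" using m(1) by (simp only: of_nat_le_iff)
      then show "4 * real m \<le> (?n - ?t - real (card R0))\<^sup>2"
        using tn rk by (simp add: of_nat_diff diff_diff_eq)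
      have "real M \<le> ?n / 2 + ?n / (16 * ?v)" unfolding M_def by (intro of_nat_floor) auto
      then show "16 * ?v * real M \<le> 8 * ?v * ?n + ?n" using v1 by (simp add: field_simps)
    qed simp
    have up2: "real (?P1 + ?P0) \<le> ?t * real m
        + real (card R0) * (2 * ?v + (?t - 1) * (real M + real (card R)))
        + (2 * ?v * (real (card R0))\<^sup>2 + 4 * ?v\<^sup>2 * real (card R0))"
    proof -
      have "?P1 + ?P0 \<le> t * m + card R0 * (2 * vT + (t - 1) * (M + card R))
          + (2 * vT * (card R0)\<^sup>2 + 4 * vT\<^sup>2 * card R0)"
        using m(2) S0 by (simp add: R_def)
      then have "real (?P1 + ?P0) \<le> real (t * m + card R0 * (2 * vT + (t - 1) * (M + card R))
          + (2 * vT * (card R0)\<^sup>2 + 4 * vT\<^sup>2 * card R0))"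
        by (simp only: of_nat_le_iff)
      then show ?thesis using t1 by (simp add: of_nat_diff)
    qed
    have "4 * real (?P1 + ?P0) \<le> ?t * (?n - ?t)\<^sup>2 - ?t"
      by (rule order_trans[OF mult_left_mono[OF up2] up1]) simp
    also have "\<dots> = ?t * (real ((nG - t)\<^sup>2) - 1)" using tn by (simp add: of_nat_diff algebra_simps)
    \<comment> \<open>The spare \<open>- t\<close> pays for rounding: for odd \<open>k\<close> the
      balanced product is \<open>(k^2 - 1) / 4\<close>.\<close>
    also have "\<dots> \<le> ?t * (4 * real ?F)"
    proof (rule mult_left_mono)
      have "real ((nG - t)\<^sup>2) \<le> real (4 * ?F + 1)" using quarter_square_lower by (simp only: of_nat_le_iff)
      then show "real ((nG - t)\<^sup>2) - 1 \<le> 4 * real ?F" by simp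
    qed simp
    finally have "real (?P1 + ?P0) \<le> real (t * ?F)" by simp
    then show ?thesis by (simp only: of_nat_le_iff)
  qed
  then show ?thesis using triangles_by_core[OF X(1,2)] by (simp add: extremal_count_def)
qed

end

section \<open>The extremal graphs\<close>

text \<open>Graphs with fewer triangles than this satisfy the upper bound at once, so the structural
  argument may assume that many.\<close>

lemma extremal_count_lower:
  assumes "t \<le> n"
  shows "t * (real n)\<^sup>2 - (2 * (real t)\<^sup>2 + t) * n \<le> 4 * extremal_count n t"
proof (cases "n = 0")
  case False
  let ?F = "((n - t) div 2) * (n - t - (n - t) div 2)"
  have "real ((n - t)\<^sup>2) \<le> real (4 * ?F + 1)" using quarter_square_lower by (simp only: of_nat_le_iff)
  then have F: "(real n - t)\<^sup>2 - 1 \<le> 4 * real ?F" using assms by (simp add: of_nat_diff)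
  have "real (t * ?F) \<le> real (extremal_count n t)" unfolding extremal_count_def of_nat_le_iff by simp
  then have "real t * (4 * real ?F) \<le> 4 * real (extremal_count n t)" by simp
  moreover have "real t * ((real n - t)\<^sup>2 - 1) \<le> real t * (4 * real ?F)" by (rule mult_left_mono[OF F]) simp
  moreover have "real t * ((real n - t)\<^sup>2 - 1)
      = t * (real n)\<^sup>2 - 2 * (real t)\<^sup>2 * n + real t ^ 3 - t"
    by (simp add: power2_eq_square power3_eq_cube algebra_simps)
  moreover have "0 \<le> real t ^ 3" by simp
  moreover have "real t * 1 \<le> real t * n" using False by (intro mult_left_mono) auto
  moreover have "(2 * (real t)\<^sup>2 + t) * n = 2 * (real t)\<^sup>2 * n + real t * n" by (simp add: algebra_simps)
  ultimately show ?thesis by linarith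
qed simp

lemma eventually_triangles_le:
  fixes T :: "'a graph"
  assumes tree: "is_tree T" and A: "A \<subseteq> verts T" "\<And>e. e \<in> edges T \<Longrightarrow> card (A \<inter> e) = 1" "card A = Suc t"
    and l: "l \<in> A" "e0 \<in> edges T" "l \<in> e0" "\<And>e. e \<in> edges T \<Longrightarrow> l \<in> e \<Longrightarrow> e = e0"
  shows "\<exists>N. \<forall>n\<ge>N. \<forall>G :: 'b graph. wf_graph G \<and> card (verts G) = n
    \<and> \<not> contains_copy G (tri_blowup T) \<longrightarrow> card (triangles G) \<le> extremal_count n t"
proof -
  let ?v = "card (verts T)"
  have "finite (verts T)" using tree wf_finite_verts[of T] by (simp add: is_tree_def)
  then have v: "Suc t \<le> ?v" using card_mono[OF _ A(1)] A(3) by simp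
  define \<gamma> where "\<gamma> = 1 / (1024 * real ?v ^ 3)"
  \<comment> \<open>Chosen so that \<open>64 * ?v^2 / D\<close> equals
    \<open>\<gamma> / 4\<close>.\<close>
  define D where "D = 262144 * ?v ^ 5"
  define K where "K = nat \<lfloor>4 * ?v / (\<gamma> / (16 * ?v))\<rfloor>"
  define c where "c = 2 * (real t)\<^sup>2 + t"
  define b1 where "b1 = 2 * (2 * c + lin_const ?v t D + K * (2 ^ K * ?v)) / \<gamma>"
  define b2 where "b2 = 128 * (real ?v)\<^sup>2 * (c + lin_const ?v t D + 4 * ?v)"
  \<comment> \<open>\<open>b1\<close> and \<open>b2\<close> are the thresholds of
    \<open>dominating_set_exists\<close> and \<open>triangles_le_extremal_count\<close>; the summand
    1 makes the first one strict.\<close>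
  define N where "N = nat \<lceil>b1\<rceil> + nat \<lceil>b2\<rceil> + t + 1"
  have \<gamma>: "0 < \<gamma>" "\<gamma> \<le> 1"
  proof -
    have 1: "1 \<le> real ?v ^ 3" using v by (intro one_le_power) simp
    then have pos: "0 < 1024 * real ?v ^ 3" by linarith
    then show "0 < \<gamma>" unfolding \<gamma>_def by (rule divide_pos_pos[OF zero_less_one])
    show "\<gamma> \<le> 1" unfolding \<gamma>_def divide_le_eq_1_pos[OF pos] using 1 by linarith
  qed
  have \<gamma>': "\<gamma> = 1 / real (1024 * ?v ^ 3)" by (simp add: \<gamma>_def)
  have D: "0 < D" "64 * ?v\<^sup>2 / D \<le> \<gamma> / 4"
  proof -
    show "0 < D" using v by (simp add: D_def)
    have v5: "real ?v ^ 5 = (real ?v)\<^sup>2 * real ?v ^ 3" by (simp flip: power_add)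
    have v0: "real ?v \<noteq> 0" using v by linarith
    have cancel: "64 * a / (262144 * (a * b)) = 1 / (1024 * b) / 4" if "a \<noteq> 0" for a b :: real
      using that by simp
    have "real D = 262144 * ((real ?v)\<^sup>2 * real ?v ^ 3)"
      by (simp only: D_def of_nat_mult of_nat_power of_nat_numeral v5)
    then have "64 * (real ?v)\<^sup>2 / real D = \<gamma> / 4"
      using cancel[of "(real ?v)\<^sup>2" "real ?v ^ 3"] v0 by (simp only: \<gamma>_def power_eq_0_iff simp_thms)
    then show "64 * ?v\<^sup>2 / D \<le> \<gamma> / 4" by simp
  qed
  have c: "0 \<le> c" by (simp add: c_def)
  show ?thesis
  proof (intro exI[of _ N] allI impI)
    fix n and G :: "'b graph"
    assume n: "N \<le> n" and G: "wf_graph G \<and> card (verts G) = n \<and> \<not> contains_copy G (tri_blowup T)"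
    interpret tree_free T A t G using tree A G by unfold_locales auto
    have "b1 < n" "b2 \<le> n" "t \<le> n" using n unfolding N_def by linarith+
    then have n1: "2 * (2 * c + lin_const ?v t D + K * (2 ^ K * ?v)) < \<gamma> * card (verts G)"
      and n2: "128 * (real ?v)\<^sup>2 * (c + lin_const ?v t D + 4 * ?v) \<le> card (verts G)"
      using \<gamma>(1) G by (simp_all add: b1_def b2_def field_simps)
    show "card (triangles G) \<le> extremal_count n t"
    proof (cases "t * (real (card (verts G)))\<^sup>2 - c * card (verts G) \<le> 4 * card (triangles G)")
      case True
      obtain X where X: "X \<subseteq> verts G" "card X = t" "\<forall>x\<in>X. (1 - \<gamma>) * card (verts G) \<le> card (NT x)"
        using dominating_set_exists[OF \<gamma> D _ K_def n1 True c] v by auto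
      show ?thesis
        using triangles_le_extremal_count[OF l X \<gamma>' D True c n2] G by simp
    next
      case False
      have "t * (real n)\<^sup>2 - c * n \<le> 4 * extremal_count n t"
        using extremal_count_lower[OF \<open>t \<le> n\<close>] by (simp add: c_def)
      then show ?thesis using False G by simp
    qed
  qed
qed

lemma S_graph_wf: "wf_graph (S_graph n t)" "verts (S_graph n t) = {..<n}"
  unfolding wf_graph_def S_graph_def verts_def edges_def by auto

lemma S_graph_edge:
  "{x, y} \<in> edges (S_graph n t) \<longleftrightarrow> x < n \<and> y < n \<and> x \<noteq> y \<and>
     (x < t \<or> y < t \<or> ((x < t + (n - t) div 2) \<noteq> (y < t + (n - t) div 2)))"
  unfolding S_graph_def edges_def by (auto simp: doubleton_eq_iff)

text \<open>The three families are told apart by how many elements lie below \<open>t\<close>. One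
  inequality suffices, since the lower bound on \<open>ex_K3\<close> works with \<open>S_bi\<close>
  directly.\<close>

lemma extremal_count_le_S_bi:
  assumes "t \<le> n"
  shows "extremal_count n t \<le> card (S_bi n t)"
proof -
  let ?h = "(n - t) div 2"
  let ?S3 = "{s. s \<subseteq> {..<t} \<and> card s = 3}"
  let ?P2 = "{B. B \<subseteq> {..<t} \<and> card B = 2} \<times> {t..<n}"
  let ?S2 = "(\<lambda>(B, w). insert w B) ` ?P2"
  let ?P1 = "{..<t} \<times> {t..<t + ?h} \<times> {t + ?h..<n}"
  let ?S1 = "(\<lambda>(x, y, z). {x, y, z}) ` ?P1"
  have tri: "s \<in> S_bi n t" if "s \<subseteq> {..<n}" "card s = 3"
    "\<And>x y. x \<in> s \<Longrightarrow> y \<in> s \<Longrightarrow> x \<noteq> y \<Longrightarrow> x < t \<or> y < t \<or> ((x < t + ?h) \<noteq> (y < t + ?h))" for s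
    using that by (auto simp: S_bi_def triangles_def S_graph_wf S_graph_edge)
  have fP: "finite {B. B \<subseteq> {..<t} \<and> card B = k}" for k
    by (rule finite_subset[of _ "Pow {..<t}"]) auto
  have S3: "?S3 \<subseteq> S_bi n t"
  proof
    fix s assume "s \<in> ?S3"
    then show "s \<in> S_bi n t" using assms by (intro tri) auto
  qed
  have S2: "?S2 \<subseteq> S_bi n t \<and> (\<forall>s\<in>?S2. card (s \<inter> {..<t}) = 2)"
  proof -
    have "s \<in> S_bi n t \<and> card (s \<inter> {..<t}) = 2" if "s \<in> ?S2" for s
    proof -
      obtain B w where B: "B \<subseteq> {..<t}" "card B = 2" "t \<le> w" "w < n" "s = insert w B"
        using \<open>s \<in> ?S2\<close> by auto
      have fB: "finite B" using B(1) finite_subset by blast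
      have "w \<notin> B" using B(1,3) by auto
      then have "card s = 3" using B(2,5) fB by simp
      moreover have "s \<subseteq> {..<n}" using B assms by auto
      moreover have "x < t \<or> y < t" if "x \<in> s" "y \<in> s" "x \<noteq> y" for x y
        using that B(1,5) by auto
      ultimately have "s \<in> S_bi n t" by (intro tri) auto
      moreover have "s \<inter> {..<t} = B" using B by auto
      ultimately show ?thesis using B(2) by simp
    qed
    then show ?thesis by blast
  qed
  have S1: "?S1 \<subseteq> S_bi n t \<and> (\<forall>s\<in>?S1. card (s \<inter> {..<t}) = 1)"
  proof -
    have "s \<in> S_bi n t \<and> card (s \<inter> {..<t}) = 1" if "s \<in> ?S1" for s
    proof -
      obtain x y z where s: "s = {x, y, z}" "x < t" "t \<le> y" "y < t + ?h" "t + ?h \<le> z" "z < n"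
        using \<open>s \<in> ?S1\<close> by auto
      have "card s = 3" using s by auto
      moreover have "s \<subseteq> {..<n}" using s assms by auto
      ultimately have "s \<in> S_bi n t" using s by (intro tri) auto
      moreover have "s \<inter> {..<t} = {x}" using s by auto
      ultimately show ?thesis by simp
    qed
    then show ?thesis by blast
  qed
  have c3: "card ?S3 = t choose 3" using n_subsets[of "{..<t}" 3] by simp
  have i2: "inj_on (\<lambda>(B, w). insert w B) ?P2"
  proof (rule inj_onI)
    fix p q assume p: "p \<in> ?P2" and q: "q \<in> ?P2" and eq: "(\<lambda>(B, w). insert w B) p = (\<lambda>(B, w). insert w B) q"
    obtain B w where pw: "p = (B, w)" "B \<subseteq> {..<t}" "t \<le> w" using p by auto
    obtain B' w' where qw: "q = (B', w')" "B' \<subseteq> {..<t}" "t \<le> w'" using q by auto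
    have e: "insert w B = insert w' B'" using eq pw(1) qw(1) by simp
    have "B = insert w B \<inter> {..<t}" "B' = insert w' B' \<inter> {..<t}" using pw qw by auto
    then have "B = B'" using e by simp
    moreover have "{w} = insert w B - {..<t}" "{w'} = insert w' B' - {..<t}" using pw qw by auto
    then have "{w} = {w'}" using e by simp
    ultimately show "p = q" using pw(1) qw(1) by simp
  qed
  have c2: "card ?S2 = (t choose 2) * (n - t)"
    using card_image[OF i2] n_subsets[of "{..<t}" 2] by (simp add: card_cartesian_product)
  have i1: "inj_on (\<lambda>(x, y, z). {x, y, z}) ?P1"
  proof (rule inj_onI)
    fix p q assume p: "p \<in> ?P1" and q: "q \<in> ?P1"
      and eq: "(\<lambda>(x, y, z). {x, y, z}) p = (\<lambda>(x, y, z). {x, y, z}) q"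
    obtain x y z where pw: "p = (x, y, z)" "x < t" "t \<le> y" "y < t + ?h" "t + ?h \<le> z" using p by auto
    obtain x' y' z' where qw: "q = (x', y', z')" "x' < t" "t \<le> y'" "y' < t + ?h" "t + ?h \<le> z'"
      using q by auto
    have e: "{x, y, z} = {x', y', z'}" using eq pw(1) qw(1) by simp
    have "{x} = {x, y, z} \<inter> {..<t}" "{x'} = {x', y', z'} \<inter> {..<t}" using pw qw by auto
    then have "{x} = {x'}" using e by simp
    moreover have "{y} = {x, y, z} \<inter> {t..<t + ?h}" "{y'} = {x', y', z'} \<inter> {t..<t + ?h}"
      using pw qw by auto
    then have "{y} = {y'}" using e by simp
    moreover have "{z} = {x, y, z} \<inter> {t + ?h..}" "{z'} = {x', y', z'} \<inter> {t + ?h..}"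
      using pw qw by auto
    then have "{z} = {z'}" using e by simp
    ultimately show "p = q" using pw(1) qw(1) by simp
  qed
  have c1: "card ?S1 = t * (?h * (n - t - ?h))"
    using card_image[OF i1] by (simp add: card_cartesian_product)
  have s3: "card (s \<inter> {..<t}) = 3" if "s \<in> ?S3" for s
    using that by (auto simp: Int_absorb2)
  have d: "?S3 \<inter> ?S2 = {}" "(?S3 \<union> ?S2) \<inter> ?S1 = {}"
  proof -
    show "?S3 \<inter> ?S2 = {}"
    proof (rule ccontr)
      assume "?S3 \<inter> ?S2 \<noteq> {}"
      then obtain s where s: "s \<in> ?S3" "s \<in> ?S2" by (meson disjoint_iff)
      then show False using s3[OF s(1)] bspec[OF conjunct2[OF S2] s(2)] by simp
    qed
    show "(?S3 \<union> ?S2) \<inter> ?S1 = {}"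
    proof (rule ccontr)
      assume "(?S3 \<union> ?S2) \<inter> ?S1 \<noteq> {}"
      then obtain s where s: "s \<in> ?S3 \<or> s \<in> ?S2" "s \<in> ?S1" by (meson disjoint_iff Un_iff)
      have "card (s \<inter> {..<t}) = 1" using bspec[OF conjunct2[OF S1] s(2)] .
      then show False using s(1) s3[of s] bspec[OF conjunct2[OF S2], of s] by auto
    qed
  qed
  have fin: "finite ?S3" "finite ?S2" "finite ?S1" using fP by auto
  have "extremal_count n t = card ?S3 + card ?S2 + card ?S1"
    by (simp only: extremal_count_def c1 c2 c3)
  also have "\<dots> = card (?S3 \<union> ?S2 \<union> ?S1)"
    using card_Un_disjoint[OF fin(1,2) d(1)] card_Un_disjoint[OF finite_UnI[OF fin(1,2)] fin(3) d(2)] by simp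
  also have "\<dots> \<le> card (S_bi n t)"
  proof (rule card_mono)
    show "finite (S_bi n t)" unfolding S_bi_def by (rule finite_triangles[OF S_graph_wf(1)])
    show "?S3 \<union> ?S2 \<union> ?S1 \<subseteq> S_bi n t" by (intro Un_least S3 conjunct1[OF S2] conjunct1[OF S1])
  qed
  finally show ?thesis .
qed

lemma tau_le_cover:
  assumes "wf_graph T" "C \<subseteq> verts T" "\<forall>e\<in>edges T. e \<inter> C \<noteq> {}"
  shows "tau T \<le> card C"
proof -
  let ?Q = "{card C | C. C \<subseteq> verts T \<and> (\<forall>e\<in>edges T. e \<inter> C \<noteq> {})}"
  have "finite ?Q"
    by (rule finite_subset[of _ "card ` Pow (verts T)"]) (use wf_finite_verts[OF assms(1)] in auto)
  moreover have "card C \<in> ?Q" using assms(2,3) by blast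
  ultimately show ?thesis unfolding tau_def by (rule Min_le)
qed

text \<open>Each triangle of the blowup uses a vertex of the core, and charging that vertex to the tree
  vertex or to an end of the tree edge it represents gives a vertex cover of size at most t.\<close>
lemma S_graph_free:
  assumes wf: "wf_graph T" and tau: "t < tau T"
  shows "\<not> contains_copy (S_graph n t) (tri_blowup T)"
proof
  let ?B = "tri_blowup T" and ?S = "S_graph n t"
  assume "contains_copy ?S ?B"
  then obtain f where f: "inj_on f (verts ?B)" "\<forall>e\<in>edges ?B. f ` e \<in> edges ?S"
    by (auto simp: contains_copy_def)
  have V: "verts ?B = Inl ` verts T \<union> Inr ` edges T" by (simp add: tri_blowup_def verts_def)
  have E: "edges ?B = (\<Union>e\<in>edges T. {Inl ` e} \<union> {{Inl x, Inr e} | x. x \<in> e})"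
    by (simp add: tri_blowup_def edges_def)
  let ?g = "case_sum (\<lambda>v. v) (\<lambda>e. SOME v. v \<in> e)"
  let ?P = "{p\<in>verts ?B. f p < t}"
  have g: "?g (Inr e) \<in> e" if "e \<in> edges T" for e
    using wf_edge_card[OF wf that] by (auto intro!: some_in_eq[THEN iffD2])
  have finP: "finite ?P"
    unfolding V using wf_finite_verts[OF wf] wf_finite_edges[OF wf] by auto
  have "card (?g ` ?P) \<le> card ?P" by (rule card_image_le[OF finP])
  also have "card ?P \<le> card {..<t}"
    using f(1) by (intro card_inj_on_le[of f]) (auto simp: inj_on_def)
  finally have "card (?g ` ?P) \<le> t" by simp
  moreover have "tau T \<le> card (?g ` ?P)"
  proof (rule tau_le_cover[OF wf])
    show "?g ` ?P \<subseteq> verts T"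
    proof
      fix v assume "v \<in> ?g ` ?P"
      then obtain p where p: "p \<in> verts ?B" "v = ?g p" by blast
      show "v \<in> verts T"
      proof (cases p)
        case (Inl a)
        then show ?thesis using p by (auto simp: V)
      next
        case (Inr e)
        then have "e \<in> edges T" using p(1) by (auto simp: V)
        then show ?thesis using g[of e] p(2) Inr wf_edge_subset[OF wf] by blast
      qed
    qed
    show "\<forall>e\<in>edges T. e \<inter> ?g ` ?P \<noteq> {}"
    proof
      fix e assume e: "e \<in> edges T"
      obtain x y where xy: "x \<noteq> y" "e = {x, y}" "x \<in> verts T" "y \<in> verts T"
        using wf e by (rule wf_edgeE)
      have sub: "{Inl ` e} \<union> {{Inl x, Inr e} | x. x \<in> e} \<subseteq> edges ?B" unfolding E using e by blast
      have "Inl ` e \<in> edges ?B" using sub by blast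
      moreover have "{Inl x, Inr e} \<in> edges ?B" "{Inl y, Inr e} \<in> edges ?B"
        using sub xy(2) by blast+
      ultimately have "f ` Inl ` e \<in> edges ?S" "f ` {Inl x, Inr e} \<in> edges ?S" "f ` {Inl y, Inr e} \<in> edges ?S"
        using f(2) by blast+
      then have "{f (Inl x), f (Inl y)} \<in> edges ?S" "{f (Inl x), f (Inr e)} \<in> edges ?S"
        "{f (Inl y), f (Inr e)} \<in> edges ?S"
        using xy(2) by simp_all
      \<comment> \<open>Outside the core only two parts are available, so three pairwise adjacent
        vertices cannot all lie there.\<close>
      then have "f (Inl x) < t \<or> f (Inl y) < t \<or> f (Inr e) < t"
        unfolding S_graph_edge by auto
      then consider "Inl x \<in> ?P" | "Inl y \<in> ?P" | "Inr e \<in> ?P" using xy e by (auto simp: V)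
      then show "e \<inter> ?g ` ?P \<noteq> {}"
      proof cases
        case 1
        then have "x \<in> ?g ` ?P" by (rule rev_image_eqI) simp
        then show ?thesis using xy(2) by blast
      next
        case 2
        then have "y \<in> ?g ` ?P" by (rule rev_image_eqI) simp
        then show ?thesis using xy(2) by blast
      next
        case 3
        then have "?g (Inr e) \<in> ?g ` ?P" by (rule imageI)
        then show ?thesis using g[OF e] by blast
      qed
    qed
  qed
  ultimately show False using tau by simp
qed

lemma ex_K3_finite: "finite {card (triangles G) | G :: nat graph.
    wf_graph G \<and> verts G = {..<n} \<and> \<not> contains_copy G H}"
proof (rule finite_subset)
  show "{card (triangles G) | G :: nat graph. wf_graph G \<and> verts G = {..<n} \<and> \<not> contains_copy G H}
      \<subseteq> {..card (Pow {..<n})}"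
  proof
    fix k assume "k \<in> {card (triangles G) | G :: nat graph.
      wf_graph G \<and> verts G = {..<n} \<and> \<not> contains_copy G H}"
    then obtain G :: "nat graph" where G: "verts G = {..<n}" "k = card (triangles G)" by blast
    then have "triangles G \<subseteq> Pow {..<n}" by (auto simp: triangles_def)
    then show "k \<in> {..card (Pow {..<n})}" using card_mono[of "Pow {..<n}"] G(2) by simp
  qed
qed simp

theorem theorem1p5:
  fixes T :: "'a graph"
  assumes "is_tree T"
  shows "(sigma T = tau_ind T \<and> (\<exists>e. critical_edge T e) \<longrightarrow>
            (\<exists>N. \<forall>n\<ge>N. ex_K3 n (tri_blowup T) \<le> card (S_bi n (sigma T - 1))))
       \<and> (strongly_edge_critical T \<longrightarrow>
            (\<exists>N. \<forall>n\<ge>N. ex_K3 n (tri_blowup T) = card (S_bi n (sigma T - 1))))"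
proof -
  have wf: "wf_graph T" using assms by (simp add: is_tree_def)
  let ?t = "sigma T - 1"
  have upper: "\<exists>N. \<forall>n\<ge>N. ex_K3 n (tri_blowup T) \<le> card (S_bi n ?t)"
    if st: "sigma T = tau_ind T" and e: "critical_edge T e" for e
  proof -
    obtain A where A0: "A \<subseteq> verts T" "\<forall>e\<in>edges T. card (A \<inter> e) = 1" "card A = tau_ind T"
      and min0: "\<forall>S. S \<subseteq> verts T \<and> (\<forall>e\<in>edges T. card (S \<inter> e) = 1) \<longrightarrow> card A \<le> card S"
      using tau_ind_attained[OF assms] by (elim exE conjE) (rule that)
    have A: "A \<subseteq> verts T" "\<And>e. e \<in> edges T \<Longrightarrow> card (A \<inter> e) = 1" "card A = tau_ind T"
      using A0 by blast+
    have min: "card A \<le> card S" if "S \<subseteq> verts T" "\<And>e. e \<in> edges T \<Longrightarrow> card (S \<inter> e) = 1" for S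
      using min0 that by blast
    have cA: "card A = sigma T" using A(3) st by simp
    obtain l where l: "l \<in> A" "card {e\<in>edges T. l \<in> e} \<le> 1"
      using critical_leaf[OF assms e A(1,2) cA] by blast
    \<comment> \<open>A critical edge makes \<open>sigma T\<close> positive, so the subtraction in
      \<open>?t\<close> does not truncate.\<close>
    have sig: "card A = Suc ?t" using cA e by (simp add: critical_edge_def)
    have finA: "finite A" using A(1) wf_finite_verts[OF wf] finite_subset by blast
    \<comment> \<open>So far \<open>l\<close> has degree at most one. Degree zero is impossible by
      minimality, as an isolated vertex could be dropped from \<open>A\<close>.\<close>
    have "{e\<in>edges T. l \<in> e} \<noteq> {}"
    proof
      assume none: "{e\<in>edges T. l \<in> e} = {}"
      have "card ((A - {l}) \<inter> f) = 1" if f: "f \<in> edges T" for f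
      proof -
        have "l \<notin> f" using none f by blast
        then have "(A - {l}) \<inter> f = A \<inter> f" by blast
        then show ?thesis using A(2)[OF f] by simp
      qed
      then have "card A \<le> card (A - {l})" using A(1) by (intro min) auto
      then show False using card_Diff1_less[OF finA l(1)] by simp
    qed
    moreover have "finite {e\<in>edges T. l \<in> e}" using wf_finite_edges[OF wf] by simp
    ultimately have "0 < card {e\<in>edges T. l \<in> e}" by (rule card_gt_0_iff[THEN iffD2, OF conjI])
    then have "card {e\<in>edges T. l \<in> e} = 1" using l(2) by linarith
    then obtain e0 where e0: "{e\<in>edges T. l \<in> e} = {e0}" by (rule card_1_singletonE)
    then have e0': "e0 \<in> edges T" "l \<in> e0" "\<And>e. e \<in> edges T \<Longrightarrow> l \<in> e \<Longrightarrow> e = e0" by blast+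
    obtain N where N: "\<And>n G. N \<le> n \<Longrightarrow> wf_graph (G :: nat graph) \<Longrightarrow> card (verts G) = n \<Longrightarrow>
      \<not> contains_copy G (tri_blowup T) \<Longrightarrow> card (triangles G) \<le> extremal_count n ?t"
      using eventually_triangles_le[OF assms A(1,2) sig l(1) e0'] by blast
    show ?thesis
    proof (intro exI[of _ "N + ?t"] allI impI)
      fix n assume n: "N + ?t \<le> n"
      let ?Q = "{card (triangles G) | G :: nat graph.
        wf_graph G \<and> verts G = {..<n} \<and> \<not> contains_copy G (tri_blowup T)}"
      \<comment> \<open>The edgeless graph shows that the maximum in \<open>ex_K3\<close> is over a
        nonempty set; it avoids the blowup because the edge \<open>e0\<close> exists.\<close>
      let ?G0 = "({..<n}, {}) :: nat graph"
      have "Inl ` e0 \<in> edges (tri_blowup T)" using e0'(1) by (auto simp: tri_blowup_def edges_def)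
      then have "\<not> contains_copy ?G0 (tri_blowup T)"
        by (auto simp: contains_copy_def edges_def[of ?G0])
      moreover have "wf_graph ?G0" "verts ?G0 = {..<n}" by (simp_all add: wf_graph_def verts_def edges_def)
      ultimately have ne: "?Q \<noteq> {}" by blast
      have "q \<le> card (S_bi n ?t)" if "q \<in> ?Q" for q
      proof -
        obtain G :: "nat graph" where G: "q = card (triangles G)" "wf_graph G" "verts G = {..<n}"
          "\<not> contains_copy G (tri_blowup T)" using \<open>q \<in> ?Q\<close> by blast
        have "card (triangles G) \<le> extremal_count n ?t" using n G by (intro N) simp_all
        also have "\<dots> \<le> card (S_bi n ?t)" using n by (intro extremal_count_le_S_bi) simp
        finally show ?thesis using G(1) by simp
      qed
      then show "ex_K3 n (tri_blowup T) \<le> card (S_bi n ?t)"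
        unfolding ex_K3_def using ne ex_K3_finite by (intro Max.boundedI)
    qed
  qed
  \<comment> \<open>The graph \<open>S_graph n ?t\<close> is itself a competitor. The condition
    \<open>?t < tau T\<close> is where the equality of \<open>tau\<close> and \<open>sigma\<close>
    enters.\<close>
  have lower: "card (S_bi n ?t) \<le> ex_K3 n (tri_blowup T)" if "?t < tau T" for n
    unfolding ex_K3_def S_bi_def
    using S_graph_wf S_graph_free[OF wf that] by (intro Max_ge[OF ex_K3_finite]) blast
  show ?thesis
  proof (intro conjI impI)
    assume "sigma T = tau_ind T \<and> (\<exists>e. critical_edge T e)"
    then show "\<exists>N. \<forall>n\<ge>N. ex_K3 n (tri_blowup T) \<le> card (S_bi n ?t)" using upper by blast
  next
    assume s: "strongly_edge_critical T"
    then obtain e where e: "critical_edge T e" by (auto simp: strongly_edge_critical_def)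
    have "sigma T = tau_ind T" "tau T = sigma T" using s by (simp_all add: strongly_edge_critical_def)
    moreover have "0 < sigma T" using e by (simp add: critical_edge_def)
    ultimately obtain N where "\<forall>n\<ge>N. ex_K3 n (tri_blowup T) \<le> card (S_bi n ?t)" "?t < tau T"
      using upper[OF _ e] by auto
    then show "\<exists>N. \<forall>n\<ge>N. ex_K3 n (tri_blowup T) = card (S_bi n ?t)"
      using lower by (meson antisym)
  qed
qed

end
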